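(* Let $\Bbbk$ be a field of characteristic $0$. The Witt algebra $\mathfrak W=\bigoplus_{n\in\mathbb Z}\Bbbk e_n$, with bracket $[e_i,e_j]=(j-i)e_{i+j}$, is amenable but not elementarily amenable; and moreover $\mathsf{EL}\neq\mathsf{SL}$.
   Context: $U(\mathfrak L)$ denotes the universal enveloping algebra with its usual Hopf algebra structure. A Lie algebra $\mathfrak L$ is amenable if for every finite-dimensional subspace $F\le\mathfrak L$ and every $\epsilon>0$ there exists a finite-dimensional subcoalgebra $E\le U(\mathfrak L)$ with $\dim\frac{E+FE}{E}<\epsilon\dim E$, where $FE$ is the linear span of $\{fe:f\in F,e\in E\}$. $\mathsf{EL}$, the class of elementarily amenable Lie algebras, is the smallest class of Lie algebras over $\Bbbk$ containing the finite-dimensional and the Abelian Lie algebras and closed under taking subalgebras, quotients, extensions, and directed unions. $\mathsf{SL}$ is the smallest class of Lie algebras over $\Bbbk$ containing the Lie algebras of subexponential growth and closed under the same four operations. For a Lie algebra $\mathfrak L$ generated by a finite-dimensional subspace $F$, put $B_1=F$ and $B_{n+1}=B_n+\langle[b,f]:b\in B_n,f\in F\rangle_{\Bbbk}$ for $n\ge1$; $\mathfrak L$ has subexponential growth if $\limsup_{n\to\infty}(\dim B_n)^{1/n}\le1$. *)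

theory Defs
  imports
    "Jordan_Normal_Form.VS_Connect"
    "HOL-Algebra.QuotRing"
    "HOL-Library.Poly_Mapping"
    "HOL-Library.Equipollence"
    "HOL-Library.Extended_Real"
    "HOL-Library.Liminf_Limsup"
begin

section \<open>Algebras over a field\<close>

text \<open>
  The ground field is a type \<open>'k\<close> of class \<^class>\<open>field\<close>, viewed as the record \<open>class_ring\<close>.
  All (not necessarily associative) \<open>'k\<close>-algebras are records of type \<open>('k, 'v) module\<close>, whose
  field \<^const>\<open>mult\<close> holds the product; for a Lie algebra it is the Lie bracket, so \<open>x \<otimes>\<^bsub>L\<^esub> y\<close> below
  reads $[x,y]$, and the field \<^const>\<open>one\<close> carries no information.
\<close>

abbreviation lin_subspace :: "'v set \<Rightarrow> ('k::field, 'v) module \<Rightarrow> bool" where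
  "lin_subspace W V \<equiv> VectorSpace.subspace class_ring W V"

abbreviation lin_span :: "('k::field, 'v) module \<Rightarrow> 'v set \<Rightarrow> 'v set" where
  "lin_span V S \<equiv> LinearCombinations.module.span class_ring V S"

abbreviation finite_dim :: "('k::field, 'v) module \<Rightarrow> bool" where
  "finite_dim V \<equiv> vectorspace.fin_dim class_ring V"

abbreviation dimension :: "('k::field, 'v) module \<Rightarrow> nat" where
  "dimension V \<equiv> vectorspace.dim class_ring V"

text \<open>
  The quotient of \<open>A\<close> by \<open>I\<close>: \<^const>\<open>FactRing\<close> together with the induced scalar multiplication.
  It serves for Lie algebras (\<open>I\<close> a Lie ideal), for associative algebras (\<open>I\<close> a two-sided ideal)
  and for bare vector spaces (\<open>I\<close> a subspace; the product on the quotient is then ignored).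
\<close>
definition quotient_alg :: "('k::field, 'v) module \<Rightarrow> 'v set \<Rightarrow> ('k, 'v set) module" where
  "quotient_alg A I = ring.extend (A Quot I)
     (module.fields (\<lambda>c X. \<Union>x\<in>X. I +>\<^bsub>A\<^esub> (c \<odot>\<^bsub>A\<^esub> x)))"

section \<open>Lie algebras\<close>

locale lie_algebra = vectorspace class_ring L
  for L :: "('k::field, 'v) module" (structure) +
  assumes bracket_closed:
      "x \<in> carrier L \<Longrightarrow> y \<in> carrier L \<Longrightarrow> x \<otimes>\<^bsub>L\<^esub> y \<in> carrier L"
    and bracket_add_left:
      "x \<in> carrier L \<Longrightarrow> y \<in> carrier L \<Longrightarrow> z \<in> carrier L \<Longrightarrow>
        (x \<oplus>\<^bsub>L\<^esub> y) \<otimes>\<^bsub>L\<^esub> z = (x \<otimes>\<^bsub>L\<^esub> z) \<oplus>\<^bsub>L\<^esub> (y \<otimes>\<^bsub>L\<^esub> z)"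
    and bracket_add_right:
      "x \<in> carrier L \<Longrightarrow> y \<in> carrier L \<Longrightarrow> z \<in> carrier L \<Longrightarrow>
        x \<otimes>\<^bsub>L\<^esub> (y \<oplus>\<^bsub>L\<^esub> z) = (x \<otimes>\<^bsub>L\<^esub> y) \<oplus>\<^bsub>L\<^esub> (x \<otimes>\<^bsub>L\<^esub> z)"
    and bracket_smult_left:
      "x \<in> carrier L \<Longrightarrow> y \<in> carrier L \<Longrightarrow> (c \<odot>\<^bsub>L\<^esub> x) \<otimes>\<^bsub>L\<^esub> y = c \<odot>\<^bsub>L\<^esub> (x \<otimes>\<^bsub>L\<^esub> y)"
    and bracket_smult_right:
      "x \<in> carrier L \<Longrightarrow> y \<in> carrier L \<Longrightarrow> x \<otimes>\<^bsub>L\<^esub> (c \<odot>\<^bsub>L\<^esub> y) = c \<odot>\<^bsub>L\<^esub> (x \<otimes>\<^bsub>L\<^esub> y)"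
    and bracket_alternating:
      "x \<in> carrier L \<Longrightarrow> x \<otimes>\<^bsub>L\<^esub> x = \<zero>\<^bsub>L\<^esub>"
    and jacobi:
      "x \<in> carrier L \<Longrightarrow> y \<in> carrier L \<Longrightarrow> z \<in> carrier L \<Longrightarrow>
        (x \<otimes>\<^bsub>L\<^esub> (y \<otimes>\<^bsub>L\<^esub> z)) \<oplus>\<^bsub>L\<^esub> ((y \<otimes>\<^bsub>L\<^esub> (z \<otimes>\<^bsub>L\<^esub> x)) \<oplus>\<^bsub>L\<^esub> (z \<otimes>\<^bsub>L\<^esub> (x \<otimes>\<^bsub>L\<^esub> y))) = \<zero>\<^bsub>L\<^esub>"

definition lie_subalgebra :: "'v set \<Rightarrow> ('k::field, 'v) module \<Rightarrow> bool" where
  "lie_subalgebra H L \<longleftrightarrow> lin_subspace H L \<and> (\<forall>x\<in>H. \<forall>y\<in>H. x \<otimes>\<^bsub>L\<^esub> y \<in> H)"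

definition lie_ideal :: "'v set \<Rightarrow> ('k::field, 'v) module \<Rightarrow> bool" where
  "lie_ideal I L \<longleftrightarrow> lin_subspace I L \<and> (\<forall>x\<in>carrier L. \<forall>y\<in>I. x \<otimes>\<^bsub>L\<^esub> y \<in> I)"

definition lie_isomorphic :: "('k::field, 'v) module \<Rightarrow> ('k, 'w) module \<Rightarrow> bool" where
  "lie_isomorphic L M \<longleftrightarrow> (\<exists>h \<in> LinearCombinations.module_hom class_ring L M.
     (\<forall>x\<in>carrier L. \<forall>y\<in>carrier L. h (x \<otimes>\<^bsub>L\<^esub> y) = h x \<otimes>\<^bsub>M\<^esub> h y) \<and>
     bij_betw h (carrier L) (carrier M))"

section \<open>Growth\<close>

text \<open>\<open>lie_ball L F n\<close> is $B_n$ for \<open>n \<ge> 1\<close>; the value at 0 is irrelevant.\<close>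
fun lie_ball :: "('k::field, 'v) module \<Rightarrow> 'v set \<Rightarrow> nat \<Rightarrow> 'v set" where
  "lie_ball L F 0 = {\<zero>\<^bsub>L\<^esub>}"
| "lie_ball L F (Suc 0) = F"
| "lie_ball L F (Suc (Suc n)) = lie_ball L F (Suc n) <+>\<^bsub>L\<^esub>
     lin_span L {b \<otimes>\<^bsub>L\<^esub> f | b f. b \<in> lie_ball L F (Suc n) \<and> f \<in> F}"

definition subexponential_growth :: "('k::field, 'v) module \<Rightarrow> bool" where
  "subexponential_growth L \<longleftrightarrow> lie_algebra L \<and>
     (\<exists>F. lin_subspace F L \<and> finite_dim (L\<lparr>carrier := F\<rparr>) \<and>
          \<Inter>{H. lie_subalgebra H L \<and> F \<subseteq> H} = carrier L \<and>
          limsup (\<lambda>n. ereal (root n (real (dimension (L\<lparr>carrier := lie_ball L F n\<rparr>))))) \<le> 1)"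

section \<open>Classes of Lie algebras\<close>

text \<open>
  The smallest class containing \<open>\<C>\<close> and closed under subalgebras, quotients, extensions and directed
  unions, among the Lie algebras whose elements are drawn from the type \<open>'u\<close>. The cosets forming
  a quotient do not have type \<open>'u\<close>, so quotients are taken up to isomorphism; with \<open>I = {\<zero>}\<close>
  the rule for quotients gives closure under isomorphism.
\<close>
inductive_set lie_closure :: "('k::field, 'u) module set \<Rightarrow> ('k, 'u) module set"
  for \<C> :: "('k::field, 'u) module set" where
  base: "L \<in> \<C> \<Longrightarrow> L \<in> lie_closure \<C>"
| subalgebra: "L \<in> lie_closure \<C> \<Longrightarrow> lie_subalgebra H L \<Longrightarrow> L\<lparr>carrier := H\<rparr> \<in> lie_closure \<C>"
| quotient: "L \<in> lie_closure \<C> \<Longrightarrow> lie_ideal I L \<Longrightarrow> lie_algebra Q \<Longrightarrow>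
    lie_isomorphic (quotient_alg L I) Q \<Longrightarrow> Q \<in> lie_closure \<C>"
| extension: "lie_algebra L \<Longrightarrow> lie_ideal I L \<Longrightarrow> L\<lparr>carrier := I\<rparr> \<in> lie_closure \<C> \<Longrightarrow>
    Q \<in> lie_closure \<C> \<Longrightarrow> lie_isomorphic (quotient_alg L I) Q \<Longrightarrow> L \<in> lie_closure \<C>"
| directed_union: "lie_algebra L \<Longrightarrow> D \<noteq> {} \<Longrightarrow> (\<And>H. H \<in> D \<Longrightarrow> lie_subalgebra H L) \<Longrightarrow>
    (\<And>H K. H \<in> D \<Longrightarrow> K \<in> D \<Longrightarrow> \<exists>M\<in>D. H \<subseteq> M \<and> K \<subseteq> M) \<Longrightarrow> \<Union>D = carrier L \<Longrightarrow>
    (\<And>H. H \<in> D \<Longrightarrow> L\<lparr>carrier := H\<rparr> \<in> lie_closure \<C>) \<Longrightarrow> L \<in> lie_closure \<C>"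

definition EL :: "('k::field, 'u) module set" where
  "EL = lie_closure
     {L. lie_algebra L \<and> (finite_dim L \<or> (\<forall>x\<in>carrier L. \<forall>y\<in>carrier L. x \<otimes>\<^bsub>L\<^esub> y = \<zero>\<^bsub>L\<^esub>))}"

definition SL :: "('k::field, 'u) module set" where
  "SL = lie_closure {L. subexponential_growth L}"

text \<open>
  Membership in the class $\mathsf{EL}$ formed inside the universe \<open>'u\<close>, for a Lie algebra
  whose elements may have another type.
\<close>
definition elementarily_amenable :: "'u itself \<Rightarrow> ('k::field, 'v) module \<Rightarrow> bool" where
  "elementarily_amenable _ L \<longleftrightarrow> (\<exists>L' \<in> (EL :: ('k, 'u) module set). lie_isomorphic L L')"

section \<open>Enveloping algebra and coproduct\<close>

definition monoid_algebra :: "('g, 'm) monoid_scheme \<Rightarrow> ('k::field, 'g \<Rightarrow>\<^sub>0 'k) module" where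
  "monoid_algebra G =
     \<lparr>carrier = {f. Poly_Mapping.keys f \<subseteq> carrier G},
      mult = (\<lambda>f g. \<Sum>p\<in>Poly_Mapping.keys f. \<Sum>q\<in>Poly_Mapping.keys g.
                Poly_Mapping.single (p \<otimes>\<^bsub>G\<^esub> q) (Poly_Mapping.lookup f p * Poly_Mapping.lookup g q)),
      one = Poly_Mapping.single \<one>\<^bsub>G\<^esub> 1, zero = 0, add = (+),
      smult = (\<lambda>c. Poly_Mapping.map ((*) c))\<rparr>"

definition free_monoid :: "'a set \<Rightarrow> 'a list monoid" where
  "free_monoid X = \<lparr>carrier = lists X, mult = (@), one = []\<rparr>"

text \<open>
  $U(L)$ is the free associative unital algebra on the set \<open>carrier L\<close>, modulo the two-sided ideal
  making the inclusion of \<open>L\<close> linear (which gives the tensor algebra $T(L)$) and imposing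
  $xy - yx = [x,y]$.
\<close>
definition envelope_relations :: "('k::field, 'v) module \<Rightarrow> ('v list \<Rightarrow>\<^sub>0 'k) set" where
  "envelope_relations L =
     {Poly_Mapping.single [x \<oplus>\<^bsub>L\<^esub> y] 1 - Poly_Mapping.single [x] 1 - Poly_Mapping.single [y] 1 | x y.
        x \<in> carrier L \<and> y \<in> carrier L} \<union>
     {Poly_Mapping.single [c \<odot>\<^bsub>L\<^esub> x] 1 - Poly_Mapping.single [x] c | c x. x \<in> carrier L} \<union>
     {Poly_Mapping.single [x, y] 1 - Poly_Mapping.single [y, x] 1 - Poly_Mapping.single [x \<otimes>\<^bsub>L\<^esub> y] 1 | x y.
        x \<in> carrier L \<and> y \<in> carrier L}"

definition envelope_ideal :: "('k::field, 'v) module \<Rightarrow> ('v list \<Rightarrow>\<^sub>0 'k) set" where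
  "envelope_ideal L =
     genideal (monoid_algebra (free_monoid (carrier L)) :: ('k, _) module) (envelope_relations L)"

definition envelope :: "('k::field, 'v) module \<Rightarrow> ('k, ('v list \<Rightarrow>\<^sub>0 'k) set) module" where
  "envelope L = quotient_alg (monoid_algebra (free_monoid (carrier L))) (envelope_ideal L)"

definition envelope_incl :: "('k::field, 'v) module \<Rightarrow> 'v \<Rightarrow> ('v list \<Rightarrow>\<^sub>0 'k) set" where
  "envelope_incl L x =
     envelope_ideal L +>\<^bsub>(monoid_algebra (free_monoid (carrier L)) :: ('k, _) module)\<^esub>
       Poly_Mapping.single [x] 1"

text \<open>
  $A \otimes B$ is the vector space with basis \<open>carrier A \<times> carrier B\<close> modulo the span of the
  bilinearity relations. Taking for the former the monoid algebra of the multiplicative monoid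
  \<open>A \<times>\<times> B\<close>, the induced product is the usual one, $(a \otimes b)(a' \otimes b') = aa' \otimes bb'$.
\<close>
definition tensor_relations ::
    "('k::field, 'a) module \<Rightarrow> ('k, 'b) module \<Rightarrow> ('a \<times> 'b \<Rightarrow>\<^sub>0 'k) set" where
  "tensor_relations A B =
     {Poly_Mapping.single (a \<oplus>\<^bsub>A\<^esub> a', b) 1 - Poly_Mapping.single (a, b) 1 - Poly_Mapping.single (a', b) 1 | a a' b.
        a \<in> carrier A \<and> a' \<in> carrier A \<and> b \<in> carrier B} \<union>
     {Poly_Mapping.single (a, b \<oplus>\<^bsub>B\<^esub> b') 1 - Poly_Mapping.single (a, b) 1 - Poly_Mapping.single (a, b') 1 | a b b'.
        a \<in> carrier A \<and> b \<in> carrier B \<and> b' \<in> carrier B} \<union>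
     {Poly_Mapping.single (c \<odot>\<^bsub>A\<^esub> a, b) 1 - Poly_Mapping.single (a, b) c | c a b.
        a \<in> carrier A \<and> b \<in> carrier B} \<union>
     {Poly_Mapping.single (a, c \<odot>\<^bsub>B\<^esub> b) 1 - Poly_Mapping.single (a, b) c | c a b.
        a \<in> carrier A \<and> b \<in> carrier B}"

definition tensor_kernel ::
    "('k::field, 'a) module \<Rightarrow> ('k, 'b) module \<Rightarrow> ('a \<times> 'b \<Rightarrow>\<^sub>0 'k) set" where
  "tensor_kernel A B = lin_span (monoid_algebra (A \<times>\<times> B)) (tensor_relations A B)"

definition tensor ::
    "('k::field, 'a) module \<Rightarrow> ('k, 'b) module \<Rightarrow> ('k, ('a \<times> 'b \<Rightarrow>\<^sub>0 'k) set) module" where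
  "tensor A B = quotient_alg (monoid_algebra (A \<times>\<times> B)) (tensor_kernel A B)"

definition pure_tensor ::
    "('k::field, 'a) module \<Rightarrow> ('k, 'b) module \<Rightarrow> 'a \<Rightarrow> 'b \<Rightarrow> ('a \<times> 'b \<Rightarrow>\<^sub>0 'k) set" where
  "pure_tensor A B a b =
     tensor_kernel A B +>\<^bsub>(monoid_algebra (A \<times>\<times> B) :: ('k, _) module)\<^esub> Poly_Mapping.single (a, b) 1"

text \<open>
  The coproduct of $U(L)$ is the homomorphism of unital algebras $U(L) \to U(L) \otimes U(L)$ with
  $\Delta(x) = x \otimes 1 + 1 \otimes x$ for $x \in L$. It is unique on \<open>carrier (envelope L)\<close>; the
  choice only affects its values elsewhere, which are never used.
\<close>
definition comult ::
    "('k::field, 'v) module \<Rightarrow> ('v list \<Rightarrow>\<^sub>0 'k) set \<Rightarrow>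
       (('v list \<Rightarrow>\<^sub>0 'k) set \<times> ('v list \<Rightarrow>\<^sub>0 'k) set \<Rightarrow>\<^sub>0 'k) set" where
  "comult L = (let U = envelope L; T = tensor U U in
     SOME \<Delta>. \<Delta> \<in> LinearCombinations.module_hom class_ring U T \<and> \<Delta> \<in> Ring.ring_hom U T \<and>
       (\<forall>x\<in>carrier L. \<Delta> (envelope_incl L x) =
          pure_tensor U U (envelope_incl L x) \<one>\<^bsub>U\<^esub> \<oplus>\<^bsub>T\<^esub> pure_tensor U U \<one>\<^bsub>U\<^esub> (envelope_incl L x)))"

definition subcoalgebra :: "('v list \<Rightarrow>\<^sub>0 'k) set set \<Rightarrow> ('k::field, 'v) module \<Rightarrow> bool" where
  "subcoalgebra E L \<longleftrightarrow> lin_subspace E (envelope L) \<and>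
     comult L ` E \<subseteq> lin_span (tensor (envelope L) (envelope L))
       {pure_tensor (envelope L) (envelope L) a b | a b. a \<in> E \<and> b \<in> E}"

section \<open>Amenability\<close>

definition lie_translate ::
    "('k::field, 'v) module \<Rightarrow> 'v set \<Rightarrow> ('v list \<Rightarrow>\<^sub>0 'k) set set \<Rightarrow> ('v list \<Rightarrow>\<^sub>0 'k) set set" where
  "lie_translate L F E =
     lin_span (envelope L) {envelope_incl L f \<otimes>\<^bsub>envelope L\<^esub> e | f e. f \<in> F \<and> e \<in> E}"

definition lie_amenable :: "('k::field, 'v) module \<Rightarrow> bool" where
  "lie_amenable L \<longleftrightarrow> lie_algebra L \<and>
     (\<forall>F (\<epsilon>::real). lin_subspace F L \<and> finite_dim (L\<lparr>carrier := F\<rparr>) \<and> \<epsilon> > 0 \<longrightarrow>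
       (\<exists>E. subcoalgebra E L \<and> finite_dim ((envelope L)\<lparr>carrier := E\<rparr>) \<and>
          real (dimension (quotient_alg
              ((envelope L)\<lparr>carrier := E <+>\<^bsub>envelope L\<^esub> lie_translate L F E\<rparr>) E))
            < \<epsilon> * real (dimension ((envelope L)\<lparr>carrier := E\<rparr>))))"

section \<open>The Witt algebra\<close>

text \<open>The basis vector $e_n$ is \<open>Poly_Mapping.single n 1\<close>.\<close>
definition witt :: "('k::field, int \<Rightarrow>\<^sub>0 'k) module" where
  "witt =
     \<lparr>carrier = UNIV,
      mult = (\<lambda>f g. \<Sum>i\<in>Poly_Mapping.keys f. \<Sum>j\<in>Poly_Mapping.keys g.
                Poly_Mapping.single (i + j) (of_int (j - i) * Poly_Mapping.lookup f i * Poly_Mapping.lookup g j)),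
      one = undefined, zero = 0, add = (+),
      smult = (\<lambda>c. Poly_Mapping.map ((*) c))\<rparr>"

end

(* The Witt algebra W is amenable because its enveloping algebra is filtered by the spans E_n of
   the words e_i1 ... e_ik with sum (|i_j| + 1) <= n. Each E_n is a subcoalgebra, since the
   generators are primitive, and left multiplication by finitely many of them maps E_n into
   E_(n+c). Sorting a word only creates shorter words of no larger weight, so the sorted words
   span E_n; no linear independence (Poincare-Birkhoff-Witt) is needed. Sorted words are multisets,
   whose number grows subexponentially in n, so dim E_(n+c) < (1 + eps) dim E_n for some n.

   For the second claim, call W a section of L if W is a quotient of a subalgebra of L. The Lie
   algebras without W as a section contain the finite-dimensional and the Abelian ones and are
   closed under the four operations: W is simple, which handles extensions, and finitely generated,
   which handles directed unions. So W is not elementarily amenable, whereas it is generated by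
   e_-2, ..., e_2 with balls of linearly growing dimension, so it belongs to SL. *)
theory Submission
  imports Defs Complex_Main "HOL-Library.Multiset" "HOL-Library.FuncSet"
begin

section \<open>Subspaces and dimension\<close>

text \<open>The coproduct is given by a choice operator, so nothing is known about it until some map
  with the required properties has been built. Hence the universal property of U(L) and the algebra
  structure on U(L) tensor U(L) have to be established before any subspace can be recognised as a
  subcoalgebra. The growth criterion uses dim E_n only through an upper bound and through
  positivity. The upper bound is a count of spanning words, and positivity comes down to 1 being
  nonzero in U(W). The count is compared, for each x in (0,1), with a convergent product, which
  bounds the product of the n-th count and x^n without any partition asymptotics. Characteristic 0
  enters through the structure constants j - i, which vanish only for i = j: so ad e_0 has pairwise
  distinct eigenvalues, which yields simplicity, and a few basis vectors generate W. Sections are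
  excluded, rather than subalgebras isomorphic to W, because the excluded property must pass to
  quotients as well as to subalgebras.\<close>

lemma lin_subspaceI:
  fixes V :: "('k::field, 'v) module"
  assumes "vectorspace class_ring V" "W \<subseteq> carrier V" "\<zero>\<^bsub>V\<^esub> \<in> W"
    and "\<And>x y. x \<in> W \<Longrightarrow> y \<in> W \<Longrightarrow> x \<oplus>\<^bsub>V\<^esub> y \<in> W"
    and "\<And>c x. x \<in> W \<Longrightarrow> c \<odot>\<^bsub>V\<^esub> x \<in> W"
  shows "lin_subspace W V"
proof -
  interpret vectorspace class_ring V by fact
  show ?thesis
    by (intro subspace.intro assms(1) submodule.intro) (use assms module_axioms in auto)
qed

lemma lin_subspaceD:
  fixes V :: "('k::field, 'v) module"
  assumes "lin_subspace W V"
  shows "vectorspace class_ring V" "W \<subseteq> carrier V" "\<zero>\<^bsub>V\<^esub> \<in> W"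
    "x \<in> W \<Longrightarrow> y \<in> W \<Longrightarrow> x \<oplus>\<^bsub>V\<^esub> y \<in> W" "x \<in> W \<Longrightarrow> c \<odot>\<^bsub>V\<^esub> x \<in> W"
    "x \<in> W \<Longrightarrow> \<ominus>\<^bsub>V\<^esub> x \<in> W" "x \<in> W \<Longrightarrow> y \<in> W \<Longrightarrow> x \<ominus>\<^bsub>V\<^esub> y \<in> W"
proof -
  interpret subspace class_ring W V by fact
  interpret submodule class_ring W V by (rule submod)
  interpret vectorspace class_ring V by (rule vs)
  show "vectorspace class_ring V" "W \<subseteq> carrier V" "\<zero>\<^bsub>V\<^esub> \<in> W"
    and add: "x \<in> W \<Longrightarrow> y \<in> W \<Longrightarrow> x \<oplus>\<^bsub>V\<^esub> y \<in> W" for x y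
    using vs subset by auto
  show smult: "x \<in> W \<Longrightarrow> c \<odot>\<^bsub>V\<^esub> x \<in> W" for x c by auto
  have eq: "\<ominus>\<^bsub>V\<^esub> x = (- 1) \<odot>\<^bsub>V\<^esub> x" if "x \<in> W" for x
    using smult_l_minus[of 1 x] smult_one[of x] that subset by (auto simp: class_ring_simps)
  show neg: "x \<in> W \<Longrightarrow> \<ominus>\<^bsub>V\<^esub> x \<in> W" for x
    using smult eq by simp
  show "x \<in> W \<Longrightarrow> y \<in> W \<Longrightarrow> x \<ominus>\<^bsub>V\<^esub> y \<in> W"
    using add neg by (simp add: a_minus_def)
qed

lemma lin_subspace_carrier: "vectorspace class_ring V \<Longrightarrow> lin_subspace (carrier V) V"
  for V :: "('k::field, 'v) module"
proof -
  assume a: "vectorspace class_ring V"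
  then interpret vectorspace class_ring V .
  show ?thesis by (rule lin_subspaceI[OF a]) auto
qed

lemma lin_span_subspace:
  fixes V :: "('k::field, 'v) module"
  assumes "vectorspace class_ring V" "S \<subseteq> carrier V"
  shows "lin_subspace (lin_span V S) V"
  using vectorspace.span_is_subspace[OF assms] .

lemma lin_span_superset:
  fixes V :: "('k::field, 'v) module"
  assumes "vectorspace class_ring V" "S \<subseteq> carrier V"
  shows "S \<subseteq> lin_span V S"
proof -
  interpret vectorspace class_ring V by fact
  show ?thesis using in_own_span[OF assms(2)] .
qed

lemma lin_span_minimal:
  fixes V :: "('k::field, 'v) module"
  assumes "lin_subspace W V" "S \<subseteq> W"
  shows "lin_span V S \<subseteq> W"
proof -
  interpret vectorspace class_ring V using lin_subspaceD(1)[OF assms(1)] .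
  show ?thesis using span_is_subset[OF assms(2)] assms(1) by simp
qed

lemma lin_span_mono:
  fixes V :: "('k::field, 'v) module"
  assumes "vectorspace class_ring V" "S \<subseteq> T"
  shows "lin_span V S \<subseteq> lin_span V T"
proof -
  interpret vectorspace class_ring V by fact
  show ?thesis using span_is_monotone[OF assms(2)] .
qed

lemma lin_span_restrict:
  fixes V :: "('k::field, 'v) module"
  assumes "lin_subspace W V" "S \<subseteq> W"
  shows "lin_span (V\<lparr>carrier := W\<rparr>) S = lin_span V S"
proof -
  interpret vectorspace class_ring V using lin_subspaceD(1)[OF assms(1)] .
  show ?thesis using span_li_not_depend(1)[OF assms(2)] assms(1) by simp
qed

lemma lin_subspace_restrict:
  fixes V :: "('k::field, 'v) module"
  assumes "lin_subspace W V" "lin_subspace X V" "X \<subseteq> W"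
  shows "lin_subspace X (V\<lparr>carrier := W\<rparr>)"
  using vectorspace.subspace_is_vs[OF lin_subspaceD(1)[OF assms(1)] assms(1)]
  by (rule lin_subspaceI) (use assms lin_subspaceD[OF assms(2)] in auto)

text \<open>A set independent in \<open>W\<close> is independent in \<open>V\<close>, so its size is
  at most the dimension of \<open>V\<close>. An independent subset of \<open>W\<close> of largest
  possible size is then finite and maximal, hence generates \<open>W\<close>.\<close>

lemma finite_dim_subspace:
  fixes V :: "('k::field, 'v) module"
  assumes "finite_dim V" "lin_subspace W V"
  shows "finite_dim (V\<lparr>carrier := W\<rparr>)"
proof -
  interpret V: vectorspace class_ring V using lin_subspaceD(1)[OF assms(2)] .
  interpret W: vectorspace class_ring "V\<lparr>carrier := W\<rparr>"
    using V.subspace_is_vs[OF assms(2)] .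
  have sub: "W \<subseteq> carrier V" using lin_subspaceD[OF assms(2)] by auto
  define P where "P A \<longleftrightarrow> finite A \<and> A \<subseteq> W \<and> W.lin_indpt A" for A
  have bd: "card A \<le> V.dim \<and> finite A" if "W.lin_indpt A" "A \<subseteq> W" for A
    using V.li_le_dim[OF assms(1), of A] that sub
      V.span_li_not_depend(2)[OF that(2)] assms(2) by auto
  have "P {}" by (auto simp: P_def W.lin_dep_def)
  have "\<exists>A. P A \<and> (\<forall>B. P B \<longrightarrow> card B \<le> card A)"
    by (rule ex_has_greatest_nat[where b = "V.dim + 1" and P = P and k = "{}", OF \<open>P {}\<close>]) (use bd in \<open>simp add: P_def less_Suc_eq_le\<close>)
  then obtain A where A: "P A" and max: "\<And>B. P B \<Longrightarrow> card B \<le> card A" by blast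
  have "maximal A (\<lambda>S. S \<subseteq> carrier (V\<lparr>carrier := W\<rparr>) \<and> W.lin_indpt S)"
    unfolding maximal_def
  proof (intro conjI allI impI)
    show "A \<subseteq> carrier (V\<lparr>carrier := W\<rparr>)" "W.lin_indpt A" using A by (auto simp: P_def)
    fix B assume B: "A \<subseteq> B \<and> B \<subseteq> carrier (V\<lparr>carrier := W\<rparr>) \<and> W.lin_indpt B"
    then have fB: "finite B" using bd by auto
    then have "P B" using B by (auto simp: P_def)
    then show "B = A" using max B fB by (metis card_seteq)
  qed
  then have "W.gen_set A" by (rule W.max_li_is_gen)
  then show ?thesis using A unfolding W.fin_dim_def P_def by auto
qed

lemma dimension_subspace_le:
  fixes V :: "('k::field, 'v) module"
  assumes "finite_dim V" "lin_subspace W V"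
  shows "dimension (V\<lparr>carrier := W\<rparr>) \<le> dimension V"
proof -
  interpret V: vectorspace class_ring V using lin_subspaceD(1)[OF assms(2)] .
  interpret W: vectorspace class_ring "V\<lparr>carrier := W\<rparr>"
    using V.subspace_is_vs[OF assms(2)] .
  have sub: "W \<subseteq> carrier V" using lin_subspaceD[OF assms(2)] by auto
  obtain b where b: "finite b" "W.basis b"
    using W.finite_basis_exists[OF finite_dim_subspace[OF assms]] by auto
  then have bW: "b \<subseteq> W" "W.lin_indpt b" unfolding W.basis_def by auto
  then have "V.lin_indpt b" using V.span_li_not_depend(2)[OF bW(1)] assms(2) by auto
  then show ?thesis using V.li_le_dim(2)[OF assms(1), of b] bW sub W.dim_basis[OF b] by auto
qed

lemma
  fixes V :: "('k::field, 'v) module"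
  assumes "vectorspace class_ring V" "finite S" "S \<subseteq> carrier V"
  shows finite_dim_lin_span: "finite_dim (V\<lparr>carrier := lin_span V S\<rparr>)"
    and dimension_lin_span: "dimension (V\<lparr>carrier := lin_span V S\<rparr>) \<le> card S"
proof -
  interpret V: vectorspace class_ring V by fact
  have sub: "lin_subspace (lin_span V S) V" by (rule lin_span_subspace[OF assms(1,3)])
  interpret W: vectorspace class_ring "V\<lparr>carrier := lin_span V S\<rparr>"
    using V.subspace_is_vs[OF sub] .
  have S: "S \<subseteq> lin_span V S" by (rule lin_span_superset[OF assms(1,3)])
  have gen: "W.gen_set S"
    using lin_span_restrict[OF sub S] by simp
  show "W.fin_dim" using gen assms(2) S unfolding W.fin_dim_def by auto
  show "W.dim \<le> card S" using W.gen_ge_dim[OF assms(2) _ gen] S by auto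
qed

lemma
  fixes V :: "('k::field, 'v) module"
  assumes "lin_subspace W V" "lin_subspace X V" "X \<subseteq> W" "finite_dim (V\<lparr>carrier := W\<rparr>)"
  shows finite_dim_mono: "finite_dim (V\<lparr>carrier := X\<rparr>)"
    and dimension_mono: "dimension (V\<lparr>carrier := X\<rparr>) \<le> dimension (V\<lparr>carrier := W\<rparr>)"
  using finite_dim_subspace[OF assms(4) lin_subspace_restrict[OF assms(1-3)]]
    dimension_subspace_le[OF assms(4) lin_subspace_restrict[OF assms(1-3)]]
  by simp_all

text \<open>All axioms except one are identities or closure conditions, so they are inherited by the
  image of any map that respects the operations; an additive inverse of an image is the image of the
  inverse. The target is an arbitrary record, which makes this usable for quotients and, through the
  analogous lemmas for algebras, for transported copies.\<close>

lemma vectorspace_surj: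
  fixes V :: "('k::field, 'v) module" and Q :: "('k, 'w) module"
  assumes V: "vectorspace class_ring V" and surj: "\<pi> ` carrier V = carrier Q"
    and add: "\<And>x y. x \<in> carrier V \<Longrightarrow> y \<in> carrier V \<Longrightarrow> \<pi> (x \<oplus>\<^bsub>V\<^esub> y) = \<pi> x \<oplus>\<^bsub>Q\<^esub> \<pi> y"
    and smult: "\<And>c x. x \<in> carrier V \<Longrightarrow> \<pi> (c \<odot>\<^bsub>V\<^esub> x) = c \<odot>\<^bsub>Q\<^esub> \<pi> x"
    and zero: "\<pi> \<zero>\<^bsub>V\<^esub> = \<zero>\<^bsub>Q\<^esub>"
  shows "vectorspace class_ring Q"
proof -
  interpret vectorspace class_ring V by fact
  have Q: "\<exists>x\<in>carrier V. v = \<pi> x" if "v \<in> carrier Q" for v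
    using that unfolding surj[symmetric] by blast
  have mem: "\<pi> x \<in> carrier Q" if "x \<in> carrier V" for x by (simp add: surj[symmetric] that)
  show ?thesis
  proof (rule vs_criteria)
    show "field (class_ring :: 'k ring)" by (rule class_field)
    show "\<zero>\<^bsub>Q\<^esub> \<in> carrier Q" using mem[of "\<zero>\<^bsub>V\<^esub>"] zero by auto
    show "\<forall>v w. v \<in> carrier Q \<and> w \<in> carrier Q \<longrightarrow> v \<oplus>\<^bsub>Q\<^esub> w \<in> carrier Q"
      by (auto dest!: Q simp: add[symmetric] mem)
    show "\<forall>v\<in>carrier Q. \<exists>neg_v\<in>carrier Q. v \<oplus>\<^bsub>Q\<^esub> neg_v = \<zero>\<^bsub>Q\<^esub>"
    proof
      fix v assume "v \<in> carrier Q"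
      then obtain x where "x \<in> carrier V" "v = \<pi> x" using Q by blast
      then show "\<exists>neg_v\<in>carrier Q. v \<oplus>\<^bsub>Q\<^esub> neg_v = \<zero>\<^bsub>Q\<^esub>"
        by (intro bexI[of _ "\<pi> (\<ominus>\<^bsub>V\<^esub> x)"]) (simp_all add: add[symmetric] mem zero M.r_neg)
    qed
    show "\<forall>c v. c \<in> carrier class_ring \<and> v \<in> carrier Q \<longrightarrow> c \<odot>\<^bsub>Q\<^esub> v \<in> carrier Q"
      by (auto dest!: Q simp: smult[symmetric] mem)
    show "\<forall>v w. v \<in> carrier Q \<and> w \<in> carrier Q \<longrightarrow> v \<oplus>\<^bsub>Q\<^esub> w = w \<oplus>\<^bsub>Q\<^esub> v"
      by (auto dest!: Q simp: add[symmetric] M.a_comm)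
    show "\<forall>v w x. v \<in> carrier Q \<and> w \<in> carrier Q \<and> x \<in> carrier Q \<longrightarrow> v \<oplus>\<^bsub>Q\<^esub> w \<oplus>\<^bsub>Q\<^esub> x = v \<oplus>\<^bsub>Q\<^esub> (w \<oplus>\<^bsub>Q\<^esub> x)"
    proof (intro allI impI)
      fix v w x assume "v \<in> carrier Q \<and> w \<in> carrier Q \<and> x \<in> carrier Q"
      then obtain a b c where "a \<in> carrier V" "b \<in> carrier V" "c \<in> carrier V" "v = \<pi> a" "w = \<pi> b" "x = \<pi> c"
        using Q by metis
      then show "v \<oplus>\<^bsub>Q\<^esub> w \<oplus>\<^bsub>Q\<^esub> x = v \<oplus>\<^bsub>Q\<^esub> (w \<oplus>\<^bsub>Q\<^esub> x)" by (simp add: add[symmetric] M.a_assoc)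
    qed
    show "\<forall>v\<in>carrier Q. v \<oplus>\<^bsub>Q\<^esub> \<zero>\<^bsub>Q\<^esub> = v"
      by (auto dest!: Q simp: add[symmetric] zero[symmetric])
    show "\<forall>a b v. a \<in> carrier class_ring \<and> b \<in> carrier class_ring \<and> v \<in> carrier Q \<longrightarrow>
        (a \<otimes>\<^bsub>class_ring\<^esub> b) \<odot>\<^bsub>Q\<^esub> v = a \<odot>\<^bsub>Q\<^esub> (b \<odot>\<^bsub>Q\<^esub> v)"
    proof (intro allI impI)
      fix a b v assume "a \<in> carrier (class_ring :: 'k ring) \<and> b \<in> carrier (class_ring :: 'k ring) \<and> v \<in> carrier Q"
      then obtain x where "x \<in> carrier V" "v = \<pi> x" using Q by blast
      then show "(a \<otimes>\<^bsub>class_ring\<^esub> b) \<odot>\<^bsub>Q\<^esub> v = a \<odot>\<^bsub>Q\<^esub> (b \<odot>\<^bsub>Q\<^esub> v)"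
        using smult_assoc1[of a b x] smult_closed[of b x] by (simp add: smult[symmetric])
    qed
    show "\<forall>v\<in>carrier Q. \<one>\<^bsub>class_ring\<^esub> \<odot>\<^bsub>Q\<^esub> v = v"
      using smult_one by (auto dest!: Q simp: smult[symmetric])
    show "\<forall>a b v. a \<in> carrier class_ring \<and> b \<in> carrier class_ring \<and> v \<in> carrier Q \<longrightarrow>
        (a \<oplus>\<^bsub>class_ring\<^esub> b) \<odot>\<^bsub>Q\<^esub> v = a \<odot>\<^bsub>Q\<^esub> v \<oplus>\<^bsub>Q\<^esub> b \<odot>\<^bsub>Q\<^esub> v"
    proof (intro allI impI)
      fix a b v assume "a \<in> carrier (class_ring :: 'k ring) \<and> b \<in> carrier (class_ring :: 'k ring) \<and> v \<in> carrier Q"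
      then obtain x where "x \<in> carrier V" "v = \<pi> x" using Q by blast
      then show "(a \<oplus>\<^bsub>class_ring\<^esub> b) \<odot>\<^bsub>Q\<^esub> v = a \<odot>\<^bsub>Q\<^esub> v \<oplus>\<^bsub>Q\<^esub> b \<odot>\<^bsub>Q\<^esub> v"
        using smult_l_distr[of a b x] smult_closed[of b x] smult_closed[of a x]
        by (simp add: smult[symmetric] add[symmetric])
    qed
    show "\<forall>a v w. a \<in> carrier class_ring \<and> v \<in> carrier Q \<and> w \<in> carrier Q \<longrightarrow>
        a \<odot>\<^bsub>Q\<^esub> (v \<oplus>\<^bsub>Q\<^esub> w) = a \<odot>\<^bsub>Q\<^esub> v \<oplus>\<^bsub>Q\<^esub> a \<odot>\<^bsub>Q\<^esub> w"
    proof (intro allI impI)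
      fix a v w assume "a \<in> carrier (class_ring :: 'k ring) \<and> v \<in> carrier Q \<and> w \<in> carrier Q"
      then obtain x y where "x \<in> carrier V" "v = \<pi> x" "y \<in> carrier V" "w = \<pi> y" using Q by metis
      then show "a \<odot>\<^bsub>Q\<^esub> (v \<oplus>\<^bsub>Q\<^esub> w) = a \<odot>\<^bsub>Q\<^esub> v \<oplus>\<^bsub>Q\<^esub> a \<odot>\<^bsub>Q\<^esub> w"
        using smult_r_distr[of a x y] smult_closed[of a x] smult_closed[of a y]
        by (simp add: smult[symmetric] add[symmetric])
    qed
  qed
qed

section \<open>Quotients and associative algebras\<close>

lemma quotient_alg_simps:
  fixes V :: "('k::field, 'v) module"
  shows "carrier (quotient_alg V N) = a_rcosets\<^bsub>V\<^esub> N"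
    "mult (quotient_alg V N) = rcoset_mult V N"
    "one (quotient_alg V N) = N +>\<^bsub>V\<^esub> \<one>\<^bsub>V\<^esub>"
    "zero (quotient_alg V N) = N"
    "add (quotient_alg V N) = set_add V"
    "smult (quotient_alg V N) = (\<lambda>c X. \<Union>x\<in>X. N +>\<^bsub>V\<^esub> (c \<odot>\<^bsub>V\<^esub> x))"
  by (simp_all add: quotient_alg_def FactRing_def ring.defs module.defs)

context
  fixes V :: "('k::field, 'v) module" and N :: "'v set"
  assumes N: "lin_subspace N V"
begin

interpretation vectorspace class_ring V
  using lin_subspaceD(1)[OF N] .

lemma lin_subspace_abelian_subgroup: "abelian_subgroup N V"
proof (rule abelian_subgroupI3)
  show "additive_subgroup N V"
  proof (rule additive_subgroup.intro, rule subgroup.intro)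
    show "inv\<^bsub>add_monoid V\<^esub> x \<in> N" if "x \<in> N" for x
      using lin_subspaceD(6)[OF N that] by (simp add: a_inv_def)
  qed (use lin_subspaceD[OF N] in auto)
qed (rule M.abelian_group_axioms)

interpretation abelian_subgroup N V
  by (rule lin_subspace_abelian_subgroup)

lemma quotient_alg_eq_iff:
  assumes "x \<in> carrier V" "y \<in> carrier V"
  shows "N +>\<^bsub>V\<^esub> x = N +>\<^bsub>V\<^esub> y \<longleftrightarrow> x \<ominus>\<^bsub>V\<^esub> y \<in> N"
proof -
  have "N +>\<^bsub>V\<^esub> x = N +>\<^bsub>V\<^esub> y \<longleftrightarrow> x \<in> N +>\<^bsub>V\<^esub> y"
    using a_repr_independence'[of x y] a_rcos_self[OF assms(1)] assms(2) by auto
  also have "\<dots> \<longleftrightarrow> x \<ominus>\<^bsub>V\<^esub> y \<in> N"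
    using a_rcos_module[OF assms(2,1)] by (simp add: a_minus_def)
  finally show ?thesis .
qed

lemma quotient_alg_surj: "(+>\<^bsub>V\<^esub>) N ` carrier V = carrier (quotient_alg V N)"
  by (auto simp: quotient_alg_simps A_RCOSETS_def')

lemma quotient_alg_zero: "N +>\<^bsub>V\<^esub> \<zero>\<^bsub>V\<^esub> = \<zero>\<^bsub>quotient_alg V N\<^esub>"
  by (simp add: quotient_alg_simps a_subset)

lemma quotient_alg_add:
  assumes "x \<in> carrier V" "y \<in> carrier V"
  shows "N +>\<^bsub>V\<^esub> (x \<oplus>\<^bsub>V\<^esub> y) = (N +>\<^bsub>V\<^esub> x) \<oplus>\<^bsub>quotient_alg V N\<^esub> (N +>\<^bsub>V\<^esub> y)"
  using assms by (simp add: quotient_alg_simps a_rcos_sum)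

text \<open>A coset is scaled by taking a union over all its representatives. Two representatives
  differ by an element of \<open>N\<close>, which stays in \<open>N\<close> after scaling, so all
  members of the union are one and the same coset.\<close>

lemma quotient_alg_smult:
  assumes x: "x \<in> carrier V"
  shows "N +>\<^bsub>V\<^esub> (c \<odot>\<^bsub>V\<^esub> x) = c \<odot>\<^bsub>quotient_alg V N\<^esub> (N +>\<^bsub>V\<^esub> x)"
proof -
  have "N +>\<^bsub>V\<^esub> (c \<odot>\<^bsub>V\<^esub> z) = N +>\<^bsub>V\<^esub> (c \<odot>\<^bsub>V\<^esub> x)" if z: "z \<in> N +>\<^bsub>V\<^esub> x" for z
  proof -
    have zc: "z \<in> carrier V" using a_elemrcos_carrier[OF x z] .
    have "z \<ominus>\<^bsub>V\<^esub> x \<in> N" using a_rcos_module[OF x zc] z by (simp add: a_minus_def)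
    then have "c \<odot>\<^bsub>V\<^esub> (z \<ominus>\<^bsub>V\<^esub> x) \<in> N" by (rule lin_subspaceD(5)[OF N])
    then have "c \<odot>\<^bsub>V\<^esub> z \<ominus>\<^bsub>V\<^esub> c \<odot>\<^bsub>V\<^esub> x \<in> N"
      using x zc smult_r_distr[of c z "\<ominus>\<^bsub>V\<^esub> x"] smult_r_minus[of c x] by (simp add: a_minus_def)
    then show ?thesis
      using quotient_alg_eq_iff[of "c \<odot>\<^bsub>V\<^esub> z" "c \<odot>\<^bsub>V\<^esub> x"] x zc by simp
  qed
  then have "(\<Union>z\<in>N +>\<^bsub>V\<^esub> x. N +>\<^bsub>V\<^esub> (c \<odot>\<^bsub>V\<^esub> z)) = (\<Union>z\<in>N +>\<^bsub>V\<^esub> x. N +>\<^bsub>V\<^esub> (c \<odot>\<^bsub>V\<^esub> x))"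
    by (intro SUP_cong refl)
  also have "\<dots> = N +>\<^bsub>V\<^esub> (c \<odot>\<^bsub>V\<^esub> x)"
    using a_rcos_self[OF x] by blast
  finally show ?thesis by (simp add: quotient_alg_simps)
qed

text \<open>The product of cosets is a union over pairs of representatives, and (u + x)(v + y) =
  (u(v + y) + xv) + xy with the bracketed part in \<open>N\<close>. The assumptions are
  distributivity and two-sided absorption, which Lie brackets and associative products share, so
  both kinds of quotient are served.\<close>

lemma quotient_alg_mult:
  assumes x: "x \<in> carrier V" and y: "y \<in> carrier V"
    and cl: "\<And>u v. u \<in> carrier V \<Longrightarrow> v \<in> carrier V \<Longrightarrow> u \<otimes>\<^bsub>V\<^esub> v \<in> carrier V"
    and dl: "\<And>u v w. u \<in> carrier V \<Longrightarrow> v \<in> carrier V \<Longrightarrow> w \<in> carrier V \<Longrightarrow>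
      (u \<oplus>\<^bsub>V\<^esub> v) \<otimes>\<^bsub>V\<^esub> w = u \<otimes>\<^bsub>V\<^esub> w \<oplus>\<^bsub>V\<^esub> v \<otimes>\<^bsub>V\<^esub> w"
    and dr: "\<And>u v w. u \<in> carrier V \<Longrightarrow> v \<in> carrier V \<Longrightarrow> w \<in> carrier V \<Longrightarrow>
      u \<otimes>\<^bsub>V\<^esub> (v \<oplus>\<^bsub>V\<^esub> w) = u \<otimes>\<^bsub>V\<^esub> v \<oplus>\<^bsub>V\<^esub> u \<otimes>\<^bsub>V\<^esub> w"
    and il: "\<And>u v. u \<in> carrier V \<Longrightarrow> v \<in> N \<Longrightarrow> u \<otimes>\<^bsub>V\<^esub> v \<in> N"
    and ir: "\<And>u v. u \<in> carrier V \<Longrightarrow> v \<in> N \<Longrightarrow> v \<otimes>\<^bsub>V\<^esub> u \<in> N"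
  shows "N +>\<^bsub>V\<^esub> (x \<otimes>\<^bsub>V\<^esub> y) = (N +>\<^bsub>V\<^esub> x) \<otimes>\<^bsub>quotient_alg V N\<^esub> (N +>\<^bsub>V\<^esub> y)"
proof -
  have Nc: "u \<in> carrier V" if "u \<in> N" for u using that a_subset by auto
  have "N +>\<^bsub>V\<^esub> (a \<otimes>\<^bsub>V\<^esub> b) = N +>\<^bsub>V\<^esub> (x \<otimes>\<^bsub>V\<^esub> y)" if a: "a \<in> N +>\<^bsub>V\<^esub> x" and b: "b \<in> N +>\<^bsub>V\<^esub> y" for a b
  proof -
    obtain u v where uv: "u \<in> N" "a = u \<oplus>\<^bsub>V\<^esub> x" "v \<in> N" "b = v \<oplus>\<^bsub>V\<^esub> y"
      using a b by (auto simp: a_r_coset_def')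
    note c = Nc[OF uv(1)] Nc[OF uv(3)]
    have "a \<otimes>\<^bsub>V\<^esub> b = (u \<otimes>\<^bsub>V\<^esub> (v \<oplus>\<^bsub>V\<^esub> y) \<oplus>\<^bsub>V\<^esub> x \<otimes>\<^bsub>V\<^esub> v) \<oplus>\<^bsub>V\<^esub> x \<otimes>\<^bsub>V\<^esub> y"
      using uv c x y by (simp add: dl dr cl M.a_ac)
    moreover have "u \<otimes>\<^bsub>V\<^esub> (v \<oplus>\<^bsub>V\<^esub> y) \<oplus>\<^bsub>V\<^esub> x \<otimes>\<^bsub>V\<^esub> v \<in> N"
      using uv c x y by (intro lin_subspaceD(4)[OF N] il ir) auto
    ultimately have "a \<otimes>\<^bsub>V\<^esub> b \<in> N +>\<^bsub>V\<^esub> (x \<otimes>\<^bsub>V\<^esub> y)" by (auto simp: a_r_coset_def')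
    then show ?thesis by (rule a_repr_independence'[symmetric]) (rule cl[OF x y])
  qed
  then have "rcoset_mult V N (N +>\<^bsub>V\<^esub> x) (N +>\<^bsub>V\<^esub> y) =
      (\<Union>a\<in>N +>\<^bsub>V\<^esub> x. \<Union>b\<in>N +>\<^bsub>V\<^esub> y. N +>\<^bsub>V\<^esub> (x \<otimes>\<^bsub>V\<^esub> y))"
    unfolding rcoset_mult_def by (intro SUP_cong refl)
  also have "\<dots> = N +>\<^bsub>V\<^esub> (x \<otimes>\<^bsub>V\<^esub> y)"
    using a_rcos_self[OF x] a_rcos_self[OF y] by blast
  finally show ?thesis by (simp add: quotient_alg_simps)
qed

lemma vectorspace_quotient_alg: "vectorspace class_ring (quotient_alg V N)"
  by (rule vectorspace_surj[OF lin_subspaceD(1)[OF N] quotient_alg_surj])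
     (simp_all add: quotient_alg_add quotient_alg_smult quotient_alg_zero)

text \<open>Rank-nullity for the projection onto cosets, whose kernel is \<open>N\<close>. It turns
  the dimension of (E + FE)/E into a difference of two dimensions.\<close>

lemma dimension_quotient_alg:
  assumes "finite_dim V"
  shows "dimension (quotient_alg V N) + dimension (V\<lparr>carrier := N\<rparr>) = dimension V"
proof -
  interpret Q: vectorspace class_ring "quotient_alg V N" by (rule vectorspace_quotient_alg)
  have hom: "(+>\<^bsub>V\<^esub>) N \<in> LinearCombinations.module_hom class_ring V (quotient_alg V N)"
    using quotient_alg_surj by (auto simp: LinearCombinations.module_hom_def quotient_alg_add quotient_alg_smult)
  interpret T: linear_map class_ring V "quotient_alg V N" "(+>\<^bsub>V\<^esub>) N"
    by unfold_locales (rule hom)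
  have im: "T.im = carrier (quotient_alg V N)"
    using quotient_alg_surj by (simp add: T.im_def)
  have "N +>\<^bsub>V\<^esub> x = N +>\<^bsub>V\<^esub> \<zero>\<^bsub>V\<^esub> \<longleftrightarrow> x \<in> N" if "x \<in> carrier V" for x
    using quotient_alg_eq_iff[OF that M.zero_closed] that
    by (simp add: a_minus_def M.add.inv_one[folded a_inv_def])
  then have ker: "T.ker = N"
    using a_subset by (auto simp: T.ker_def quotient_alg_zero)
  show ?thesis using T.rank_nullity[OF assms] by (simp add: im ker)
qed

end

section \<open>Unital associative algebras and their quotients\<close>

definition assoc_algebra :: "('k::field, 'a) module \<Rightarrow> bool" where
  "assoc_algebra A \<longleftrightarrow> ring A \<and> vectorspace class_ring A \<and>
     (\<forall>c. \<forall>x\<in>carrier A. \<forall>y\<in>carrier A. (c \<odot>\<^bsub>A\<^esub> x) \<otimes>\<^bsub>A\<^esub> y = c \<odot>\<^bsub>A\<^esub> (x \<otimes>\<^bsub>A\<^esub> y) \<and>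
        x \<otimes>\<^bsub>A\<^esub> (c \<odot>\<^bsub>A\<^esub> y) = c \<odot>\<^bsub>A\<^esub> (x \<otimes>\<^bsub>A\<^esub> y))"

lemma assoc_algebraD:
  fixes A :: "('k::field, 'a) module"
  assumes "assoc_algebra A"
  shows "ring A" "vectorspace class_ring A"
    "x \<in> carrier A \<Longrightarrow> y \<in> carrier A \<Longrightarrow> (c \<odot>\<^bsub>A\<^esub> x) \<otimes>\<^bsub>A\<^esub> y = c \<odot>\<^bsub>A\<^esub> (x \<otimes>\<^bsub>A\<^esub> y)"
    "x \<in> carrier A \<Longrightarrow> y \<in> carrier A \<Longrightarrow> x \<otimes>\<^bsub>A\<^esub> (c \<odot>\<^bsub>A\<^esub> y) = c \<odot>\<^bsub>A\<^esub> (x \<otimes>\<^bsub>A\<^esub> y)"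
    "x \<in> carrier A \<Longrightarrow> c \<odot>\<^bsub>A\<^esub> x \<in> carrier A"
proof -
  show "ring A" and v: "vectorspace class_ring A" using assms by (auto simp: assoc_algebra_def)
  interpret vectorspace class_ring A by (rule v)
  show "x \<in> carrier A \<Longrightarrow> y \<in> carrier A \<Longrightarrow> (c \<odot>\<^bsub>A\<^esub> x) \<otimes>\<^bsub>A\<^esub> y = c \<odot>\<^bsub>A\<^esub> (x \<otimes>\<^bsub>A\<^esub> y)"
    "x \<in> carrier A \<Longrightarrow> y \<in> carrier A \<Longrightarrow> x \<otimes>\<^bsub>A\<^esub> (c \<odot>\<^bsub>A\<^esub> y) = c \<odot>\<^bsub>A\<^esub> (x \<otimes>\<^bsub>A\<^esub> y)"
    using assms by (auto simp: assoc_algebra_def)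
  show "x \<in> carrier A \<Longrightarrow> c \<odot>\<^bsub>A\<^esub> x \<in> carrier A" by auto
qed

lemma assoc_algebra_surj:
  fixes A :: "('k::field, 'v) module" and Q :: "('k, 'w) module"
  assumes A: "assoc_algebra A" and surj: "\<pi> ` carrier A = carrier Q"
    and add: "\<And>x y. x \<in> carrier A \<Longrightarrow> y \<in> carrier A \<Longrightarrow> \<pi> (x \<oplus>\<^bsub>A\<^esub> y) = \<pi> x \<oplus>\<^bsub>Q\<^esub> \<pi> y"
    and smult: "\<And>c x. x \<in> carrier A \<Longrightarrow> \<pi> (c \<odot>\<^bsub>A\<^esub> x) = c \<odot>\<^bsub>Q\<^esub> \<pi> x"
    and zero: "\<pi> \<zero>\<^bsub>A\<^esub> = \<zero>\<^bsub>Q\<^esub>"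
    and mult: "\<And>x y. x \<in> carrier A \<Longrightarrow> y \<in> carrier A \<Longrightarrow> \<pi> (x \<otimes>\<^bsub>A\<^esub> y) = \<pi> x \<otimes>\<^bsub>Q\<^esub> \<pi> y"
    and one: "\<pi> \<one>\<^bsub>A\<^esub> = \<one>\<^bsub>Q\<^esub>"
  shows "assoc_algebra Q"
proof -
  interpret A: ring A using assoc_algebraD(1)[OF A] .
  have vs: "vectorspace class_ring Q"
    by (rule vectorspace_surj[OF assoc_algebraD(2)[OF A] surj add smult zero])
  interpret Q: vectorspace class_ring Q by (rule vs)
  have mem: "\<pi> x \<in> carrier Q" if "x \<in> carrier A" for x by (simp add: surj[symmetric] that)
  have Q: "\<exists>x\<in>carrier A. v = \<pi> x" if "v \<in> carrier Q" for v
    using that unfolding surj[symmetric] by blast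
  have "ring Q"
  proof (rule ringI)
    show "abelian_group Q" by (rule Q.M.abelian_group_axioms)
    show "monoid Q"
      by (rule monoidI) (auto dest!: Q simp: mult[symmetric] one[symmetric] mem A.m_assoc)
  qed (auto dest!: Q simp: mult[symmetric] add[symmetric] mem A.l_distr A.r_distr)
  moreover have "(c \<odot>\<^bsub>Q\<^esub> x) \<otimes>\<^bsub>Q\<^esub> y = c \<odot>\<^bsub>Q\<^esub> (x \<otimes>\<^bsub>Q\<^esub> y)"
    "x \<otimes>\<^bsub>Q\<^esub> (c \<odot>\<^bsub>Q\<^esub> y) = c \<odot>\<^bsub>Q\<^esub> (x \<otimes>\<^bsub>Q\<^esub> y)" if xy: "x \<in> carrier Q" "y \<in> carrier Q" for c x y
  proof -
    obtain a b where "a \<in> carrier A" "x = \<pi> a" "b \<in> carrier A" "y = \<pi> b"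
      using Q[OF xy(1)] Q[OF xy(2)] by blast
    then show "(c \<odot>\<^bsub>Q\<^esub> x) \<otimes>\<^bsub>Q\<^esub> y = c \<odot>\<^bsub>Q\<^esub> (x \<otimes>\<^bsub>Q\<^esub> y)"
      "x \<otimes>\<^bsub>Q\<^esub> (c \<odot>\<^bsub>Q\<^esub> y) = c \<odot>\<^bsub>Q\<^esub> (x \<otimes>\<^bsub>Q\<^esub> y)"
      by (simp_all add: mult[symmetric] smult[symmetric] assoc_algebraD(3-5)[OF A])
  qed
  ultimately show ?thesis
    unfolding assoc_algebra_def using vs by blast
qed

context
  fixes A :: "('k::field, 'v) module" and I :: "'v set"
  assumes A: "assoc_algebra A" and I: "ideal I A" and sub: "lin_subspace I A"
begin

lemma quotient_alg_ideal_mult: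
  assumes "x \<in> carrier A" "y \<in> carrier A"
  shows "I +>\<^bsub>A\<^esub> (x \<otimes>\<^bsub>A\<^esub> y) = (I +>\<^bsub>A\<^esub> x) \<otimes>\<^bsub>quotient_alg A I\<^esub> (I +>\<^bsub>A\<^esub> y)"
proof -
  interpret ideal I A by (rule I)
  show ?thesis
    by (rule quotient_alg_mult[OF sub assms]) (auto simp: l_distr r_distr I_l_closed I_r_closed)
qed

lemma assoc_algebra_quotient: "assoc_algebra (quotient_alg A I)"
  by (rule assoc_algebra_surj[OF A quotient_alg_surj[OF sub]])
    (simp_all only: quotient_alg_add[OF sub] quotient_alg_smult[OF sub] quotient_alg_zero[OF sub]
      quotient_alg_ideal_mult quotient_alg_simps(3))

end

text \<open>In a unital algebra c x = (c 1) x, so a ring ideal absorbs scalars as well. This matters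
  because \<open>genideal\<close> only produces a ring ideal.\<close>

lemma ideal_lin_subspace:
  fixes A :: "('k::field, 'v) module"
  assumes A: "assoc_algebra A" and I: "ideal I A"
  shows "lin_subspace I A"
proof -
  interpret ideal I A by (rule I)
  have "c \<odot>\<^bsub>A\<^esub> x \<in> I" if "x \<in> I" for c x
  proof -
    have "x \<in> carrier A" using that a_subset by blast
    then have "c \<odot>\<^bsub>A\<^esub> x = (c \<odot>\<^bsub>A\<^esub> \<one>\<^bsub>A\<^esub>) \<otimes>\<^bsub>A\<^esub> x"
      using assoc_algebraD(3)[OF A one_closed, of x c] by simp
    then show ?thesis
      using I_l_closed[OF that assoc_algebraD(5)[OF A one_closed, of c]] by simp
  qed
  then show ?thesis
    by (intro lin_subspaceI[OF assoc_algebraD(2)[OF A] a_subset]) auto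
qed

lemma lie_algebra_surj:
  fixes A :: "('k::field, 'v) module" and Q :: "('k, 'w) module"
  assumes A: "lie_algebra A" and surj: "\<pi> ` carrier A = carrier Q"
    and add: "\<And>x y. x \<in> carrier A \<Longrightarrow> y \<in> carrier A \<Longrightarrow> \<pi> (x \<oplus>\<^bsub>A\<^esub> y) = \<pi> x \<oplus>\<^bsub>Q\<^esub> \<pi> y"
    and smult: "\<And>c x. x \<in> carrier A \<Longrightarrow> \<pi> (c \<odot>\<^bsub>A\<^esub> x) = c \<odot>\<^bsub>Q\<^esub> \<pi> x"
    and zero: "\<pi> \<zero>\<^bsub>A\<^esub> = \<zero>\<^bsub>Q\<^esub>"
    and mult: "\<And>x y. x \<in> carrier A \<Longrightarrow> y \<in> carrier A \<Longrightarrow> \<pi> (x \<otimes>\<^bsub>A\<^esub> y) = \<pi> x \<otimes>\<^bsub>Q\<^esub> \<pi> y"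
  shows "lie_algebra Q"
proof -
  interpret A: lie_algebra A by (rule A)
  have vs: "vectorspace class_ring Q"
    by (rule vectorspace_surj[OF A.vectorspace_axioms surj add smult zero])
  have mem: "\<pi> x \<in> carrier Q" if "x \<in> carrier A" for x by (simp add: surj[symmetric] that)
  have Q: "\<exists>x\<in>carrier A. v = \<pi> x" if "v \<in> carrier Q" for v
    using that unfolding surj[symmetric] by blast
  have sc: "c \<odot>\<^bsub>A\<^esub> x \<in> carrier A" if "x \<in> carrier A" for c x using that by auto
  show ?thesis
  proof (rule lie_algebra.intro[OF vs], rule lie_algebra_axioms.intro)
    fix x y assume "x \<in> carrier Q" "y \<in> carrier Q"
    then obtain a b where ab: "a \<in> carrier A" "x = \<pi> a" "b \<in> carrier A" "y = \<pi> b"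
      by (blast dest: Q)
    then show "x \<otimes>\<^bsub>Q\<^esub> y \<in> carrier Q" "(c \<odot>\<^bsub>Q\<^esub> x) \<otimes>\<^bsub>Q\<^esub> y = c \<odot>\<^bsub>Q\<^esub> (x \<otimes>\<^bsub>Q\<^esub> y)"
      "x \<otimes>\<^bsub>Q\<^esub> (c \<odot>\<^bsub>Q\<^esub> y) = c \<odot>\<^bsub>Q\<^esub> (x \<otimes>\<^bsub>Q\<^esub> y)" "x \<otimes>\<^bsub>Q\<^esub> x = \<zero>\<^bsub>Q\<^esub>" for c
      by (simp_all add: mult[symmetric] smult[symmetric] zero[symmetric] mem sc
        A.bracket_closed A.bracket_smult_left A.bracket_smult_right A.bracket_alternating)
    fix z assume "z \<in> carrier Q"
    then obtain c where "c \<in> carrier A" "z = \<pi> c" by (blast dest: Q)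
    with ab show "(x \<oplus>\<^bsub>Q\<^esub> y) \<otimes>\<^bsub>Q\<^esub> z = (x \<otimes>\<^bsub>Q\<^esub> z) \<oplus>\<^bsub>Q\<^esub> (y \<otimes>\<^bsub>Q\<^esub> z)"
      "x \<otimes>\<^bsub>Q\<^esub> (y \<oplus>\<^bsub>Q\<^esub> z) = (x \<otimes>\<^bsub>Q\<^esub> y) \<oplus>\<^bsub>Q\<^esub> (x \<otimes>\<^bsub>Q\<^esub> z)"
      "(x \<otimes>\<^bsub>Q\<^esub> (y \<otimes>\<^bsub>Q\<^esub> z)) \<oplus>\<^bsub>Q\<^esub> ((y \<otimes>\<^bsub>Q\<^esub> (z \<otimes>\<^bsub>Q\<^esub> x)) \<oplus>\<^bsub>Q\<^esub> (z \<otimes>\<^bsub>Q\<^esub> (x \<otimes>\<^bsub>Q\<^esub> y))) = \<zero>\<^bsub>Q\<^esub>"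
      by (simp_all add: mult[symmetric] add[symmetric] zero[symmetric] A.bracket_closed A.bracket_add_left
        A.bracket_add_right A.jacobi)
  qed
qed

section \<open>Monoid algebras\<close>

abbreviation single :: "'a \<Rightarrow> 'b \<Rightarrow> 'a \<Rightarrow>\<^sub>0 'b::zero" where
  "single \<equiv> Poly_Mapping.single"

abbreviation keys :: "('a \<Rightarrow>\<^sub>0 'b::zero) \<Rightarrow> 'a set" where
  "keys \<equiv> Poly_Mapping.keys"

abbreviation lookup :: "('a \<Rightarrow>\<^sub>0 'b::zero) \<Rightarrow> 'a \<Rightarrow> 'b" where
  "lookup \<equiv> Poly_Mapping.lookup"

abbreviation scale :: "'k::field \<Rightarrow> ('a \<Rightarrow>\<^sub>0 'k) \<Rightarrow> 'a \<Rightarrow>\<^sub>0 'k" where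
  "scale c \<equiv> Poly_Mapping.map ((*) c)"

lemma lookup_map_mult [simp]:
  "lookup (scale c f) p = (c::'k::field) * lookup f p"
  by (simp add: Poly_Mapping.map.rep_eq when_def)

lemma keys_map_mult: "keys (scale (c::'k::field) f) \<subseteq> keys f"
  by (auto simp: in_keys_iff)

text \<open>A finitely supported function is the sum of its monomials. The support condition is
  carried through the induction on partial sums, so that properties valid only for functions
  supported in \<open>S\<close> can be proved this way.\<close>

lemma poly_mapping_induct_on [consumes 1, case_names zero add single]:
  fixes f :: "'a \<Rightarrow>\<^sub>0 'b::comm_monoid_add"
  assumes "keys f \<subseteq> S" "P 0"
    and add: "\<And>f g. keys f \<subseteq> S \<Longrightarrow> keys g \<subseteq> S \<Longrightarrow> P f \<Longrightarrow> P g \<Longrightarrow> P (f + g)"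
    and single: "\<And>p c. p \<in> S \<Longrightarrow> P (single p c)"
  shows "P f"
proof -
  have eq: "f = (\<Sum>p\<in>keys f. single p (lookup f p))"
    by (rule poly_mapping_eqI) (simp add: lookup_sum lookup_single when_def in_keys_iff split: if_splits)
  have "P (\<Sum>p\<in>T. single p (g p)) \<and>
      keys (\<Sum>p\<in>T. single p (g p)) \<subseteq> S" if "finite T" "T \<subseteq> S" for T and g :: "'a \<Rightarrow> 'b"
    using that
  proof (induction T)
    case (insert x T)
    have 1: "keys (single x (g x)) \<subseteq> S" using insert by auto
    then have "keys (single x (g x) + (\<Sum>p\<in>T. single p (g p))) \<subseteq> S"
      using insert order_trans[OF Poly_Mapping.keys_add Un_least] by blast
    then show ?case using insert add[OF 1 _ single] by simp
  qed (simp add: assms)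
  from this[of "keys f" "lookup f"] show ?thesis
    using assms(1) by (simp add: eq[symmetric])
qed

context
  fixes G :: "('g, 'm) monoid_scheme" and M :: "('k::field, 'g \<Rightarrow>\<^sub>0 'k) module"
  defines "M \<equiv> monoid_algebra G"
begin

lemma monoid_algebra_simps:
  "carrier M = {f. keys f \<subseteq> carrier G}"
  "one M = single \<one>\<^bsub>G\<^esub> 1" "zero M = 0" "add M = (+)"
  "smult M = (\<lambda>c. scale c)"
  by (simp_all add: M_def monoid_algebra_def)

text \<open>Enlarging the index sets beyond the supports adds only zero terms. With one common index
  set for several factors, distributivity becomes a termwise identity.\<close>

lemma monoid_algebra_mult:
  assumes "finite X" "finite Y" "keys f \<subseteq> X" "keys g \<subseteq> Y"
  shows "f \<otimes>\<^bsub>M\<^esub> g = (\<Sum>p\<in>X. \<Sum>q\<in>Y.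
     single (p \<otimes>\<^bsub>G\<^esub> q) (lookup f p * lookup g q))"
proof -
  have "(\<Sum>q\<in>keys g. single (p \<otimes>\<^bsub>G\<^esub> q) (lookup f p * lookup g q)) =
      (\<Sum>q\<in>Y. single (p \<otimes>\<^bsub>G\<^esub> q) (lookup f p * lookup g q))" for p
    by (rule sum.mono_neutral_left) (use assms in \<open>auto simp: in_keys_iff\<close>)
  then have "f \<otimes>\<^bsub>M\<^esub> g = (\<Sum>p\<in>keys f. \<Sum>q\<in>Y.
     single (p \<otimes>\<^bsub>G\<^esub> q) (lookup f p * lookup g q))"
    by (simp add: M_def monoid_algebra_def)
  also have "\<dots> = (\<Sum>p\<in>X. \<Sum>q\<in>Y.
     single (p \<otimes>\<^bsub>G\<^esub> q) (lookup f p * lookup g q))"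
    by (rule sum.mono_neutral_left) (use assms in \<open>auto simp: in_keys_iff\<close>)
  finally show ?thesis .
qed

lemma monoid_algebra_mult_single:
  "single p a \<otimes>\<^bsub>M\<^esub> single q b = single (p \<otimes>\<^bsub>G\<^esub> q) (a * b)"
  by (subst monoid_algebra_mult[of "{p}" "{q}"]) auto

lemma monoid_algebra_distrib:
  "(f + g) \<otimes>\<^bsub>M\<^esub> h = f \<otimes>\<^bsub>M\<^esub> h + g \<otimes>\<^bsub>M\<^esub> h" (is ?l)
  "h \<otimes>\<^bsub>M\<^esub> (f + g) = h \<otimes>\<^bsub>M\<^esub> f + h \<otimes>\<^bsub>M\<^esub> g" (is ?r)
proof -
  define X where "X = keys f \<union> keys g \<union> keys h"
  have X: "finite X" "keys f \<subseteq> X" "keys g \<subseteq> X" "keys h \<subseteq> X"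
    "keys (f + g) \<subseteq> X"
    using Poly_Mapping.keys_add[of f g] by (auto simp: X_def)
  show ?l ?r
    by (simp_all add: monoid_algebra_mult[OF X(1,1)] X lookup_add distrib_left distrib_right
        Poly_Mapping.single_add sum.distrib)
qed

lemma monoid_algebra_mult_zero: "0 \<otimes>\<^bsub>M\<^esub> h = 0" "h \<otimes>\<^bsub>M\<^esub> 0 = 0"
  by (simp_all add: M_def monoid_algebra_def)

lemma map_mult_sum:
  "scale (c::'k) (\<Sum>x\<in>X. F x) = (\<Sum>x\<in>X. scale c (F x))"
  by (rule poly_mapping_eqI) (simp add: lookup_sum sum_distrib_left)

lemma map_mult_single:
  "scale (c::'k) (single p a) = single p (c * a)"
  by (rule poly_mapping_eqI) (simp add: lookup_single when_def)

lemma monoid_algebra_mult_smult: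
  "scale c f \<otimes>\<^bsub>M\<^esub> g = scale c (f \<otimes>\<^bsub>M\<^esub> g)" (is ?l)
  "f \<otimes>\<^bsub>M\<^esub> scale c g = scale c (f \<otimes>\<^bsub>M\<^esub> g)" (is ?r)
  by (simp_all add: monoid_algebra_mult[of "keys f" "keys g"] keys_map_mult
      map_mult_sum map_mult_single mult_ac)

lemma vectorspace_monoid_algebra: "vectorspace class_ring M"
proof (rule vs_criteria)
  show "field (class_ring :: 'k ring)" by (rule class_field)
  show "\<forall>v w. v \<in> carrier M \<and> w \<in> carrier M \<longrightarrow> v \<oplus>\<^bsub>M\<^esub> w \<in> carrier M"
    using Poly_Mapping.keys_add by (fastforce simp: monoid_algebra_simps)
  show "\<forall>v\<in>carrier M. \<exists>neg_v\<in>carrier M. v \<oplus>\<^bsub>M\<^esub> neg_v = \<zero>\<^bsub>M\<^esub>"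
  proof
    fix v assume "v \<in> carrier M"
    then show "\<exists>neg_v\<in>carrier M. v \<oplus>\<^bsub>M\<^esub> neg_v = \<zero>\<^bsub>M\<^esub>"
      by (intro bexI[of _ "- v"]) (auto simp: monoid_algebra_simps in_keys_iff)
  qed
  show "\<forall>c v. c \<in> carrier class_ring \<and> v \<in> carrier M \<longrightarrow> c \<odot>\<^bsub>M\<^esub> v \<in> carrier M"
    using keys_map_mult by (fastforce simp: monoid_algebra_simps)
qed (auto simp: monoid_algebra_simps add_ac lookup_add distrib_left distrib_right mult.assoc
      intro!: poly_mapping_eqI)

text \<open>Closure, associativity and the unit law are compatible with sums in each argument, so
  they reduce to monomials, where they are the monoid axioms of \<open>G\<close>.\<close>

lemma assoc_algebra_monoid_algebra:
  assumes "monoid G"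
  shows "assoc_algebra M"
proof -
  interpret G: monoid G by fact
  interpret vectorspace class_ring M by (rule vectorspace_monoid_algebra)
  have kadd: "keys (f + g) \<subseteq> carrier G"
    if "keys f \<subseteq> carrier G" "keys g \<subseteq> carrier G" for f g :: "'g \<Rightarrow>\<^sub>0 'k"
    using that Poly_Mapping.keys_add[of f g] by auto
  have closed: "keys (f \<otimes>\<^bsub>M\<^esub> g) \<subseteq> carrier G"
    if f: "keys f \<subseteq> carrier G" and g: "keys g \<subseteq> carrier G" for f g
    using f
  proof (induction rule: poly_mapping_induct_on)
    case (single p c)
    show ?case using g
      by (induction rule: poly_mapping_induct_on)
        (use single in \<open>auto simp: monoid_algebra_distrib monoid_algebra_mult_zero kadd monoid_algebra_mult_single\<close>)
  qed (simp_all add: monoid_algebra_distrib monoid_algebra_mult_zero kadd)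
  have assoc: "(f \<otimes>\<^bsub>M\<^esub> g) \<otimes>\<^bsub>M\<^esub> h = f \<otimes>\<^bsub>M\<^esub> (g \<otimes>\<^bsub>M\<^esub> h)"
    if f: "keys f \<subseteq> carrier G" and g: "keys g \<subseteq> carrier G"
      and h: "keys h \<subseteq> carrier G" for f g h
    using f
  proof (induction rule: poly_mapping_induct_on)
    case (single p c)
    show ?case using g
    proof (induction rule: poly_mapping_induct_on)
      case (single q d)
      note pq = \<open>p \<in> carrier G\<close> \<open>q \<in> carrier G\<close>
      show ?case using h
      proof (induction rule: poly_mapping_induct_on)
        case (single r e)
        then show ?case using pq by (simp add: monoid_algebra_mult_single G.m_assoc mult.assoc)
      qed (simp_all add: monoid_algebra_distrib monoid_algebra_mult_zero)
    qed (simp_all add: monoid_algebra_distrib monoid_algebra_mult_zero)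
  qed (simp_all add: monoid_algebra_distrib monoid_algebra_mult_zero)
  have unit: "f \<otimes>\<^bsub>M\<^esub> \<one>\<^bsub>M\<^esub> = f \<and> \<one>\<^bsub>M\<^esub> \<otimes>\<^bsub>M\<^esub> f = f" if "keys f \<subseteq> carrier G" for f
    using that unfolding monoid_algebra_simps
    by (induction rule: poly_mapping_induct_on)
      (simp_all add: monoid_algebra_distrib monoid_algebra_mult_zero monoid_algebra_mult_single)
  have "ring M"
  proof (rule ringI)
    show "abelian_group M" by (rule M.abelian_group_axioms)
    show "monoid M"
      by (rule monoidI) (use closed assoc unit in \<open>auto simp: monoid_algebra_simps\<close>)
  qed (simp_all add: monoid_algebra_simps monoid_algebra_distrib)
  then show ?thesis
    unfolding assoc_algebra_def using vectorspace_monoid_algebra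
    by (simp add: monoid_algebra_simps monoid_algebra_mult_smult)
qed

lemma monoid_algebra_minus:
  assumes "f \<in> carrier M" "g \<in> carrier M"
  shows "f \<ominus>\<^bsub>M\<^esub> g = f - g"
proof -
  interpret vectorspace class_ring M by (rule vectorspace_monoid_algebra)
  have "- g \<in> carrier M" using assms by (auto simp: monoid_algebra_simps in_keys_iff)
  then have "- g = \<ominus>\<^bsub>M\<^esub> g"
    using M.minus_equality[of "- g" g] assms by (simp add: monoid_algebra_simps)
  then show ?thesis by (simp add: a_minus_def monoid_algebra_simps)
qed

lemma monoid_algebra_diff:
  "(f - g) \<otimes>\<^bsub>M\<^esub> h = f \<otimes>\<^bsub>M\<^esub> h - g \<otimes>\<^bsub>M\<^esub> h" "h \<otimes>\<^bsub>M\<^esub> (f - g) = h \<otimes>\<^bsub>M\<^esub> f - h \<otimes>\<^bsub>M\<^esub> g"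
  using monoid_algebra_distrib(1)[of "f - g" g h] monoid_algebra_distrib(2)[of h "f - g" g]
  by (simp_all add: algebra_simps)

lemma keys_diff_subset:
  "keys f \<subseteq> S \<Longrightarrow> keys g \<subseteq> S \<Longrightarrow> keys (f - g) \<subseteq> S"
  for f g :: "'a \<Rightarrow>\<^sub>0 'b::ab_group_add"
proof
  fix x assume "x \<in> keys (f - g)"
  then have "x \<in> keys f \<or> x \<in> keys g" by (auto simp: in_keys_iff lookup_minus)
  then show "x \<in> S" if "keys f \<subseteq> S" "keys g \<subseteq> S" using that by blast
qed

end

section \<open>Linear maps out of a free vector space\<close>

definition lin_ext :: "('k::field, 'w) module \<Rightarrow> ('g \<Rightarrow> 'w) \<Rightarrow> ('g \<Rightarrow>\<^sub>0 'k) \<Rightarrow> 'w" where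
  "lin_ext T \<phi> f = finsum T (\<lambda>p. lookup f p \<odot>\<^bsub>T\<^esub> \<phi> p) (keys f)"

context
  fixes T :: "('k::field, 'w) module" and S :: "'g set" and \<phi> :: "'g \<Rightarrow> 'w"
  assumes T: "vectorspace class_ring T" and \<phi>: "\<And>p. p \<in> S \<Longrightarrow> \<phi> p \<in> carrier T"
begin

interpretation vectorspace class_ring T by (rule T)

lemma lin_ext_superset:
  assumes "finite X" "keys f \<subseteq> X" "X \<subseteq> S"
  shows "lin_ext T \<phi> f = finsum T (\<lambda>p. lookup f p \<odot>\<^bsub>T\<^esub> \<phi> p) X"
  unfolding lin_ext_def
proof (rule M.add.finprod_mono_neutral_cong_left[OF assms(1,2)])
  fix i assume "i \<in> X - keys f"
  then show "lookup f i \<odot>\<^bsub>T\<^esub> \<phi> i = \<zero>\<^bsub>T\<^esub>"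
    using smult_l_null[of "\<phi> i"] \<phi> assms by (auto simp: in_keys_iff)
qed (use \<phi> assms in auto)

lemma lin_ext_closed: "keys f \<subseteq> S \<Longrightarrow> lin_ext T \<phi> f \<in> carrier T"
  unfolding lin_ext_def by (rule M.finsum_closed) (use \<phi> in auto)

lemma lin_ext_zero: "lin_ext T \<phi> 0 = \<zero>\<^bsub>T\<^esub>"
  by (simp add: lin_ext_def)

lemma lin_ext_add:
  assumes "keys f \<subseteq> S" "keys g \<subseteq> S"
  shows "lin_ext T \<phi> (f + g) = lin_ext T \<phi> f \<oplus>\<^bsub>T\<^esub> lin_ext T \<phi> g"
proof -
  define X where "X = keys f \<union> keys g"
  have X: "finite X" "keys f \<subseteq> X" "keys g \<subseteq> X" "keys (f + g) \<subseteq> X" "X \<subseteq> S"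
    using Poly_Mapping.keys_add[of f g] assms by (auto simp: X_def)
  have "lin_ext T \<phi> (f + g) =
      finsum T (\<lambda>p. lookup f p \<odot>\<^bsub>T\<^esub> \<phi> p \<oplus>\<^bsub>T\<^esub> lookup g p \<odot>\<^bsub>T\<^esub> \<phi> p) X"
    unfolding lin_ext_superset[OF X(1,4,5)]
    by (rule M.finsum_cong') (use X \<phi> smult_l_distr in \<open>auto simp: lookup_add\<close>)
  also have "\<dots> = lin_ext T \<phi> f \<oplus>\<^bsub>T\<^esub> lin_ext T \<phi> g"
    unfolding lin_ext_superset[OF X(1,2,5)] lin_ext_superset[OF X(1,3,5)]
    by (rule M.finsum_addf) (use X \<phi> in auto)
  finally show ?thesis .
qed

lemma lin_ext_single: "p \<in> S \<Longrightarrow> lin_ext T \<phi> (single p c) = c \<odot>\<^bsub>T\<^esub> \<phi> p"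
  by (subst lin_ext_superset[of "{p}"]) (use \<phi> in auto)

lemma lin_ext_smult:
  assumes "keys f \<subseteq> S"
  shows "lin_ext T \<phi> (scale c f) = c \<odot>\<^bsub>T\<^esub> lin_ext T \<phi> f"
  using assms
proof (induction rule: poly_mapping_induct_on)
  case (add f g)
  have "scale c (f + g) = scale c f + scale c g"
    by (rule poly_mapping_eqI) (simp add: lookup_add distrib_left)
  moreover have "keys (scale c f) \<subseteq> S" "keys (scale c g) \<subseteq> S"
    using add(1,2) by (meson order_trans keys_map_mult)+
  ultimately show ?case
    using add smult_r_distr[of c "lin_ext T \<phi> f" "lin_ext T \<phi> g"] lin_ext_closed
    by (simp add: lin_ext_add)
next
  case (single p d)
  then show ?case
    using smult_assoc1[of c d "\<phi> p", symmetric] by (simp add: map_mult_single lin_ext_single \<phi>)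
next
  case zero
  have "scale c 0 = (0 :: 'g \<Rightarrow>\<^sub>0 'k)" by (rule poly_mapping_eqI) simp
  then show ?case using smult_r_null[of c] by (simp add: lin_ext_zero)
qed

lemma lin_ext_diff:
  assumes "keys f \<subseteq> S" "keys g \<subseteq> S"
  shows "lin_ext T \<phi> (f - g) = lin_ext T \<phi> f \<ominus>\<^bsub>T\<^esub> lin_ext T \<phi> g"
proof -
  have eq: "f - g = f + scale (- 1) g"
    by (rule poly_mapping_eqI) (simp add: lookup_add lookup_minus)
  have k: "keys (scale (- 1) g) \<subseteq> S"
    using keys_map_mult[of "-1" g] assms(2) by blast
  have "(- 1) \<odot>\<^bsub>T\<^esub> x = \<ominus>\<^bsub>T\<^esub> x" if "x \<in> carrier T" for x
    using smult_l_minus[of 1 x] smult_one[of x] that by (auto simp: class_ring_simps)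
  then show ?thesis
    unfolding eq lin_ext_add[OF assms(1) k] lin_ext_smult[OF assms(2)]
    by (simp add: a_minus_def lin_ext_closed assms)
qed

end

section \<open>The universal property of the enveloping algebra\<close>

text \<open>The homomorphism out of the free monoid that extends \<open>\<delta>\<close>. Nesting to
  the right makes left multiplication by the image of a letter the same as prefixing that letter,
  which suits induction on words.\<close>

definition word_prod :: "('a, 'm) monoid_scheme \<Rightarrow> ('v \<Rightarrow> 'a) \<Rightarrow> 'v list \<Rightarrow> 'a" where
  "word_prod T \<delta> ws = foldr (\<lambda>x u. \<delta> x \<otimes>\<^bsub>T\<^esub> u) ws \<one>\<^bsub>T\<^esub>"

lemma word_prod_simps [simp]:
  "word_prod T \<delta> [] = \<one>\<^bsub>T\<^esub>" "word_prod T \<delta> (x # ws) = \<delta> x \<otimes>\<^bsub>T\<^esub> word_prod T \<delta> ws"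
  by (simp_all add: word_prod_def)

lemma word_prod_closed:
  assumes "monoid T" "\<And>x. x \<in> S \<Longrightarrow> \<delta> x \<in> carrier T"
  shows "ws \<in> lists S \<Longrightarrow> word_prod T \<delta> ws \<in> carrier T"
proof -
  interpret monoid T by fact
  show "ws \<in> lists S \<Longrightarrow> word_prod T \<delta> ws \<in> carrier T"
    by (induction ws) (auto simp: assms(2))
qed

lemma word_prod_append:
  assumes "monoid T" "\<And>x. x \<in> S \<Longrightarrow> \<delta> x \<in> carrier T" "vs \<in> lists S"
  shows "ws \<in> lists S \<Longrightarrow> word_prod T \<delta> (ws @ vs) = word_prod T \<delta> ws \<otimes>\<^bsub>T\<^esub> word_prod T \<delta> vs"
proof -
  interpret monoid T by fact
  have c: "word_prod T \<delta> ws \<in> carrier T" if "ws \<in> lists S" for ws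
    using word_prod_closed[OF assms(1,2) that] .
  show "ws \<in> lists S \<Longrightarrow> word_prod T \<delta> (ws @ vs) = word_prod T \<delta> ws \<otimes>\<^bsub>T\<^esub> word_prod T \<delta> vs"
    by (induction ws) (use c assms in \<open>auto simp: m_assoc\<close>)
qed

lemma monoid_free_monoid: "monoid (free_monoid X)"
  by (rule monoidI) (auto simp: free_monoid_def)

abbreviation free_alg :: "('k::field, 'v) module \<Rightarrow> ('k, 'v list \<Rightarrow>\<^sub>0 'k) module" where
  "free_alg L \<equiv> monoid_algebra (free_monoid (carrier L))"

lemma assoc_algebra_free_alg: "assoc_algebra (free_alg L)"
  by (rule assoc_algebra_monoid_algebra[OF monoid_free_monoid])

lemma free_alg_carrier: "carrier (free_alg L) = {f. keys f \<subseteq> lists (carrier L)}"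
  by (simp add: monoid_algebra_simps free_monoid_def)

lemma free_alg_one: "\<one>\<^bsub>free_alg L\<^esub> = single [] 1"
  by (simp add: monoid_algebra_simps free_monoid_def)

lemma single_free_alg: "ws \<in> lists (carrier L) \<Longrightarrow> single ws c \<in> carrier (free_alg L)"
  by (simp add: free_alg_carrier)

lemma free_alg_mult_single:
  "single p a \<otimes>\<^bsub>free_alg L\<^esub> single q b = single (p @ q) (a * b)"
  by (simp add: monoid_algebra_mult_single free_monoid_def)

section \<open>The presentation of the enveloping algebra by generators and relations\<close>

lemma envelope_relations_cases:
  fixes L :: "('k::field, 'v) module"
  assumes "r \<in> envelope_relations L"
  obtains (add) x y where "x \<in> carrier L" "y \<in> carrier L"
      "r = single [x \<oplus>\<^bsub>L\<^esub> y] 1 - single [x] 1 - single [y] 1"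
    | (smult) c x where "x \<in> carrier L" "r = single [c \<odot>\<^bsub>L\<^esub> x] 1 - single [x] c"
    | (bracket) x y where "x \<in> carrier L" "y \<in> carrier L"
      "r = single [x, y] 1 - single [y, x] 1 - single [x \<otimes>\<^bsub>L\<^esub> y] 1"
  using assms unfolding envelope_relations_def by (elim UnE CollectE exE conjE) metis+

lemma envelope_relationsI:
  fixes L :: "('k::field, 'v) module"
  assumes "x \<in> carrier L"
  shows "y \<in> carrier L \<Longrightarrow> single [x \<oplus>\<^bsub>L\<^esub> y] 1 - single [x] 1 - single [y] 1
      \<in> envelope_relations L"
    "single [c \<odot>\<^bsub>L\<^esub> x] 1 - single [x] c \<in> envelope_relations L"
    "y \<in> carrier L \<Longrightarrow> single [x, y] 1 - single [y, x] 1 - single [x \<otimes>\<^bsub>L\<^esub> y] 1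
      \<in> envelope_relations L"
proof -
  show "y \<in> carrier L \<Longrightarrow> single [x \<oplus>\<^bsub>L\<^esub> y] 1 - single [x] 1 - single [y] 1
      \<in> envelope_relations L"
    unfolding envelope_relations_def
    by (rule UnI1, rule UnI1, intro CollectI exI conjI, rule refl, rule assms)
  show "single [c \<odot>\<^bsub>L\<^esub> x] 1 - single [x] c \<in> envelope_relations L"
    unfolding envelope_relations_def
    by (rule UnI1, rule UnI2, intro CollectI exI conjI, rule refl, rule assms)
  show "y \<in> carrier L \<Longrightarrow> single [x, y] 1 - single [y, x] 1 - single [x \<otimes>\<^bsub>L\<^esub> y] 1
      \<in> envelope_relations L"
    unfolding envelope_relations_def
    by (rule UnI2, intro CollectI exI conjI, rule refl, rule assms)
qed

context
  fixes L :: "('k::field, 'v) module"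
  assumes L: "lie_algebra L"
begin

interpretation L: lie_algebra L by (rule L)
interpretation A: ring "free_alg L" by (rule assoc_algebraD(1)[OF assoc_algebra_free_alg])

lemma L_smult_closed: "x \<in> carrier L \<Longrightarrow> c \<odot>\<^bsub>L\<^esub> x \<in> carrier L"
  using L.smult_closed[of c x] by simp

lemma envelope_relations_closed: "envelope_relations L \<subseteq> carrier (free_alg L)"
proof
  have s: "keys (single w c) \<subseteq> lists (carrier L)"
    if "w \<in> lists (carrier L)" for w :: "'v list" and c :: 'k
    using that by simp
  fix r assume "r \<in> envelope_relations L"
  then have "keys r \<subseteq> lists (carrier L)"
  proof (cases rule: envelope_relations_cases)
    case add
    then show ?thesis by (simp only: keys_diff_subset s L.M.a_closed lists.intros)
  next
    case smult
    then show ?thesis by (simp only: keys_diff_subset s L_smult_closed lists.intros)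
  next
    case bracket
    then show ?thesis by (simp only: keys_diff_subset s L.bracket_closed lists.intros)
  qed
  then show "r \<in> carrier (free_alg L)" by (simp add: free_alg_carrier)
qed

lemma envelope_ideal: "ideal (envelope_ideal L) (free_alg L)"
  unfolding envelope_ideal_def by (rule A.genideal_ideal[OF envelope_relations_closed])

lemma envelope_relations_ideal: "envelope_relations L \<subseteq> envelope_ideal L"
  unfolding envelope_ideal_def by (rule A.genideal_self[OF envelope_relations_closed])

lemma envelope_ideal_subspace: "lin_subspace (envelope_ideal L) (free_alg L)"
  by (rule ideal_lin_subspace[OF assoc_algebra_free_alg envelope_ideal])

lemma assoc_algebra_envelope: "assoc_algebra (envelope L)"
  unfolding envelope_def
  by (rule assoc_algebra_quotient[OF assoc_algebra_free_alg envelope_ideal envelope_ideal_subspace])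

lemma envelope_incl_closed:
  assumes "x \<in> carrier L"
  shows "envelope_incl L x \<in> carrier (envelope L)"
  unfolding envelope_incl_def envelope_def quotient_alg_surj[OF envelope_ideal_subspace, symmetric]
  using assms by (intro imageI single_free_alg) auto

lemma envelope_incl_add:
  assumes x: "x \<in> carrier L" and y: "y \<in> carrier L"
  shows "envelope_incl L (x \<oplus>\<^bsub>L\<^esub> y) = envelope_incl L x \<oplus>\<^bsub>envelope L\<^esub> envelope_incl L y"
proof -
  let ?s = "\<lambda>x. single [x] (1::'k)"
  have c: "?s z \<in> carrier (free_alg L)" if "z \<in> carrier L" for z using that by (intro single_free_alg) auto
  have "?s (x \<oplus>\<^bsub>L\<^esub> y) \<ominus>\<^bsub>free_alg L\<^esub> (?s x \<oplus>\<^bsub>free_alg L\<^esub> ?s y) = ?s (x \<oplus>\<^bsub>L\<^esub> y) - ?s x - ?s y"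
    using monoid_algebra_minus[OF c[OF L.M.a_closed[OF x y]] A.a_closed[OF c[OF x] c[OF y]]]
    by (simp only: monoid_algebra_simps(4) diff_diff_eq)
  also have "\<dots> \<in> envelope_ideal L"
    using envelope_relations_ideal envelope_relationsI(1)[OF x y] ..
  finally have "envelope_ideal L +>\<^bsub>free_alg L\<^esub> ?s (x \<oplus>\<^bsub>L\<^esub> y) =
      envelope_ideal L +>\<^bsub>free_alg L\<^esub> (?s x \<oplus>\<^bsub>free_alg L\<^esub> ?s y)"
    using quotient_alg_eq_iff[OF envelope_ideal_subspace c[OF L.M.a_closed[OF x y]] A.a_closed[OF c[OF x] c[OF y]]]
    by blast
  then show ?thesis
    unfolding envelope_incl_def envelope_def
      quotient_alg_add[OF envelope_ideal_subspace c[OF x] c[OF y]] .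
qed

lemma envelope_incl_smult:
  assumes x: "x \<in> carrier L"
  shows "envelope_incl L (c \<odot>\<^bsub>L\<^esub> x) = c \<odot>\<^bsub>envelope L\<^esub> envelope_incl L x"
proof -
  let ?s = "\<lambda>x. single [x] (1::'k)"
  have cl: "single [z] d \<in> carrier (free_alg L)" if "z \<in> carrier L" for z d
    using that by (intro single_free_alg) auto
  have e: "c \<odot>\<^bsub>free_alg L\<^esub> ?s x = single [x] c"
    by (simp add: monoid_algebra_simps map_mult_single)
  have "?s (c \<odot>\<^bsub>L\<^esub> x) \<ominus>\<^bsub>free_alg L\<^esub> single [x] c = ?s (c \<odot>\<^bsub>L\<^esub> x) - single [x] c"
    using x by (intro monoid_algebra_minus cl L_smult_closed)
  also have "\<dots> \<in> envelope_ideal L"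
    using envelope_relations_ideal envelope_relationsI(2)[OF x] ..
  finally have "envelope_ideal L +>\<^bsub>free_alg L\<^esub> ?s (c \<odot>\<^bsub>L\<^esub> x) =
      envelope_ideal L +>\<^bsub>free_alg L\<^esub> (c \<odot>\<^bsub>free_alg L\<^esub> ?s x)"
    using quotient_alg_eq_iff[OF envelope_ideal_subspace cl[OF L_smult_closed[OF x]] cl[OF x]]
    unfolding e by blast
  then show ?thesis
    unfolding envelope_incl_def envelope_def
      quotient_alg_smult[OF envelope_ideal_subspace cl[OF x]] .
qed

text \<open>The commutator relation is put as xy = yx + [x,y], with no difference in it: this is the
  shape in which the universal property assumes it and in which it exchanges two neighbouring
  letters.\<close>

lemma envelope_incl_bracket:
  assumes x: "x \<in> carrier L" and y: "y \<in> carrier L"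
  shows "envelope_incl L x \<otimes>\<^bsub>envelope L\<^esub> envelope_incl L y =
    (envelope_incl L y \<otimes>\<^bsub>envelope L\<^esub> envelope_incl L x) \<oplus>\<^bsub>envelope L\<^esub> envelope_incl L (x \<otimes>\<^bsub>L\<^esub> y)"
proof -
  let ?s = "\<lambda>x. single [x] (1::'k)"
  let ?b = "x \<otimes>\<^bsub>L\<^esub> y"
  have b: "?b \<in> carrier L" using x y L.bracket_closed by simp
  have c: "?s z \<in> carrier (free_alg L)" if "z \<in> carrier L" for z using that by (intro single_free_alg) auto
  have c2: "?s z \<otimes>\<^bsub>free_alg L\<^esub> ?s w \<in> carrier (free_alg L)" if "z \<in> carrier L" "w \<in> carrier L" for z w
    using c that by (intro A.m_closed)
  have "?s x \<otimes>\<^bsub>free_alg L\<^esub> ?s y \<ominus>\<^bsub>free_alg L\<^esub> (?s y \<otimes>\<^bsub>free_alg L\<^esub> ?s x \<oplus>\<^bsub>free_alg L\<^esub> ?s ?b) =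
      single [x, y] 1 - single [y, x] 1 - ?s ?b"
    using monoid_algebra_minus[OF c2[OF x y] A.a_closed[OF c2[OF y x] c[OF b]]]
    by (simp add: monoid_algebra_simps(4) free_alg_mult_single)
  also have "\<dots> \<in> envelope_ideal L"
    using envelope_relations_ideal envelope_relationsI(3)[OF x y] ..
  finally have "envelope_ideal L +>\<^bsub>free_alg L\<^esub> (?s x \<otimes>\<^bsub>free_alg L\<^esub> ?s y) =
      envelope_ideal L +>\<^bsub>free_alg L\<^esub> (?s y \<otimes>\<^bsub>free_alg L\<^esub> ?s x \<oplus>\<^bsub>free_alg L\<^esub> ?s ?b)"
    using quotient_alg_eq_iff[OF envelope_ideal_subspace c2[OF x y] A.a_closed[OF c2[OF y x] c[OF b]]]
    by simp
  then show ?thesis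
    unfolding envelope_incl_def envelope_def
      quotient_alg_add[OF envelope_ideal_subspace c2[OF y x] c[OF b]]
      quotient_alg_ideal_mult[OF assoc_algebra_free_alg envelope_ideal envelope_ideal_subspace c[OF x] c[OF y]]
      quotient_alg_ideal_mult[OF assoc_algebra_free_alg envelope_ideal envelope_ideal_subspace c[OF y] c[OF x]] .
qed

text \<open>The word product, extended linearly to the free algebra, is an algebra homomorphism that
  kills the defining relations, hence the ideal they generate, and so descends to cosets. It serves
  two purposes: it yields a coproduct, and it separates 1 from 0.\<close>

theorem envelope_universal:
  fixes T :: "('k, 'w) module"
  assumes T: "assoc_algebra T"
    and cl: "\<And>x. x \<in> carrier L \<Longrightarrow> \<delta> x \<in> carrier T"
    and add: "\<And>x y. x \<in> carrier L \<Longrightarrow> y \<in> carrier L \<Longrightarrow> \<delta> (x \<oplus>\<^bsub>L\<^esub> y) = \<delta> x \<oplus>\<^bsub>T\<^esub> \<delta> y"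
    and smult: "\<And>c x. x \<in> carrier L \<Longrightarrow> \<delta> (c \<odot>\<^bsub>L\<^esub> x) = c \<odot>\<^bsub>T\<^esub> \<delta> x"
    and bracket: "\<And>x y. x \<in> carrier L \<Longrightarrow> y \<in> carrier L \<Longrightarrow>
      \<delta> x \<otimes>\<^bsub>T\<^esub> \<delta> y = (\<delta> y \<otimes>\<^bsub>T\<^esub> \<delta> x) \<oplus>\<^bsub>T\<^esub> \<delta> (x \<otimes>\<^bsub>L\<^esub> y)"
  shows "\<exists>\<Delta>. \<Delta> \<in> LinearCombinations.module_hom class_ring (envelope L) T \<and> \<Delta> \<in> Ring.ring_hom (envelope L) T \<and>
    (\<forall>x\<in>carrier L. \<Delta> (envelope_incl L x) = \<delta> x)"
proof -
  let ?A = "free_alg L" and ?S = "lists (carrier L)" and ?I = "envelope_ideal L"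
  interpret T: ring T by (rule assoc_algebraD(1)[OF T])
  have vT: "vectorspace class_ring T" by (rule assoc_algebraD(2)[OF T])
  have sc: "\<And>c x. x \<in> carrier T \<Longrightarrow> c \<odot>\<^bsub>T\<^esub> x \<in> carrier T" by (rule assoc_algebraD(5)[OF T])
  interpret vT: vectorspace class_ring T by (rule vT)
  have one: "1 \<odot>\<^bsub>T\<^esub> x = x" if "x \<in> carrier T" for x using vT.smult_one[OF that] by simp
  have wc: "word_prod T \<delta> ws \<in> carrier T" if "ws \<in> ?S" for ws
    by (rule word_prod_closed[OF T.is_monoid cl that])
  have wa: "word_prod T \<delta> (ws @ vs) = word_prod T \<delta> ws \<otimes>\<^bsub>T\<^esub> word_prod T \<delta> vs" if "ws \<in> ?S" "vs \<in> ?S" for ws vs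
    by (rule word_prod_append[OF T.is_monoid cl that(2,1)])
  define \<Phi> where "\<Phi> = lin_ext T (word_prod T \<delta>)"
  have \<Phi>_closed: "\<Phi> f \<in> carrier T" if "keys f \<subseteq> ?S" for f
    unfolding \<Phi>_def by (rule lin_ext_closed[OF vT wc that])
  have \<Phi>_add: "\<Phi> (f + g) = \<Phi> f \<oplus>\<^bsub>T\<^esub> \<Phi> g" if "keys f \<subseteq> ?S" "keys g \<subseteq> ?S" for f g
    unfolding \<Phi>_def by (rule lin_ext_add[OF vT wc that])
  have \<Phi>_diff: "\<Phi> (f - g) = \<Phi> f \<ominus>\<^bsub>T\<^esub> \<Phi> g" if "keys f \<subseteq> ?S" "keys g \<subseteq> ?S" for f g
    unfolding \<Phi>_def by (rule lin_ext_diff[OF vT wc that])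
  have \<Phi>_smult: "\<Phi> (scale c f) = c \<odot>\<^bsub>T\<^esub> \<Phi> f" if "keys f \<subseteq> ?S" for c f
    unfolding \<Phi>_def by (rule lin_ext_smult[OF vT wc that])
  have \<Phi>_single: "\<Phi> (single ws c) = c \<odot>\<^bsub>T\<^esub> word_prod T \<delta> ws" if "ws \<in> ?S" for c ws
    unfolding \<Phi>_def by (rule lin_ext_single[OF vT wc that])
  have \<Phi>_zero: "\<Phi> 0 = \<zero>\<^bsub>T\<^esub>" unfolding \<Phi>_def by (rule lin_ext_zero[OF vT wc])
  have mcl: "keys (f \<otimes>\<^bsub>?A\<^esub> g) \<subseteq> ?S"
    if "keys f \<subseteq> ?S" "keys g \<subseteq> ?S" for f g
    using A.m_closed[of f g] that unfolding free_alg_carrier by simp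
  \<comment> \<open>Both sides are additive in each factor, so it suffices to compare scaled words,
    where concatenation turns into the product of \<open>T\<close> by \<open>wa\<close>.\<close>
  have \<Phi>_mult: "\<Phi> (f \<otimes>\<^bsub>?A\<^esub> g) = \<Phi> f \<otimes>\<^bsub>T\<^esub> \<Phi> g"
    if f: "keys f \<subseteq> ?S" and g: "keys g \<subseteq> ?S" for f g
    using f
  proof (induction rule: poly_mapping_induct_on)
    case zero
    show ?case by (simp add: monoid_algebra_mult_zero \<Phi>_zero \<Phi>_closed g)
  next
    case (add f1 f2)
    then show ?case
      by (simp add: monoid_algebra_distrib \<Phi>_add mcl g \<Phi>_closed T.l_distr)
  next
    case (single p c)
    note p = this
    show ?case using g
    proof (induction rule: poly_mapping_induct_on)
      case zero
      show ?case using p by (simp add: monoid_algebra_mult_zero \<Phi>_zero \<Phi>_closed)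
    next
      case (add f1 f2)
      then show ?case using p
        by (simp add: monoid_algebra_distrib \<Phi>_add mcl \<Phi>_closed T.r_distr)
    next
      case (single q d)
      have "\<Phi> (single p c \<otimes>\<^bsub>?A\<^esub> single q d) = (c * d) \<odot>\<^bsub>T\<^esub> (word_prod T \<delta> p \<otimes>\<^bsub>T\<^esub> word_prod T \<delta> q)"
        using p single by (simp only: free_alg_mult_single \<Phi>_single wa append_in_lists_conv)
      also have "\<dots> = (c \<odot>\<^bsub>T\<^esub> word_prod T \<delta> p) \<otimes>\<^bsub>T\<^esub> (d \<odot>\<^bsub>T\<^esub> word_prod T \<delta> q)"
        unfolding assoc_algebraD(3)[OF T wc[OF p] sc[OF wc[OF single]]] assoc_algebraD(4)[OF T wc[OF p] wc[OF single]]
        using vT.smult_assoc1[of c d, OF _ _ T.m_closed[OF wc[OF p] wc[OF single]]] by simp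
      finally show ?case using p single by (simp add: \<Phi>_single)
    qed
  qed
  have hom: "\<Phi> \<in> Ring.ring_hom ?A T"
    by (rule ring_hom_memI)
      (use \<Phi>_closed \<Phi>_mult \<Phi>_add \<Phi>_single[of "[]" 1] one in
        \<open>auto simp: free_alg_carrier free_alg_one monoid_algebra_simps(4)\<close>)
  interpret h: ring_hom_ring ?A T \<Phi>
    by (rule ring_hom_ringI2[OF A.ring_axioms T.ring_axioms hom])
  have rel: "\<Phi> r = \<zero>\<^bsub>T\<^esub>" if "r \<in> envelope_relations L" for r
  proof -
    have s: "keys (single [x] c) \<subseteq> ?S" "\<Phi> (single [x] c) = c \<odot>\<^bsub>T\<^esub> \<delta> x"
      if "x \<in> carrier L" for x and c :: 'k
      using that \<Phi>_single[of "[x]" c] cl[OF that] by simp_all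
    have s2: "keys (single [x, y] 1) \<subseteq> ?S"
      "\<Phi> (single [x, y] 1) = \<delta> x \<otimes>\<^bsub>T\<^esub> \<delta> y"
      if "x \<in> carrier L" "y \<in> carrier L" for x y
      using that \<Phi>_single[of "[x, y]" 1] cl one by simp_all
    show ?thesis using that
    proof (cases rule: envelope_relations_cases)
      case 1: (add x y)
      then have "\<Phi> r = \<delta> x \<oplus>\<^bsub>T\<^esub> \<delta> y \<ominus>\<^bsub>T\<^esub> \<delta> x \<ominus>\<^bsub>T\<^esub> \<delta> y"
        by (simp only: \<Phi>_diff keys_diff_subset s L.M.a_closed add one cl T.a_closed)
      also have "\<dots> = \<zero>\<^bsub>T\<^esub>" using cl[OF 1(1)] cl[OF 1(2)] by algebra
      finally show ?thesis .
    next
      case 2: (smult c x)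
      then have "\<Phi> r = c \<odot>\<^bsub>T\<^esub> \<delta> x \<ominus>\<^bsub>T\<^esub> c \<odot>\<^bsub>T\<^esub> \<delta> x"
        by (simp only: \<Phi>_diff s L_smult_closed smult one cl sc)
      then show ?thesis using 2 cl sc by (simp add: a_minus_def T.r_neg)
    next
      case 3: (bracket x y)
      have "\<Phi> r = (\<delta> y \<otimes>\<^bsub>T\<^esub> \<delta> x \<oplus>\<^bsub>T\<^esub> \<delta> (x \<otimes>\<^bsub>L\<^esub> y)) \<ominus>\<^bsub>T\<^esub> \<delta> y \<otimes>\<^bsub>T\<^esub> \<delta> x \<ominus>\<^bsub>T\<^esub> \<delta> (x \<otimes>\<^bsub>L\<^esub> y)"
        using 3 by (simp only: \<Phi>_diff keys_diff_subset s s2 L.bracket_closed bracket[OF 3(1,2)] one cl)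
      also have "\<dots> = \<zero>\<^bsub>T\<^esub>"
        using cl[OF L.bracket_closed[OF 3(1,2)]] T.m_closed[OF cl[OF 3(2)] cl[OF 3(1)]] by algebra
      finally show ?thesis .
    qed
  qed
  have sub: "?I \<subseteq> a_kernel ?A T \<Phi>"
    unfolding envelope_ideal_def
  proof (rule A.genideal_minimal[OF h.kernel_is_ideal], rule subsetI)
    fix r assume r: "r \<in> envelope_relations L"
    show "r \<in> a_kernel ?A T \<Phi>"
      unfolding a_kernel_def' using rel[OF r] subsetD[OF envelope_relations_closed r] by (intro CollectI conjI)
  qed
  have ker: "\<Phi> i = \<zero>\<^bsub>T\<^esub>" "i \<in> carrier ?A" if "i \<in> ?I" for i
    using subsetD[OF sub that] unfolding a_kernel_def' by simp_all
  \<comment> \<open>\<open>\<Phi>\<close> vanishes on the ideal and is therefore constant on each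
    coset; the image of a coset is a singleton, and \<open>the_elem\<close> reads off its
    element.\<close>
  define \<Delta> where "\<Delta> X = the_elem (\<Phi> ` X)" for X
  have \<Delta>: "\<Delta> (?I +>\<^bsub>?A\<^esub> f) = \<Phi> f" if f: "f \<in> carrier ?A" for f
  proof -
    have const: "\<Phi> z = \<Phi> f" if z: "z \<in> ?I +>\<^bsub>?A\<^esub> f" for z
    proof -
      obtain i where i: "i \<in> ?I" "z = i \<oplus>\<^bsub>?A\<^esub> f" using z unfolding a_r_coset_def' by blast
      show ?thesis unfolding i(2) h.hom_add[OF ker(2)[OF i(1)] f] ker(1)[OF i(1)]
        by (rule T.l_zero[OF h.hom_closed[OF f]])
    qed
    have "f \<in> ?I +>\<^bsub>?A\<^esub> f"
      using abelian_subgroup.a_rcos_self[OF lin_subspace_abelian_subgroup[OF envelope_ideal_subspace] f] .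
    then show ?thesis unfolding \<Delta>_def by (intro the_elem_image_unique const) blast
  qed
  have surj: "\<exists>f \<in> carrier ?A. X = ?I +>\<^bsub>?A\<^esub> f" if "X \<in> carrier (envelope L)" for X
    using that unfolding envelope_def quotient_alg_surj[OF envelope_ideal_subspace, symmetric] by blast
  note qa = quotient_alg_add[OF envelope_ideal_subspace, folded envelope_def, symmetric]
    and qs = quotient_alg_smult[OF envelope_ideal_subspace, folded envelope_def, symmetric]
    and qm = quotient_alg_ideal_mult[OF assoc_algebra_free_alg envelope_ideal envelope_ideal_subspace,
      folded envelope_def, symmetric]
  have Asc: "c \<odot>\<^bsub>?A\<^esub> f \<in> carrier ?A" if "f \<in> carrier ?A" for c f
    by (rule assoc_algebraD(5)[OF assoc_algebra_free_alg that])
  have \<Phi>_smult': "\<Phi> (c \<odot>\<^bsub>?A\<^esub> f) = c \<odot>\<^bsub>T\<^esub> \<Phi> f" if "f \<in> carrier ?A" for c f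
    using \<Phi>_smult[of f c] that unfolding free_alg_carrier monoid_algebra_simps(5) by simp
  have D_closed: "\<Delta> X \<in> carrier T" if X: "X \<in> carrier (envelope L)" for X
    using surj[OF X] \<Delta> h.hom_closed by auto
  have D_add: "\<Delta> (X \<oplus>\<^bsub>envelope L\<^esub> Y) = \<Delta> X \<oplus>\<^bsub>T\<^esub> \<Delta> Y"
    if X: "X \<in> carrier (envelope L)" and Y: "Y \<in> carrier (envelope L)" for X Y
  proof -
    obtain f g where "f \<in> carrier ?A" "X = ?I +>\<^bsub>?A\<^esub> f" "g \<in> carrier ?A" "Y = ?I +>\<^bsub>?A\<^esub> g"
      using surj[OF X] surj[OF Y] by blast
    then show ?thesis by (simp only: qa \<Delta> A.a_closed h.hom_add)
  qed
  have D_mult: "\<Delta> (X \<otimes>\<^bsub>envelope L\<^esub> Y) = \<Delta> X \<otimes>\<^bsub>T\<^esub> \<Delta> Y"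
    if X: "X \<in> carrier (envelope L)" and Y: "Y \<in> carrier (envelope L)" for X Y
  proof -
    obtain f g where "f \<in> carrier ?A" "X = ?I +>\<^bsub>?A\<^esub> f" "g \<in> carrier ?A" "Y = ?I +>\<^bsub>?A\<^esub> g"
      using surj[OF X] surj[OF Y] by blast
    then show ?thesis by (simp only: qm \<Delta> A.m_closed h.hom_mult)
  qed
  have D_smult: "\<Delta> (c \<odot>\<^bsub>envelope L\<^esub> X) = c \<odot>\<^bsub>T\<^esub> \<Delta> X" if X: "X \<in> carrier (envelope L)" for c X
  proof -
    obtain f where "f \<in> carrier ?A" "X = ?I +>\<^bsub>?A\<^esub> f" using surj[OF X] by blast
    then show ?thesis by (simp only: qs \<Delta> Asc \<Phi>_smult')
  qed
  have D_one: "\<Delta> \<one>\<^bsub>envelope L\<^esub> = \<one>\<^bsub>T\<^esub>"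
    unfolding envelope_def quotient_alg_simps(3) \<Delta>[OF A.one_closed] by (rule h.hom_one)
  have D_incl: "\<Delta> (envelope_incl L x) = \<delta> x" if "x \<in> carrier L" for x
    unfolding envelope_incl_def
    using that by (subst \<Delta>) (auto simp: single_free_alg \<Phi>_single one cl)
  show ?thesis
    by (rule exI[of _ \<Delta>])
      (auto simp: LinearCombinations.module_hom_def Ring.ring_hom_def D_closed D_add D_mult D_smult D_one D_incl)
qed

end

section \<open>Tensor products and the coproduct\<close>

lemma tensor_relations_cases:
  fixes A :: "('k::field, 'a) module" and B :: "('k, 'b) module"
  assumes "r \<in> tensor_relations A B"
  obtains (add_left) a a' b where "a \<in> carrier A" "a' \<in> carrier A" "b \<in> carrier B"
      "r = single (a \<oplus>\<^bsub>A\<^esub> a', b) 1 - single (a, b) 1 - single (a', b) 1"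
    | (add_right) a b b' where "a \<in> carrier A" "b \<in> carrier B" "b' \<in> carrier B"
      "r = single (a, b \<oplus>\<^bsub>B\<^esub> b') 1 - single (a, b) 1 - single (a, b') 1"
    | (smult_left) c a b where "a \<in> carrier A" "b \<in> carrier B"
      "r = single (c \<odot>\<^bsub>A\<^esub> a, b) 1 - single (a, b) c"
    | (smult_right) c a b where "a \<in> carrier A" "b \<in> carrier B"
      "r = single (a, c \<odot>\<^bsub>B\<^esub> b) 1 - single (a, b) c"
  using assms unfolding tensor_relations_def by (elim UnE CollectE exE conjE) metis+

lemma tensor_relationsI:
  fixes A :: "('k::field, 'a) module" and B :: "('k, 'b) module"
  assumes "a \<in> carrier A" "b \<in> carrier B"
  shows "a' \<in> carrier A \<Longrightarrow> single (a \<oplus>\<^bsub>A\<^esub> a', b) 1 - single (a, b) 1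
      - single (a', b) 1 \<in> tensor_relations A B"
    "b' \<in> carrier B \<Longrightarrow> single (a, b \<oplus>\<^bsub>B\<^esub> b') 1 - single (a, b) 1
      - single (a, b') 1 \<in> tensor_relations A B"
    "single (c \<odot>\<^bsub>A\<^esub> a, b) 1 - single (a, b) c \<in> tensor_relations A B"
    "single (a, c \<odot>\<^bsub>B\<^esub> b) 1 - single (a, b) c \<in> tensor_relations A B"
proof -
  show "a' \<in> carrier A \<Longrightarrow> single (a \<oplus>\<^bsub>A\<^esub> a', b) 1 - single (a, b) 1
      - single (a', b) 1 \<in> tensor_relations A B"
    unfolding tensor_relations_def
    by (rule UnI1, rule UnI1, rule UnI1, intro CollectI exI conjI, rule refl) (simp_all add: assms)
  show "b' \<in> carrier B \<Longrightarrow> single (a, b \<oplus>\<^bsub>B\<^esub> b') 1 - single (a, b) 1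
      - single (a, b') 1 \<in> tensor_relations A B"
    unfolding tensor_relations_def
    by (rule UnI1, rule UnI1, rule UnI2, intro CollectI exI conjI, rule refl) (simp_all add: assms)
  show "single (c \<odot>\<^bsub>A\<^esub> a, b) 1 - single (a, b) c \<in> tensor_relations A B"
    unfolding tensor_relations_def
    by (rule UnI1, rule UnI2, intro CollectI exI conjI, rule refl) (simp_all add: assms)
  show "single (a, c \<odot>\<^bsub>B\<^esub> b) 1 - single (a, b) c \<in> tensor_relations A B"
    unfolding tensor_relations_def
    by (rule UnI2, intro CollectI exI conjI, rule refl) (simp_all add: assms)
qed

context
  fixes A :: "('k::field, 'a) module" and B :: "('k, 'b) module"
  assumes A: "assoc_algebra A" and B: "assoc_algebra B"
begin

interpretation A: ring A by (rule assoc_algebraD(1)[OF A])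
interpretation B: ring B by (rule assoc_algebraD(1)[OF B])

abbreviation (input) "prodalg \<equiv> (monoid_algebra (A \<times>\<times> B) :: ('k, 'a \<times> 'b \<Rightarrow>\<^sub>0 'k) module)"

lemma assoc_algebra_prodalg: "assoc_algebra prodalg"
  by (rule assoc_algebra_monoid_algebra[OF DirProd_monoid[OF A.is_monoid B.is_monoid]])

interpretation C: ring prodalg by (rule assoc_algebraD(1)[OF assoc_algebra_prodalg])

lemma prodalg_carrier: "carrier prodalg = {f. keys f \<subseteq> carrier A \<times> carrier B}"
  by (simp add: monoid_algebra_simps)

lemma prodalg_mult_single:
  "single (a, b) c \<otimes>\<^bsub>prodalg\<^esub> single (a', b') c' =
   single (a \<otimes>\<^bsub>A\<^esub> a', b \<otimes>\<^bsub>B\<^esub> b') (c * c')"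
  by (simp add: monoid_algebra_mult_single)

lemma tensor_relations_closed: "tensor_relations A B \<subseteq> carrier prodalg"
proof
  have s: "keys (single (a, b) c) \<subseteq> carrier A \<times> carrier B"
    if "a \<in> carrier A" "b \<in> carrier B" for a b and c :: 'k
    using that by simp
  note sc = assoc_algebraD(5)[OF A] assoc_algebraD(5)[OF B]
  fix r assume "r \<in> tensor_relations A B"
  then have "keys r \<subseteq> carrier A \<times> carrier B"
    by (cases rule: tensor_relations_cases) (simp_all only: keys_diff_subset s sc A.a_closed B.a_closed)
  then show "r \<in> carrier prodalg" by (simp add: prodalg_carrier)
qed

lemma tensor_kernel_subspace: "lin_subspace (tensor_kernel A B) prodalg"
  unfolding tensor_kernel_def
  by (rule lin_span_subspace[OF assoc_algebraD(2)[OF assoc_algebra_prodalg] tensor_relations_closed])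

lemma tensor_relations_kernel: "tensor_relations A B \<subseteq> tensor_kernel A B"
  unfolding tensor_kernel_def
  by (rule lin_span_superset[OF assoc_algebraD(2)[OF assoc_algebra_prodalg] tensor_relations_closed])

text \<open>Basis elements multiply componentwise and both products are bilinear, so a translate of
  a relation is again a relation of the same family. This is what makes the kernel, introduced
  merely as a linear span, an ideal.\<close>

lemma tensor_relations_translate:
  assumes r: "r \<in> tensor_relations A B" and x: "x \<in> carrier A" and y: "y \<in> carrier B"
  shows "single (x, y) 1 \<otimes>\<^bsub>prodalg\<^esub> r \<in> tensor_relations A B" (is ?l)
    "r \<otimes>\<^bsub>prodalg\<^esub> single (x, y) 1 \<in> tensor_relations A B" (is ?r)
proof -
  note simps = monoid_algebra_diff prodalg_mult_single mult_1_left mult_1_right A.l_distr A.r_distr B.l_distr B.r_distr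
    assoc_algebraD(3,4)[OF A] assoc_algebraD(3,4)[OF B] A.m_closed B.m_closed x y
  show ?l using r
    by (cases rule: tensor_relations_cases) (simp_all only: simps tensor_relationsI)
  show ?r using r
    by (cases rule: tensor_relations_cases) (simp_all only: simps tensor_relationsI)
qed

lemma tensor_relations_mult:
  assumes f: "f \<in> carrier prodalg" and r: "r \<in> tensor_relations A B"
  shows "f \<otimes>\<^bsub>prodalg\<^esub> r \<in> tensor_kernel A B \<and> r \<otimes>\<^bsub>prodalg\<^esub> f \<in> tensor_kernel A B"
proof -
  note K = lin_subspaceD[OF tensor_kernel_subspace]
  note K0 = K(3)[unfolded monoid_algebra_simps(3)]
    and K1 = K(4)[unfolded monoid_algebra_simps(4)]
    and K2 = K(5)[unfolded monoid_algebra_simps(5)]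
  have "keys f \<subseteq> carrier A \<times> carrier B" using f by (simp add: prodalg_carrier)
  then show ?thesis
  proof (induction rule: poly_mapping_induct_on)
    case zero
    show ?case by (simp add: monoid_algebra_mult_zero K0)
  next
    case (add f g)
    then show ?case by (simp add: monoid_algebra_distrib K1)
  next
    case (single p c)
    obtain x y where p: "p = (x, y)" "x \<in> carrier A" "y \<in> carrier B" using single by auto
    have e: "single p c = scale c (single (x, y) 1)"
      by (simp add: map_mult_single p)
    show ?case unfolding e monoid_algebra_mult_smult
      using tensor_relations_translate[OF r p(2,3)] tensor_relations_kernel by (intro conjI K2) auto
  qed
qed

lemma tensor_kernel_ideal: "ideal (tensor_kernel A B) prodalg"
proof (rule idealI)
  note K = lin_subspaceD[OF tensor_kernel_subspace]
  show "ring prodalg" by (rule C.ring_axioms)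
  show "subgroup (tensor_kernel A B) (add_monoid prodalg)"
    using lin_subspace_abelian_subgroup[OF tensor_kernel_subspace]
    by (simp add: abelian_subgroup_def additive_subgroup_def)
  fix k f assume k: "k \<in> tensor_kernel A B" and f: "f \<in> carrier prodalg"
  \<comment> \<open>For fixed \<open>f\<close>, the elements whose products with \<open>f\<close> on
    both sides stay in the kernel form a subspace. It contains the relations, hence the whole
    kernel, which is their span.\<close>
  define W where "W = {k \<in> carrier prodalg. f \<otimes>\<^bsub>prodalg\<^esub> k \<in> tensor_kernel A B \<and> k \<otimes>\<^bsub>prodalg\<^esub> f \<in> tensor_kernel A B}"
  have "lin_subspace W prodalg"
  proof (rule lin_subspaceI[OF assoc_algebraD(2)[OF assoc_algebra_prodalg]])
    show "W \<subseteq> carrier prodalg" by (auto simp: W_def)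
    show "\<zero>\<^bsub>prodalg\<^esub> \<in> W" unfolding W_def using f K(3) by (simp only: mem_Collect_eq C.zero_closed C.l_null C.r_null)
    show "x \<oplus>\<^bsub>prodalg\<^esub> y \<in> W" if "x \<in> W" "y \<in> W" for x y
      using that f K(4) unfolding W_def by (simp only: mem_Collect_eq C.a_closed C.l_distr C.r_distr)
    show "c \<odot>\<^bsub>prodalg\<^esub> x \<in> W" if "x \<in> W" for c x
      using that f K(5) unfolding W_def
      by (simp only: mem_Collect_eq assoc_algebraD(3-5)[OF assoc_algebra_prodalg])
  qed
  moreover have "tensor_relations A B \<subseteq> W"
    unfolding W_def using tensor_relations_mult[OF f] tensor_relations_closed by (intro subsetI CollectI conjI) (simp_all only: subsetD)
  ultimately have "tensor_kernel A B \<subseteq> W" unfolding tensor_kernel_def by (rule lin_span_minimal)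
  then have "k \<in> W" using k by (rule subsetD)
  then show "f \<otimes>\<^bsub>prodalg\<^esub> k \<in> tensor_kernel A B" "k \<otimes>\<^bsub>prodalg\<^esub> f \<in> tensor_kernel A B"
    by (simp_all only: W_def mem_Collect_eq)
qed

lemma assoc_algebra_tensor: "assoc_algebra (tensor A B)"
  unfolding tensor_def
  by (rule assoc_algebra_quotient[OF assoc_algebra_prodalg tensor_kernel_ideal tensor_kernel_subspace])

lemma prodalg_single: "a \<in> carrier A \<Longrightarrow> b \<in> carrier B \<Longrightarrow> single (a, b) c \<in> carrier prodalg"
  by (simp add: prodalg_carrier)

lemma pure_tensor_closed: "a \<in> carrier A \<Longrightarrow> b \<in> carrier B \<Longrightarrow> pure_tensor A B a b \<in> carrier (tensor A B)"
  unfolding pure_tensor_def tensor_def quotient_alg_surj[OF tensor_kernel_subspace, symmetric]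
  by (intro imageI prodalg_single)

lemma pure_tensor_mult:
  assumes "a \<in> carrier A" "b \<in> carrier B" "a' \<in> carrier A" "b' \<in> carrier B"
  shows "pure_tensor A B a b \<otimes>\<^bsub>tensor A B\<^esub> pure_tensor A B a' b' =
    pure_tensor A B (a \<otimes>\<^bsub>A\<^esub> a') (b \<otimes>\<^bsub>B\<^esub> b')"
  unfolding pure_tensor_def tensor_def
    quotient_alg_ideal_mult[OF assoc_algebra_prodalg tensor_kernel_ideal tensor_kernel_subspace
      prodalg_single[OF assms(1,2)] prodalg_single[OF assms(3,4)], symmetric] prodalg_mult_single
  by simp

lemma pure_tensor_one: "\<one>\<^bsub>tensor A B\<^esub> = pure_tensor A B \<one>\<^bsub>A\<^esub> \<one>\<^bsub>B\<^esub>"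
  unfolding pure_tensor_def tensor_def quotient_alg_simps(3) by (simp add: monoid_algebra_simps(2))

lemma tensor_kernel_eqI:
  assumes "f \<in> carrier prodalg" "g \<in> carrier prodalg" "f - g \<in> tensor_relations A B"
  shows "tensor_kernel A B +>\<^bsub>prodalg\<^esub> f = tensor_kernel A B +>\<^bsub>prodalg\<^esub> g"
  unfolding quotient_alg_eq_iff[OF tensor_kernel_subspace assms(1,2)] monoid_algebra_minus[OF assms(1,2)]
  using tensor_relations_kernel assms(3) by (rule subsetD)

lemma pure_tensor_add_left:
  assumes a: "a \<in> carrier A" and a': "a' \<in> carrier A" and b: "b \<in> carrier B"
  shows "pure_tensor A B (a \<oplus>\<^bsub>A\<^esub> a') b = pure_tensor A B a b \<oplus>\<^bsub>tensor A B\<^esub> pure_tensor A B a' b"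
proof -
  note c = prodalg_single[OF a b, of 1] prodalg_single[OF a' b, of 1]
  show ?thesis
    unfolding pure_tensor_def tensor_def quotient_alg_add[OF tensor_kernel_subspace c, symmetric]
    using tensor_relationsI(1)[OF a b a']
    by (intro tensor_kernel_eqI prodalg_single C.a_closed c A.a_closed a a' b)
      (simp only: monoid_algebra_simps(4) diff_diff_eq)
qed

lemma pure_tensor_add_right:
  assumes a: "a \<in> carrier A" and b: "b \<in> carrier B" and b': "b' \<in> carrier B"
  shows "pure_tensor A B a (b \<oplus>\<^bsub>B\<^esub> b') = pure_tensor A B a b \<oplus>\<^bsub>tensor A B\<^esub> pure_tensor A B a b'"
proof -
  note c = prodalg_single[OF a b, of 1] prodalg_single[OF a b', of 1]
  show ?thesis
    unfolding pure_tensor_def tensor_def quotient_alg_add[OF tensor_kernel_subspace c, symmetric]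
    using tensor_relationsI(2)[OF a b b']
    by (intro tensor_kernel_eqI prodalg_single C.a_closed c B.a_closed a b b')
      (simp only: monoid_algebra_simps(4) diff_diff_eq)
qed

lemma pure_tensor_smult_left:
  assumes a: "a \<in> carrier A" and b: "b \<in> carrier B"
  shows "pure_tensor A B (c \<odot>\<^bsub>A\<^esub> a) b = c \<odot>\<^bsub>tensor A B\<^esub> pure_tensor A B a b"
proof -
  have e: "c \<odot>\<^bsub>prodalg\<^esub> single (a, b) 1 = single (a, b) c"
    by (simp add: monoid_algebra_simps(5) map_mult_single)
  show ?thesis
    unfolding pure_tensor_def tensor_def quotient_alg_smult[OF tensor_kernel_subspace prodalg_single[OF a b], symmetric] e
    by (intro tensor_kernel_eqI prodalg_single assoc_algebraD(5)[OF A] a b tensor_relationsI(3))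
qed

lemma pure_tensor_smult_right:
  assumes a: "a \<in> carrier A" and b: "b \<in> carrier B"
  shows "pure_tensor A B a (c \<odot>\<^bsub>B\<^esub> b) = c \<odot>\<^bsub>tensor A B\<^esub> pure_tensor A B a b"
proof -
  have e: "c \<odot>\<^bsub>prodalg\<^esub> single (a, b) 1 = single (a, b) c"
    by (simp add: monoid_algebra_simps(5) map_mult_single)
  show ?thesis
    unfolding pure_tensor_def tensor_def quotient_alg_smult[OF tensor_kernel_subspace prodalg_single[OF a b], symmetric] e
    by (intro tensor_kernel_eqI prodalg_single assoc_algebraD(5)[OF B] a b tensor_relationsI(4))
qed

end

text \<open>A choice satisfies its specification as soon as some map does. Such a map comes from the
  universal property applied to x |-> x tensor 1 + 1 tensor x, so the work is to check that this
  assignment respects brackets.\<close>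

lemma comult:
  fixes L :: "('k::field, 'v) module"
  assumes L: "lie_algebra L"
  defines "U \<equiv> envelope L"
  defines "T \<equiv> tensor U U"
  shows "comult L \<in> LinearCombinations.module_hom class_ring U T"
    and "comult L \<in> Ring.ring_hom U T"
    and "x \<in> carrier L \<Longrightarrow> comult L (envelope_incl L x) =
      pure_tensor U U (envelope_incl L x) \<one>\<^bsub>U\<^esub> \<oplus>\<^bsub>T\<^esub> pure_tensor U U \<one>\<^bsub>U\<^esub> (envelope_incl L x)"
proof -
  have U: "assoc_algebra U" unfolding U_def by (rule assoc_algebra_envelope[OF L])
  have T: "assoc_algebra T" unfolding T_def by (rule assoc_algebra_tensor[OF U U])
  interpret U: ring U by (rule assoc_algebraD(1)[OF U])
  interpret T: ring T by (rule assoc_algebraD(1)[OF T])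
  interpret vT: vectorspace class_ring T by (rule assoc_algebraD(2)[OF T])
  interpret L: lie_algebra L by (rule L)
  let ?p = "pure_tensor U U" and ?i = "envelope_incl L"
  note i = envelope_incl_closed[OF L, folded U_def]
  note p = pure_tensor_closed[OF U U, folded T_def]
  note pm = pure_tensor_mult[OF U U, folded T_def]
  note pal = pure_tensor_add_left[OF U U, folded T_def]
  note par = pure_tensor_add_right[OF U U, folded T_def]
  define \<delta> where "\<delta> x = ?p (?i x) \<one>\<^bsub>U\<^esub> \<oplus>\<^bsub>T\<^esub> ?p \<one>\<^bsub>U\<^esub> (?i x)" for x
  have "\<exists>\<Delta>. \<Delta> \<in> LinearCombinations.module_hom class_ring U T \<and> \<Delta> \<in> Ring.ring_hom U T \<and>
       (\<forall>x\<in>carrier L. \<Delta> (?i x) = \<delta> x)"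
    unfolding U_def
  proof (rule envelope_universal[OF L T])
    show "\<delta> x \<in> carrier T" if "x \<in> carrier L" for x
      unfolding \<delta>_def using i[OF that] by (intro T.a_closed p U.one_closed)
    show "\<delta> (x \<oplus>\<^bsub>L\<^esub> y) = \<delta> x \<oplus>\<^bsub>T\<^esub> \<delta> y" if xy: "x \<in> carrier L" "y \<in> carrier L" for x y
    proof -
      note c = i[OF xy(1)] i[OF xy(2)] U.one_closed
      show ?thesis
        unfolding \<delta>_def envelope_incl_add[OF L xy, folded U_def] pal[OF c] par[OF c(3,1,2)]
        using p[OF c(1,3)] p[OF c(2,3)] p[OF c(3,1)] p[OF c(3,2)] by (simp add: T.a_ac)
    qed
    show "\<delta> (c \<odot>\<^bsub>L\<^esub> x) = c \<odot>\<^bsub>T\<^esub> \<delta> x" if x: "x \<in> carrier L" for c x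
      unfolding \<delta>_def envelope_incl_smult[OF L x, folded U_def]
        pure_tensor_smult_left[OF U U i[OF x] U.one_closed, folded T_def]
        pure_tensor_smult_right[OF U U U.one_closed i[OF x], folded T_def]
      using vT.smult_r_distr[OF _ p[OF i[OF x] U.one_closed] p[OF U.one_closed i[OF x]], of c] by simp
    show "\<delta> x \<otimes>\<^bsub>T\<^esub> \<delta> y = (\<delta> y \<otimes>\<^bsub>T\<^esub> \<delta> x) \<oplus>\<^bsub>T\<^esub> \<delta> (x \<otimes>\<^bsub>L\<^esub> y)"
      if xy: "x \<in> carrier L" "y \<in> carrier L" for x y
    proof -
      let ?b = "?i (x \<otimes>\<^bsub>L\<^esub> y)"
      \<comment> \<open>The mixed terms u tensor v and v tensor u together are symmetric in u and v.
        The products for (x, y) and for (y, x) therefore share them and differ only in the terms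
        with xy and yx.\<close>
      have exp: "\<delta> u \<otimes>\<^bsub>T\<^esub> \<delta> v = (?p (?i u \<otimes>\<^bsub>U\<^esub> ?i v) \<one>\<^bsub>U\<^esub> \<oplus>\<^bsub>T\<^esub> ?p (?i u) (?i v)) \<oplus>\<^bsub>T\<^esub>
          (?p (?i v) (?i u) \<oplus>\<^bsub>T\<^esub> ?p \<one>\<^bsub>U\<^esub> (?i u \<otimes>\<^bsub>U\<^esub> ?i v))"
        if uv: "u \<in> carrier L" "v \<in> carrier L" for u v
      proof -
        note c = i[OF uv(1)] i[OF uv(2)] U.one_closed
        show ?thesis unfolding \<delta>_def
          using c p[OF c(1,3)] p[OF c(2,3)] p[OF c(3,1)] p[OF c(3,2)] p[OF U.m_closed[OF c(1,2)] c(3)]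
            p[OF c(3) U.m_closed[OF c(1,2)]] p[OF c(1,2)] p[OF c(2,1)]
          by (simp add: T.l_distr T.r_distr pm T.a_ac)
      qed
      note c = i[OF xy(1)] i[OF xy(2)] i[OF L.bracket_closed[OF xy]] U.one_closed
      note m = U.m_closed[OF c(2,1)]
      have br: "?i x \<otimes>\<^bsub>U\<^esub> ?i y = (?i y \<otimes>\<^bsub>U\<^esub> ?i x) \<oplus>\<^bsub>U\<^esub> ?b"
        using envelope_incl_bracket[OF L xy] by (simp add: U_def)
      show ?thesis
        unfolding exp[OF xy] exp[OF xy(2,1)] unfolding br pal[OF m c(3,4)] par[OF c(4) m c(3)] unfolding \<delta>_def
        using p[OF m c(4)] p[OF c(4) m] p[OF c(1,2)] p[OF c(2,1)] p[OF c(3,4)] p[OF c(4,3)]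
        by (simp add: T.a_ac)
    qed
  qed
  then have *: "\<exists>\<Delta>. \<Delta> \<in> LinearCombinations.module_hom class_ring U T \<and> \<Delta> \<in> Ring.ring_hom U T \<and>
       (\<forall>x\<in>carrier L. \<Delta> (?i x) = ?p (?i x) \<one>\<^bsub>U\<^esub> \<oplus>\<^bsub>T\<^esub> ?p \<one>\<^bsub>U\<^esub> (?i x))"
    unfolding \<delta>_def .
  have "comult L = (SOME \<Delta>. \<Delta> \<in> LinearCombinations.module_hom class_ring U T \<and> \<Delta> \<in> Ring.ring_hom U T \<and>
       (\<forall>x\<in>carrier L. \<Delta> (?i x) = ?p (?i x) \<one>\<^bsub>U\<^esub> \<oplus>\<^bsub>T\<^esub> ?p \<one>\<^bsub>U\<^esub> (?i x)))"
    unfolding comult_def Let_def U_def T_def ..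
  with someI_ex[OF *] show "comult L \<in> LinearCombinations.module_hom class_ring U T"
    and "comult L \<in> Ring.ring_hom U T"
    and "x \<in> carrier L \<Longrightarrow> comult L (envelope_incl L x) =
      pure_tensor U U (envelope_incl L x) \<one>\<^bsub>U\<^esub> \<oplus>\<^bsub>T\<^esub> pure_tensor U U \<one>\<^bsub>U\<^esub> (envelope_incl L x)"
    by simp_all
qed

section \<open>The Witt algebra\<close>

lemma witt_simps:
  "carrier witt = UNIV" "zero witt = 0" "add witt = (+)"
  "smult witt = (\<lambda>c. scale c)"
  by (simp_all add: witt_def)

lemma witt_mult:
  fixes f g :: "int \<Rightarrow>\<^sub>0 'k::field"
  assumes "finite X" "finite Y" "keys f \<subseteq> X" "keys g \<subseteq> Y"
  shows "f \<otimes>\<^bsub>witt\<^esub> g = (\<Sum>i\<in>X. \<Sum>j\<in>Y.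
     single (i + j) (of_int (j - i) * lookup f i * lookup g j))"
proof -
  have "(\<Sum>j\<in>keys g. single (i + j) (of_int (j - i) * lookup f i * lookup g j)) =
      (\<Sum>j\<in>Y. single (i + j) (of_int (j - i) * lookup f i * lookup g j))" for i
    by (rule sum.mono_neutral_left) (use assms in \<open>auto simp: in_keys_iff\<close>)
  then have "f \<otimes>\<^bsub>witt\<^esub> g = (\<Sum>i\<in>keys f. \<Sum>j\<in>Y.
     single (i + j) (of_int (j - i) * lookup f i * lookup g j))"
    by (simp add: witt_def)
  also have "\<dots> = (\<Sum>i\<in>X. \<Sum>j\<in>Y.
     single (i + j) (of_int (j - i) * lookup f i * lookup g j))"
    by (rule sum.mono_neutral_left) (use assms in \<open>auto simp: in_keys_iff\<close>)
  finally show ?thesis .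
qed

lemma witt_mult_single:
  "single i a \<otimes>\<^bsub>witt\<^esub> single j b =
   single (i + j) (of_int (j - i) * a * (b::'k::field))"
  by (subst witt_mult[of "{i}" "{j}"]) auto

lemma witt_distrib:
  fixes f g h :: "int \<Rightarrow>\<^sub>0 'k::field"
  shows "(f + g) \<otimes>\<^bsub>witt\<^esub> h = f \<otimes>\<^bsub>witt\<^esub> h + g \<otimes>\<^bsub>witt\<^esub> h"
    "h \<otimes>\<^bsub>witt\<^esub> (f + g) = h \<otimes>\<^bsub>witt\<^esub> f + h \<otimes>\<^bsub>witt\<^esub> g"
proof -
  define X where "X = keys f \<union> keys g \<union> keys h"
  have X: "finite X" "keys f \<subseteq> X" "keys g \<subseteq> X" "keys h \<subseteq> X"
    "keys (f + g) \<subseteq> X"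
    using Poly_Mapping.keys_add[of f g] by (auto simp: X_def)
  show "(f + g) \<otimes>\<^bsub>witt\<^esub> h = f \<otimes>\<^bsub>witt\<^esub> h + g \<otimes>\<^bsub>witt\<^esub> h"
    "h \<otimes>\<^bsub>witt\<^esub> (f + g) = h \<otimes>\<^bsub>witt\<^esub> f + h \<otimes>\<^bsub>witt\<^esub> g"
    by (simp_all add: witt_mult[OF X(1,1)] X lookup_add distrib_left distrib_right
        Poly_Mapping.single_add sum.distrib)
qed

lemma witt_mult_zero: "0 \<otimes>\<^bsub>witt\<^esub> h = 0" "h \<otimes>\<^bsub>witt\<^esub> 0 = (0 :: int \<Rightarrow>\<^sub>0 'k::field)"
  by (simp_all add: witt_def)

lemma witt_mult_smult:
  fixes f g :: "int \<Rightarrow>\<^sub>0 'k::field"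
  shows "scale c f \<otimes>\<^bsub>witt\<^esub> g = scale c (f \<otimes>\<^bsub>witt\<^esub> g)"
    "f \<otimes>\<^bsub>witt\<^esub> scale c g = scale c (f \<otimes>\<^bsub>witt\<^esub> g)"
  by (simp_all add: witt_mult[of "keys f" "keys g"] keys_map_mult
      map_mult_sum map_mult_single mult_ac)

lemma witt_induct [case_names zero add single]:
  fixes f :: "int \<Rightarrow>\<^sub>0 'k::field"
  assumes "P 0" "\<And>f g. P f \<Longrightarrow> P g \<Longrightarrow> P (f + g)" "\<And>i c. P (single i c)"
  shows "P f"
  by (rule poly_mapping_induct_on[of f UNIV]) (simp_all add: assms)

lemma vectorspace_witt: "vectorspace class_ring (witt :: ('k::field, int \<Rightarrow>\<^sub>0 'k) module)"
proof (rule vs_criteria)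
  show "field (class_ring :: 'k ring)" by (rule class_field)
  show "\<forall>v\<in>carrier witt. \<exists>neg_v\<in>carrier witt. v \<oplus>\<^bsub>witt\<^esub> neg_v = \<zero>\<^bsub>witt :: ('k, int \<Rightarrow>\<^sub>0 'k) module\<^esub>"
  proof
    fix v :: "int \<Rightarrow>\<^sub>0 'k"
    show "\<exists>neg_v\<in>carrier witt. v \<oplus>\<^bsub>witt\<^esub> neg_v = \<zero>\<^bsub>witt\<^esub>"
      by (intro bexI[of _ "- v"]) (simp_all add: witt_simps)
  qed
qed (auto simp: witt_simps add_ac lookup_add distrib_left distrib_right mult.assoc intro!: poly_mapping_eqI)

lemma witt_antisym: "f \<otimes>\<^bsub>witt\<^esub> g = - (g \<otimes>\<^bsub>witt\<^esub> (f :: int \<Rightarrow>\<^sub>0 'k::field))"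
proof (induction f rule: witt_induct)
  case (single i c)
  show ?case
  proof (induction g rule: witt_induct)
    case (single j d)
    show ?case
      by (simp add: witt_mult_single add.commute Poly_Mapping.single_uminus[symmetric] algebra_simps)
  qed (simp_all add: witt_mult_zero witt_distrib)
qed (simp_all add: witt_mult_zero witt_distrib)

text \<open>By additivity in each argument it suffices to treat multiples of basis vectors. There
  all three summands are multiples of e_(i+j+k), and their coefficients (k-j)(j+k-i), (i-k)(k+i-j)
  and (j-i)(i+j-k) add up to 0.\<close>

lemma witt_jacobi:
  fixes f g h :: "int \<Rightarrow>\<^sub>0 'k::field"
  shows "f \<otimes>\<^bsub>witt\<^esub> (g \<otimes>\<^bsub>witt\<^esub> h) + (g \<otimes>\<^bsub>witt\<^esub> (h \<otimes>\<^bsub>witt\<^esub> f) + h \<otimes>\<^bsub>witt\<^esub> (f \<otimes>\<^bsub>witt\<^esub> g)) = 0"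
proof (induction f rule: witt_induct)
  case (single i a)
  show ?case
  proof (induction g rule: witt_induct)
    case (single j b)
    show ?case
    proof (induction h rule: witt_induct)
      case (single k c)
      have e: "i + (j + k) = i + j + k" "j + (k + i) = i + j + k" "k + (i + j) = i + j + k" by simp_all
      show ?case
        unfolding witt_mult_single e Poly_Mapping.single_add[symmetric]
        by (rule poly_mapping_eqI) (simp add: lookup_single when_def algebra_simps)
    next
      case (add h1 h2)
      \<comment> \<open>The Jacobi expression is additive in the argument under induction, so the
        sum of the two induction hypotheses is the claim.\<close>
      from arg_cong2[OF add(1) add(2), of "(+)"] show ?case
        by (simp add: witt_distrib add_ac)
    qed (simp add: witt_mult_zero)
  next
    case (add h1 h2)
    from arg_cong2[OF add(1) add(2), of "(+)"] show ?case
      by (simp add: witt_distrib add_ac)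
  qed (simp add: witt_mult_zero)
next
  case (add h1 h2)
  from arg_cong2[OF add(1) add(2), of "(+)"] show ?case
    by (simp add: witt_distrib add_ac)
qed (simp add: witt_mult_zero)

lemma lie_algebra_witt: "lie_algebra (witt :: ('k::field_char_0, int \<Rightarrow>\<^sub>0 'k) module)"
proof (rule lie_algebra.intro[OF vectorspace_witt], rule lie_algebra_axioms.intro)
  fix x :: "int \<Rightarrow>\<^sub>0 'k"
  \<comment> \<open>Antisymmetry only says 2 [x,x] = 0; dividing by 2 is possible in characteristic
    0.\<close>
  have "2 * lookup (x \<otimes>\<^bsub>witt\<^esub> x) i = 0" for i
    using arg_cong[OF witt_antisym[of x x], of "\<lambda>f. lookup f i"] by simp
  then show "x \<otimes>\<^bsub>witt\<^esub> x = \<zero>\<^bsub>witt\<^esub>"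
    by (intro poly_mapping_eqI) (simp add: witt_simps)
qed (simp_all add: witt_simps witt_distrib witt_mult_smult witt_jacobi)

section \<open>Generation and simplicity of the Witt algebra\<close>

lemma single_eq_smult:
  "single i (c::'k::field) = scale c (single i 1)"
  by (simp add: map_mult_single)

lemma witt_subspace_eqI:
  fixes S :: "(int \<Rightarrow>\<^sub>0 'k::field) set"
  assumes "lin_subspace S witt" "\<And>i. single i 1 \<in> S"
  shows "S = UNIV"
proof -
  note S = lin_subspaceD[OF assms(1), unfolded witt_simps]
  have "f \<in> S" for f
  proof (induction f rule: witt_induct)
    case (single i c)
    show ?case unfolding single_eq_smult[of i c] by (rule S(5)[OF assms(2)])
  qed (simp_all add: S)
  then show ?thesis by blast
qed

lemma witt_unscale:
  fixes S :: "(int \<Rightarrow>\<^sub>0 'k::field) set"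
  assumes "lin_subspace S witt" "single i c \<in> S" "c \<noteq> 0"
  shows "single i 1 \<in> S"
proof -
  have "scale (inverse c) (single i c) \<in> S"
    using lin_subspaceD(5)[OF assms(1,2), of "inverse c"] by (simp add: witt_simps)
  then show ?thesis using assms(3) by (simp add: map_mult_single)
qed

text \<open>[e_1, e_i] = (i - 1) e_(i+1) is a nonzero multiple of e_(i+1) for i >= 2, and
  symmetrically with e_-1 below -2. The bound 2 is sharp: e_-1, e_0, e_1 span a proper subalgebra
  isomorphic to sl_2.\<close>

lemma witt_generated:
  fixes S :: "(int \<Rightarrow>\<^sub>0 'k::field_char_0) set"
  assumes S: "lie_subalgebra S witt" and gen: "\<And>i. \<bar>i\<bar> \<le> 2 \<Longrightarrow> single i 1 \<in> S"
  shows "S = UNIV"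
proof (rule witt_subspace_eqI)
  show sub: "lin_subspace S witt" using S by (simp add: lie_subalgebra_def)
  have br: "single (i + j) 1 \<in> S"
    if "single i 1 \<in> S" "single j 1 \<in> S" "i \<noteq> j" for i j
  proof (rule witt_unscale[OF sub])
    show "single (i + j) (of_int (j - i)) \<in> S"
      using S that(1,2) witt_mult_single[of i 1 j "1::'k"] unfolding lie_subalgebra_def by force
    show "of_int (j - i) \<noteq> (0::'k)" using that(3) by (simp only: of_int_eq_0_iff)
  qed
  have up: "single i 1 \<in> S" if "2 \<le> i" for i
    using that
  proof (induction i rule: int_ge_induct)
    case (step i)
    then show ?case using br[of 1 i] gen[of 1] by (simp add: add.commute)
  qed (simp add: gen)
  have down: "single i 1 \<in> S" if "i \<le> - 2" for i
    using that
  proof (induction i rule: int_le_induct)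
    case (step i)
    then show ?case using br[of "-1" i] gen[of "-1"] by simp
  qed (simp add: gen)
  show "single i 1 \<in> S" for i
    using up[of i] down[of i] gen[of i] by linarith
qed

text \<open>ad e_0 multiplies e_i by i, and these eigenvalues are distinct. A nonzero element of
  \<open>J\<close> with smallest support must then be a multiple of a single e_n, since otherwise ad
  e_0 - n would produce a nonzero element of \<open>J\<close> with smaller support. From e_n the
  brackets with basis vectors reach everything.\<close>

lemma witt_simple:
  fixes J :: "(int \<Rightarrow>\<^sub>0 'k::field_char_0) set"
  assumes sub: "lin_subspace J witt" and ideal: "\<And>x y. y \<in> J \<Longrightarrow> x \<otimes>\<^bsub>witt\<^esub> y \<in> J"
    and nz: "x \<in> J" "x \<noteq> 0"
  shows "J = UNIV"
proof -
  note J = lin_subspaceD[OF sub, unfolded witt_simps]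
  define x where "x = arg_min (\<lambda>x. card (keys x)) (\<lambda>x. x \<in> J \<and> x \<noteq> 0)"
  have x: "x \<in> J" "x \<noteq> 0" and min: "\<And>y. y \<in> J \<Longrightarrow> y \<noteq> 0 \<Longrightarrow> card (keys x) \<le> card (keys y)"
    using arg_min_nat_lemma[of "\<lambda>x. x \<in> J \<and> x \<noteq> 0" _ "\<lambda>x. card (keys x)"] nz
    unfolding x_def[symmetric] by blast+
  obtain n where n: "lookup x n \<noteq> 0"
    using x(2) by (metis lookup_zero poly_mapping_eqI)
  have ad: "lookup (single 0 1 \<otimes>\<^bsub>witt\<^esub> y) i = of_int i * lookup y i"
    for y :: "int \<Rightarrow>\<^sub>0 'k" and i
  proof (induction y rule: witt_induct)
    case (single j c)
    show ?case by (simp add: witt_mult_single lookup_single when_def del: single_one)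
  qed (simp_all add: witt_mult_zero witt_distrib lookup_add distrib_left)
  \<comment> \<open>Applying ad e_0 - n removes the component at n and rescales each other one by
    the nonzero number i - n; by minimality of the support nothing can remain.\<close>
  define y where "y = single 0 1 \<otimes>\<^bsub>witt\<^esub> x + scale (- of_int n) x"
  have ly: "lookup y i = of_int (i - n) * lookup x i" for i
    by (simp add: y_def lookup_add ad algebra_simps del: single_one)
  have "y \<in> J" unfolding y_def by (intro J(4) J(5) ideal x)
  moreover have "keys y = keys x - {n}"
    by (auto simp: in_keys_iff ly)
  then have "card (keys y) < card (keys x)"
    using n by (metis card_Diff1_less finite_keys in_keys_iff)
  ultimately have "y = 0" using min[of y] by (meson leD)
  then have z: "lookup x i = 0" if "i \<noteq> n" for i
    using ly[of i] that by simp
  have "x = single n (lookup x n)"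
    by (rule poly_mapping_eqI) (simp add: lookup_single when_def z)
  then have en: "single n 1 \<in> J"
    using witt_unscale[OF sub _ n, of n] x(1) by simp
  have br: "single (i + j) 1 \<in> J" if "single j 1 \<in> J" "i \<noteq> j" for i j
  proof (rule witt_unscale[OF sub])
    show "single (i + j) (of_int (j - i)) \<in> J"
      using ideal[OF that(1), of "single i 1"] witt_mult_single[of i 1 j "1::'k"] by simp
    show "of_int (j - i) \<noteq> (0::'k)" using that(2) by (simp only: of_int_eq_0_iff)
  qed
  \<comment> \<open>[e_(m-n), e_n] = (2n - m) e_m, which gives every basis vector but
    e_(2n).\<close>
  have most: "single m 1 \<in> J" if "m \<noteq> 2 * n" for m
    using br[OF en, of "m - n"] that by simp
  have "single m 1 \<in> J" for m
  proof (cases "m = 2 * n")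
    case True
    have "single (2 * n + 1) 1 \<in> J" by (rule most) simp
    then have "single (m + 1) 1 \<in> J" "single (m - 1) 1 \<in> J"
      using most[of "m - 1"] True by (simp_all add: add.commute)
    \<comment> \<open>The missing e_m is reached from a neighbour: [e_-1, e_(m+1)] = (m + 2) e_m,
      and when m = -2 makes this vanish, [e_1, e_(m-1)] = (m - 2) e_m is nonzero.\<close>
    then show ?thesis
      using br[of "m + 1" "-1"] br[of "m - 1" 1] by (cases "m + 1 = -1") simp_all
  qed (rule most)
  then show ?thesis by (rule witt_subspace_eqI[OF sub])
qed

section \<open>Sections isomorphic to the Witt algebra\<close>

text \<open>A section is recorded by a surjective homomorphism rather than by an isomorphism with a
  quotient: no cosets appear, and passing to subalgebras, preimages and images only changes
  \<open>H\<close> and \<open>h\<close>.\<close>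

definition witt_epi :: "('k::field, 'u) module \<Rightarrow> 'u set \<Rightarrow> ('u \<Rightarrow> int \<Rightarrow>\<^sub>0 'k) \<Rightarrow> bool" where
  "witt_epi L H h \<longleftrightarrow> lie_subalgebra H L \<and>
     (\<forall>x\<in>H. \<forall>y\<in>H. h (x \<oplus>\<^bsub>L\<^esub> y) = h x + h y \<and> h (x \<otimes>\<^bsub>L\<^esub> y) = h x \<otimes>\<^bsub>witt\<^esub> h y) \<and>
     (\<forall>c. \<forall>x\<in>H. h (c \<odot>\<^bsub>L\<^esub> x) = scale c (h x)) \<and> h ` H = UNIV"

definition witt_section :: "('k::field, 'u) module \<Rightarrow> bool" where
  "witt_section L \<longleftrightarrow> (\<exists>H h. witt_epi L H h)"

lemma witt_sectionI:
  fixes L :: "('k::field, 'u) module" and h :: "'u \<Rightarrow> int \<Rightarrow>\<^sub>0 'k"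
  assumes "lie_subalgebra H L"
    "\<And>x y. x \<in> H \<Longrightarrow> y \<in> H \<Longrightarrow> h (x \<oplus>\<^bsub>L\<^esub> y) = h x + h y"
    "\<And>x y. x \<in> H \<Longrightarrow> y \<in> H \<Longrightarrow> h (x \<otimes>\<^bsub>L\<^esub> y) = h x \<otimes>\<^bsub>witt\<^esub> h y"
    "\<And>c x. x \<in> H \<Longrightarrow> h (c \<odot>\<^bsub>L\<^esub> x) = scale c (h x)"
    "h ` H = UNIV"
  shows "witt_section L"
  unfolding witt_section_def witt_epi_def using assms by (intro exI[of _ H] exI[of _ h] conjI ballI allI)

lemma witt_epiD:
  fixes L :: "('k::field, 'u) module"
  assumes "witt_epi L H h"
  shows "lie_subalgebra H L"
    "x \<in> H \<Longrightarrow> y \<in> H \<Longrightarrow> h (x \<oplus>\<^bsub>L\<^esub> y) = h x + h y"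
    "x \<in> H \<Longrightarrow> y \<in> H \<Longrightarrow> h (x \<otimes>\<^bsub>L\<^esub> y) = h x \<otimes>\<^bsub>witt\<^esub> h y"
    "x \<in> H \<Longrightarrow> h (c \<odot>\<^bsub>L\<^esub> x) = scale c (h x)"
    "h ` H = UNIV"
  using assms unfolding witt_epi_def by simp_all

lemma witt_hom_zero:
  fixes L :: "('k::field, 'u) module" and h :: "'u \<Rightarrow> int \<Rightarrow>\<^sub>0 'k"
  assumes N: "lin_subspace N L" and h: "\<And>x y. x \<in> N \<Longrightarrow> y \<in> N \<Longrightarrow> h (x \<oplus>\<^bsub>L\<^esub> y) = h x + h y"
  shows "h \<zero>\<^bsub>L\<^esub> = 0"
proof -
  interpret L: vectorspace class_ring L by (rule lin_subspaceD(1)[OF N])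
  have "h \<zero>\<^bsub>L\<^esub> + h \<zero>\<^bsub>L\<^esub> = h \<zero>\<^bsub>L\<^esub>"
    using h[OF lin_subspaceD(3,3)[OF N]] by simp
  then show ?thesis by (simp only: add_cancel_left_right)
qed

text \<open>The projection L -> L/I followed by an identification of L/I with \<open>Q\<close>,
  packed into one map whose fibres are the cosets of \<open>I\<close>. Later arguments then avoid
  the coset type altogether.\<close>

definition lie_epi :: "('k::field, 'v) module \<Rightarrow> 'v set \<Rightarrow> ('k, 'w) module \<Rightarrow> ('v \<Rightarrow> 'w) \<Rightarrow> bool" where
  "lie_epi L I Q \<pi> \<longleftrightarrow> \<pi> ` carrier L = carrier Q \<and>
     (\<forall>x\<in>carrier L. \<forall>y\<in>carrier L. \<pi> (x \<oplus>\<^bsub>L\<^esub> y) = \<pi> x \<oplus>\<^bsub>Q\<^esub> \<pi> y \<and> \<pi> (x \<otimes>\<^bsub>L\<^esub> y) = \<pi> x \<otimes>\<^bsub>Q\<^esub> \<pi> y \<and>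
        (\<pi> x = \<pi> y \<longleftrightarrow> x \<ominus>\<^bsub>L\<^esub> y \<in> I)) \<and>
     (\<forall>c. \<forall>x\<in>carrier L. \<pi> (c \<odot>\<^bsub>L\<^esub> x) = c \<odot>\<^bsub>Q\<^esub> \<pi> x)"

lemma lie_epiD:
  fixes L :: "('k::field, 'v) module"
  assumes "lie_epi L I Q \<pi>"
  shows "\<pi> ` carrier L = carrier Q"
    "x \<in> carrier L \<Longrightarrow> y \<in> carrier L \<Longrightarrow> \<pi> (x \<oplus>\<^bsub>L\<^esub> y) = \<pi> x \<oplus>\<^bsub>Q\<^esub> \<pi> y"
    "x \<in> carrier L \<Longrightarrow> y \<in> carrier L \<Longrightarrow> \<pi> (x \<otimes>\<^bsub>L\<^esub> y) = \<pi> x \<otimes>\<^bsub>Q\<^esub> \<pi> y"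
    "x \<in> carrier L \<Longrightarrow> \<pi> (c \<odot>\<^bsub>L\<^esub> x) = c \<odot>\<^bsub>Q\<^esub> \<pi> x"
    "x \<in> carrier L \<Longrightarrow> y \<in> carrier L \<Longrightarrow> \<pi> x = \<pi> y \<longleftrightarrow> x \<ominus>\<^bsub>L\<^esub> y \<in> I"
  using assms unfolding lie_epi_def by simp_all

lemma lie_subalgebraD:
  assumes "lie_subalgebra H L"
  shows "lin_subspace H L" "x \<in> H \<Longrightarrow> y \<in> H \<Longrightarrow> x \<otimes>\<^bsub>L\<^esub> y \<in> H"
  using assms by (auto simp: lie_subalgebra_def)

lemma lie_subalgebraI:
  assumes "lin_subspace H L" "\<And>x y. x \<in> H \<Longrightarrow> y \<in> H \<Longrightarrow> x \<otimes>\<^bsub>L\<^esub> y \<in> H"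
  shows "lie_subalgebra H L"
  using assms by (auto simp: lie_subalgebra_def)

lemma lin_subspace_of_restrict:
  fixes L :: "('k::field, 'u) module"
  assumes "lin_subspace H L" "lin_subspace K (L\<lparr>carrier := H\<rparr>)"
  shows "lin_subspace K L"
  using lin_subspaceD(1,2)[OF assms(1)] lin_subspaceD(2-5)[OF assms(2)]
  by (intro lin_subspaceI) auto

lemma lie_subalgebra_of_restrict:
  fixes L :: "('k::field, 'u) module"
  assumes "lie_subalgebra H L" "lie_subalgebra K (L\<lparr>carrier := H\<rparr>)"
  shows "lie_subalgebra K L"
  using lie_subalgebraD[OF assms(2)]
  by (intro lie_subalgebraI lin_subspace_of_restrict[OF lie_subalgebraD(1)[OF assms(1)]]) auto

lemma lie_subalgebra_inter_restrict:
  fixes L :: "('k::field, 'u) module"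
  assumes "lie_subalgebra H L" "lie_subalgebra K L"
  shows "lie_subalgebra (H \<inter> K) (L\<lparr>carrier := K\<rparr>)"
proof (rule lie_subalgebraI)
  note H = lin_subspaceD[OF lie_subalgebraD(1)[OF assms(1)]]
    and K = lin_subspaceD[OF lie_subalgebraD(1)[OF assms(2)]]
  have "lin_subspace (H \<inter> K) L"
    by (rule lin_subspaceI[OF H(1)]) (use H(2-5) K(2-5) in auto)
  then show "lin_subspace (H \<inter> K) (L\<lparr>carrier := K\<rparr>)"
    by (rule lin_subspace_restrict[OF lie_subalgebraD(1)[OF assms(2)]]) auto
qed (use lie_subalgebraD(2)[OF assms(1)] lie_subalgebraD(2)[OF assms(2)] in auto)

lemma lie_ideal_subalgebra: "lie_ideal I L \<Longrightarrow> lie_subalgebra I L"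
  using lin_subspaceD(2)[of I L] by (auto simp: lie_ideal_def lie_subalgebra_def)

lemma lie_algebra_restrict:
  fixes L :: "('k::field, 'u) module"
  assumes L: "lie_algebra L" and H: "lie_subalgebra H L"
  shows "lie_algebra (L\<lparr>carrier := H\<rparr>)"
proof -
  interpret L: lie_algebra L by (rule L)
  note sub = lie_subalgebraD(1)[OF H]
  have c: "x \<in> carrier L" if "x \<in> H" for x using lin_subspaceD(2)[OF sub] that by blast
  show ?thesis
    by (rule lie_algebra.intro[OF L.subspace_is_vs[OF sub]], rule lie_algebra_axioms.intro)
      (simp_all add: lie_subalgebraD(2)[OF H] L.bracket_add_left L.bracket_add_right
        L.bracket_smult_left L.bracket_smult_right L.bracket_alternating L.jacobi c)
qed

lemma (in lie_algebra) bracket_antisym: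
  assumes "x \<in> carrier L" "y \<in> carrier L"
  shows "y \<otimes>\<^bsub>L\<^esub> x = \<ominus>\<^bsub>L\<^esub> (x \<otimes>\<^bsub>L\<^esub> y)"
proof -
  have "\<zero>\<^bsub>L\<^esub> = (x \<oplus>\<^bsub>L\<^esub> y) \<otimes>\<^bsub>L\<^esub> (x \<oplus>\<^bsub>L\<^esub> y)" using assms by (simp add: bracket_alternating)
  also have "\<dots> = x \<otimes>\<^bsub>L\<^esub> (x \<oplus>\<^bsub>L\<^esub> y) \<oplus>\<^bsub>L\<^esub> y \<otimes>\<^bsub>L\<^esub> (x \<oplus>\<^bsub>L\<^esub> y)"
    using assms by (intro bracket_add_left M.a_closed)
  also have "\<dots> = y \<otimes>\<^bsub>L\<^esub> x \<oplus>\<^bsub>L\<^esub> x \<otimes>\<^bsub>L\<^esub> y"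
    using assms by (simp add: bracket_add_right bracket_alternating bracket_closed M.a_comm)
  finally show ?thesis
    using assms M.minus_equality[of "y \<otimes>\<^bsub>L\<^esub> x" "x \<otimes>\<^bsub>L\<^esub> y"] by (simp add: bracket_closed)
qed

context
  fixes L :: "('k::field, 'u) module" and I :: "'u set"
  assumes L: "lie_algebra L" and I: "lie_ideal I L"
begin

interpretation L: lie_algebra L by (rule L)

lemma lie_ideal_subspace: "lin_subspace I L"
  using I by (simp add: lie_ideal_def)

lemma quotient_alg_bracket:
  assumes "x \<in> carrier L" "y \<in> carrier L"
  shows "I +>\<^bsub>L\<^esub> (x \<otimes>\<^bsub>L\<^esub> y) = (I +>\<^bsub>L\<^esub> x) \<otimes>\<^bsub>quotient_alg L I\<^esub> (I +>\<^bsub>L\<^esub> y)"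
proof (rule quotient_alg_mult[OF lie_ideal_subspace assms])
  show left: "u \<otimes>\<^bsub>L\<^esub> v \<in> I" if "u \<in> carrier L" "v \<in> I" for u v
    using I that by (simp add: lie_ideal_def)
  \<comment> \<open>\<open>lie_ideal\<close> provides absorption on one side only; the other side
    follows by antisymmetry and closure under negatives.\<close>
  show "v \<otimes>\<^bsub>L\<^esub> u \<in> I" if "u \<in> carrier L" "v \<in> I" for u v
    using lin_subspaceD(6)[OF lie_ideal_subspace left[OF that]] L.bracket_antisym[OF that(1), of v]
      lin_subspaceD(2)[OF lie_ideal_subspace] that by auto
qed (simp_all add: L.bracket_closed L.bracket_add_left L.bracket_add_right)

lemma quotient_hom:
  fixes Q :: "('k, 'w) module"
  assumes iso: "lie_isomorphic (quotient_alg L I) Q"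
  obtains \<pi> where "lie_epi L I Q \<pi>"
proof -
  let ?Q = "quotient_alg L I"
  obtain g where g: "g \<in> LinearCombinations.module_hom class_ring ?Q Q"
    and gm: "\<And>x y. x \<in> carrier ?Q \<Longrightarrow> y \<in> carrier ?Q \<Longrightarrow> g (x \<otimes>\<^bsub>?Q\<^esub> y) = g x \<otimes>\<^bsub>Q\<^esub> g y"
    and bij: "bij_betw g (carrier ?Q) (carrier Q)"
    using iso unfolding lie_isomorphic_def by blast
  have c: "I +>\<^bsub>L\<^esub> x \<in> carrier ?Q" if "x \<in> carrier L" for x
    unfolding quotient_alg_surj[OF lie_ideal_subspace, symmetric] using that by (rule imageI)
  show thesis
  proof (rule that[of "\<lambda>x. g (I +>\<^bsub>L\<^esub> x)"], unfold lie_epi_def, intro conjI allI ballI)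
    have "(\<lambda>x. g (I +>\<^bsub>L\<^esub> x)) ` carrier L = g ` (+>\<^bsub>L\<^esub>) I ` carrier L" by (simp only: image_image)
    then show "(\<lambda>x. g (I +>\<^bsub>L\<^esub> x)) ` carrier L = carrier Q"
      unfolding quotient_alg_surj[OF lie_ideal_subspace] bij_betw_imp_surj_on[OF bij] .
    fix x y c' assume x: "x \<in> carrier L"
    show "g (I +>\<^bsub>L\<^esub> (c' \<odot>\<^bsub>L\<^esub> x)) = c' \<odot>\<^bsub>Q\<^esub> g (I +>\<^bsub>L\<^esub> x)"
      unfolding quotient_alg_smult[OF lie_ideal_subspace x]
      using LinearCombinations.module_hom_smult[OF g _ c[OF x], of c'] by simp
    assume y: "y \<in> carrier L"
    show "g (I +>\<^bsub>L\<^esub> (x \<oplus>\<^bsub>L\<^esub> y)) = g (I +>\<^bsub>L\<^esub> x) \<oplus>\<^bsub>Q\<^esub> g (I +>\<^bsub>L\<^esub> y)"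
      unfolding quotient_alg_add[OF lie_ideal_subspace x y] by (rule LinearCombinations.module_hom_add[OF g c[OF x] c[OF y]])
    show "g (I +>\<^bsub>L\<^esub> (x \<otimes>\<^bsub>L\<^esub> y)) = g (I +>\<^bsub>L\<^esub> x) \<otimes>\<^bsub>Q\<^esub> g (I +>\<^bsub>L\<^esub> y)"
      unfolding quotient_alg_bracket[OF x y] by (rule gm[OF c[OF x] c[OF y]])
    show "g (I +>\<^bsub>L\<^esub> x) = g (I +>\<^bsub>L\<^esub> y) \<longleftrightarrow> x \<ominus>\<^bsub>L\<^esub> y \<in> I"
      unfolding quotient_alg_eq_iff[OF lie_ideal_subspace x y, symmetric]
      by (rule inj_on_eq_iff[OF bij_betw_imp_inj_on[OF bij] c[OF x] c[OF y]])
  qed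
qed

text \<open>The preimage of \<open>H\<close> under the projection is a subalgebra that still maps
  onto \<open>H\<close>, so the composite with \<open>h\<close> is onto the Witt algebra.\<close>

lemma witt_section_quotient:
  fixes Q :: "('k, 'w) module"
  assumes iso: "lie_isomorphic (quotient_alg L I) Q" and "witt_section Q"
  shows "witt_section L"
proof -
  obtain \<pi> where \<pi>: "lie_epi L I Q \<pi>" using quotient_hom[OF iso] by blast
  note surj = lie_epiD(1)[OF \<pi>] and add = lie_epiD(2)[OF \<pi>] and mult = lie_epiD(3)[OF \<pi>] and smult = lie_epiD(4)[OF \<pi>]
  obtain H h where Hh: "witt_epi Q H h" using assms(2) unfolding witt_section_def by blast
  note H = witt_epiD(1)[OF Hh] and h = witt_epiD(2-5)[OF Hh]
  note Hs = lin_subspaceD[OF lie_subalgebraD(1)[OF H]]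
  define H' where "H' = {x \<in> carrier L. \<pi> x \<in> H}"
  have im: "\<pi> ` H' = H"
  proof
    show "\<pi> ` H' \<subseteq> H" by (auto simp: H'_def)
    show "H \<subseteq> \<pi> ` H'"
    proof
      fix y assume y: "y \<in> H"
      then have "y \<in> \<pi> ` carrier L" unfolding surj using Hs(2) by (rule rev_subsetD)
      then obtain x where "x \<in> carrier L" "y = \<pi> x" by blast
      then show "y \<in> \<pi> ` H'" using y by (auto simp: H'_def)
    qed
  qed
  interpret Q: vectorspace class_ring Q by (rule Hs(1))
  have z: "\<pi> \<zero>\<^bsub>L\<^esub> = \<zero>\<^bsub>Q\<^esub>"
  proof -
    have "\<pi> \<zero>\<^bsub>L\<^esub> \<in> carrier Q" unfolding surj[symmetric] by (intro imageI L.M.zero_closed)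
    then show ?thesis
      using smult[OF L.M.zero_closed, of 0] L.smult_l_null[OF L.M.zero_closed] Q.smult_l_null[of "\<pi> \<zero>\<^bsub>L\<^esub>"]
      by simp
  qed
  show ?thesis
  proof (rule witt_sectionI[of H' L "\<lambda>x. h (\<pi> x)"])
    show "lie_subalgebra H' L"
    proof (intro lie_subalgebraI lin_subspaceI L.vectorspace_axioms)
      show "H' \<subseteq> carrier L" by (simp add: H'_def)
      show "\<zero>\<^bsub>L\<^esub> \<in> H'" by (simp add: H'_def z Hs(3))
      show "x \<oplus>\<^bsub>L\<^esub> y \<in> H'" if "x \<in> H'" "y \<in> H'" for x y
        using that Hs(4) by (simp add: H'_def add)
      show "c \<odot>\<^bsub>L\<^esub> x \<in> H'" if "x \<in> H'" for c x
        using that Hs(5) by (simp add: H'_def smult)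
      show "x \<otimes>\<^bsub>L\<^esub> y \<in> H'" if "x \<in> H'" "y \<in> H'" for x y
        using that lie_subalgebraD(2)[OF H] by (simp add: H'_def mult L.bracket_closed)
    qed
    show "(\<lambda>x. h (\<pi> x)) ` H' = UNIV" using im h(4) by (simp only: image_image[symmetric])
  qed (simp_all add: H'_def add mult smult h)
qed

end

lemma witt_image_subspace:
  fixes L :: "('k::field, 'u) module" and h :: "'u \<Rightarrow> int \<Rightarrow>\<^sub>0 'k"
  assumes N: "lin_subspace N L"
    and h: "\<And>x y. x \<in> N \<Longrightarrow> y \<in> N \<Longrightarrow> h (x \<oplus>\<^bsub>L\<^esub> y) = h x + h y"
    "\<And>c x. x \<in> N \<Longrightarrow> h (c \<odot>\<^bsub>L\<^esub> x) = scale c (h x)"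
  shows "lin_subspace (h ` N) witt"
proof (rule lin_subspaceI[OF vectorspace_witt])
  note Ns = lin_subspaceD[OF N]
  interpret L: vectorspace class_ring L by (rule Ns(1))
  show "h ` N \<subseteq> carrier witt" by (simp add: witt_simps)
  have "h \<zero>\<^bsub>L\<^esub> = 0" by (rule witt_hom_zero[OF N h(1)])
  then show "\<zero>\<^bsub>witt\<^esub> \<in> h ` N" using Ns(3) by (force simp: witt_simps)
  fix x y c assume x: "x \<in> h ` N"
  then obtain a where a: "a \<in> N" "x = h a" by blast
  show "c \<odot>\<^bsub>witt\<^esub> x \<in> h ` N"
    using imageI[OF Ns(5)[OF a(1), of c], of h] by (simp add: witt_simps h(2)[OF a(1)] a)
  assume "y \<in> h ` N"
  then obtain b where b: "b \<in> N" "y = h b" by blast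
  show "x \<oplus>\<^bsub>witt\<^esub> y \<in> h ` N"
    using imageI[OF Ns(4)[OF a(1) b(1)], of h] by (simp add: witt_simps h(1)[OF a(1) b(1)] a b)
qed

text \<open>By simplicity of the Witt algebra, a surjection onto it from a subalgebra of an extension
  restricts to a surjection from the ideal or factors through the quotient.\<close>
lemma witt_section_extension:
  fixes L :: "('k::field_char_0, 'u) module" and Q :: "('k, 'w) module"
  assumes L: "lie_algebra L" and I: "lie_ideal I L" and iso: "lie_isomorphic (quotient_alg L I) Q"
    and Q: "lie_algebra Q" and "witt_section L"
  shows "witt_section (L\<lparr>carrier := I\<rparr>) \<or> witt_section Q"
proof -
  interpret L: lie_algebra L by (rule L)
  interpret Q: lie_algebra Q by (rule Q)
  obtain \<pi> where \<pi>: "lie_epi L I Q \<pi>" using quotient_hom[OF L I iso] by blast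
  note surj = lie_epiD(1)[OF \<pi>] and add = lie_epiD(2)[OF \<pi>] and mult = lie_epiD(3)[OF \<pi>]
    and smult = lie_epiD(4)[OF \<pi>] and eq = lie_epiD(5)[OF \<pi>]
  obtain H h where Hh: "witt_epi L H h" using assms(5) unfolding witt_section_def by blast
  note H = witt_epiD(1)[OF Hh] and h = witt_epiD(2-5)[OF Hh]
  note Hs = lin_subspaceD[OF lie_subalgebraD(1)[OF H]]
  have Hc: "x \<in> carrier L" if "x \<in> H" for x using Hs(2) that by (rule subsetD)
  have Isub: "lie_subalgebra I L" by (rule lie_ideal_subalgebra[OF I])
  have HI: "lie_subalgebra (H \<inter> I) (L\<lparr>carrier := I\<rparr>)" by (rule lie_subalgebra_inter_restrict[OF H Isub])
  have HIs: "lin_subspace (H \<inter> I) L"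
    by (rule lie_subalgebraD(1)[OF lie_subalgebra_of_restrict[OF Isub HI]])
  have Js: "lin_subspace (h ` (H \<inter> I)) witt"
    by (rule witt_image_subspace[OF HIs]) (simp_all add: h)
  \<comment> \<open>As \<open>h\<close> is onto, each x is the image of some a in \<open>H\<close>,
    and brackets of a with \<open>H \<inter> I\<close> stay in \<open>H \<inter> I\<close>. So the
    image is an ideal of the Witt algebra, and simplicity leaves two cases.\<close>
  have Ji: "x \<otimes>\<^bsub>witt\<^esub> y \<in> h ` (H \<inter> I)" if y: "y \<in> h ` (H \<inter> I)" for x y
  proof -
    obtain b where b: "b \<in> H" "b \<in> I" "y = h b" using y by blast
    obtain a where a: "a \<in> H" "x = h a" using h(4) by (metis UNIV_I imageE)
    have "a \<otimes>\<^bsub>L\<^esub> b \<in> H \<inter> I"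
      using lie_subalgebraD(2)[OF H a(1) b(1)] I b(2) Hc[OF a(1)] by (simp add: lie_ideal_def)
    then show ?thesis using h(2)[OF a(1) b(1)] a b by force
  qed
  show ?thesis
  proof (cases "\<exists>x \<in> h ` (H \<inter> I). x \<noteq> 0")
    case True
    then have "h ` (H \<inter> I) = UNIV" using witt_simple[OF Js Ji] by blast
    then have "witt_section (L\<lparr>carrier := I\<rparr>)"
      by (intro witt_sectionI[OF HI]) (simp_all add: h)
    then show ?thesis ..
  next
    case False
    then have zero: "h x = 0" if "x \<in> H" "x \<in> I" for x using that by blast
    \<comment> \<open>Elements of \<open>H\<close> with equal image in \<open>Q\<close> differ by an
      element of \<open>H \<inter> I\<close>, where \<open>h\<close> now vanishes. Hence
      \<open>h\<close> factors through \<open>\<pi>\<close>, and the choice of preimage in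
      \<open>h'\<close> does not matter.\<close>
    have wd: "h x = h y" if x: "x \<in> H" and y: "y \<in> H" and e: "\<pi> x = \<pi> y" for x y
    proof -
      have "x \<ominus>\<^bsub>L\<^esub> y \<in> I" using eq[OF Hc[OF x] Hc[OF y]] e by simp
      then have "h (x \<ominus>\<^bsub>L\<^esub> y) = 0" by (rule zero[OF Hs(7)[OF x y]])
      moreover have "h ((x \<ominus>\<^bsub>L\<^esub> y) \<oplus>\<^bsub>L\<^esub> y) = h (x \<ominus>\<^bsub>L\<^esub> y) + h y" by (rule h(1)[OF Hs(7)[OF x y] y])
      moreover have "(x \<ominus>\<^bsub>L\<^esub> y) \<oplus>\<^bsub>L\<^esub> y = x"
        using Hc[OF x] Hc[OF y] by (simp add: a_minus_def L.M.a_assoc L.M.l_neg)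
      ultimately show ?thesis by simp
    qed
    define h' where "h' y = h (SOME x. x \<in> H \<and> \<pi> x = y)" for y
    have h': "h' (\<pi> x) = h x" if x: "x \<in> H" for x
      using someI[of "\<lambda>z. z \<in> H \<and> \<pi> z = \<pi> x" x] x wd unfolding h'_def by blast
    have z: "\<pi> \<zero>\<^bsub>L\<^esub> = \<zero>\<^bsub>Q\<^esub>"
    proof -
      have "\<pi> \<zero>\<^bsub>L\<^esub> \<in> carrier Q" unfolding surj[symmetric] by (intro imageI L.M.zero_closed)
      then show ?thesis
        using smult[OF L.M.zero_closed, of 0] L.smult_l_null[OF L.M.zero_closed] Q.smult_l_null[of "\<pi> \<zero>\<^bsub>L\<^esub>"]
        by simp
    qed
    have "witt_section Q"
    proof (rule witt_sectionI[of "\<pi> ` H" Q h'])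
      show "lie_subalgebra (\<pi> ` H) Q"
      proof (intro lie_subalgebraI lin_subspaceI Q.vectorspace_axioms)
        show "\<pi> ` H \<subseteq> carrier Q" unfolding surj[symmetric] using Hs(2) by (rule image_mono)
        show "\<zero>\<^bsub>Q\<^esub> \<in> \<pi> ` H" unfolding z[symmetric] using Hs(3) by (rule imageI)
        fix x y c assume "x \<in> \<pi> ` H"
        then obtain a where a: "a \<in> H" "x = \<pi> a" by (rule imageE) simp
        show "c \<odot>\<^bsub>Q\<^esub> x \<in> \<pi> ` H"
          unfolding a(2) smult[OF Hc[OF a(1)], symmetric] by (intro imageI Hs(5) a(1))
        assume "y \<in> \<pi> ` H"
        then obtain b where b: "b \<in> H" "y = \<pi> b" by (rule imageE) simp
        show "x \<oplus>\<^bsub>Q\<^esub> y \<in> \<pi> ` H"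
          unfolding a(2) b(2) add[OF Hc[OF a(1)] Hc[OF b(1)], symmetric] by (intro imageI Hs(4) a(1) b(1))
        show "x \<otimes>\<^bsub>Q\<^esub> y \<in> \<pi> ` H"
          unfolding a(2) b(2) mult[OF Hc[OF a(1)] Hc[OF b(1)], symmetric]
          by (intro imageI lie_subalgebraD(2)[OF H] a(1) b(1))
      qed
      have "h' ` \<pi> ` H = h ` H" unfolding image_image by (rule image_cong[OF refl h'])
      then show "h' ` \<pi> ` H = UNIV" using h(4) by simp
      fix x y c assume "x \<in> \<pi> ` H"
      then obtain a where a: "a \<in> H" "x = \<pi> a" by (rule imageE) simp
      show "h' (c \<odot>\<^bsub>Q\<^esub> x) = scale c (h' x)"
        unfolding a(2) smult[OF Hc[OF a(1)], symmetric] h'[OF a(1)] h'[OF Hs(5)[OF a(1)]] by (rule h(3)[OF a(1)])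
      assume "y \<in> \<pi> ` H"
      then obtain b where b: "b \<in> H" "y = \<pi> b" by (rule imageE) simp
      show "h' (x \<oplus>\<^bsub>Q\<^esub> y) = h' x + h' y"
        unfolding a(2) b(2) add[OF Hc[OF a(1)] Hc[OF b(1)], symmetric] h'[OF a(1)] h'[OF b(1)]
          h'[OF Hs(4)[OF a(1) b(1)]] by (rule h(1)[OF a(1) b(1)])
      show "h' (x \<otimes>\<^bsub>Q\<^esub> y) = h' x \<otimes>\<^bsub>witt\<^esub> h' y"
        unfolding a(2) b(2) mult[OF Hc[OF a(1)] Hc[OF b(1)], symmetric] h'[OF a(1)] h'[OF b(1)]
          h'[OF lie_subalgebraD(2)[OF H a(1) b(1)]] by (rule h(2)[OF a(1) b(1)])
    qed
    then show ?thesis ..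
  qed
qed

lemma directed_finite_subset:
  assumes "finite F" "F \<subseteq> \<Union>D" "D \<noteq> {}" "\<And>H K. H \<in> D \<Longrightarrow> K \<in> D \<Longrightarrow> \<exists>M\<in>D. H \<subseteq> M \<and> K \<subseteq> M"
  shows "\<exists>M\<in>D. F \<subseteq> M"
  using assms(1,2)
proof (induction F)
  case empty
  then show ?case using assms(3) by blast
next
  case (insert x F)
  then obtain M where M: "M \<in> D" "F \<subseteq> M" by auto
  obtain K where K: "K \<in> D" "x \<in> K" using insert by auto
  obtain N where "N \<in> D" "M \<subseteq> N" "K \<subseteq> N" using assms(4)[OF M(1) K(1)] by blast
  then show ?case using M K by (intro bexI[of _ N]) auto
qed

text \<open>Lift e_-2, ..., e_2 to \<open>H\<close>. These five elements lie in one member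
  \<open>M\<close> of the directed family, and the image of \<open>H \<inter> M\<close> is a
  subalgebra containing generators of the Witt algebra.\<close>

lemma witt_section_directed_union:
  fixes L :: "('k::field_char_0, 'u) module"
  assumes "D \<noteq> {}" and sub: "\<And>H. H \<in> D \<Longrightarrow> lie_subalgebra H L"
    and dir: "\<And>H K. H \<in> D \<Longrightarrow> K \<in> D \<Longrightarrow> \<exists>M\<in>D. H \<subseteq> M \<and> K \<subseteq> M"
    and un: "\<Union>D = carrier L" and "witt_section L"
  shows "\<exists>M\<in>D. witt_section (L\<lparr>carrier := M\<rparr>)"
proof -
  obtain H h where Hh: "witt_epi L H h" using assms(5) unfolding witt_section_def by blast
  note H = witt_epiD(1)[OF Hh] and h = witt_epiD(2-5)[OF Hh]
  have "\<forall>i. \<exists>x. x \<in> H \<and> h x = single i 1" using h(4) by (metis UNIV_I imageE)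
  then obtain g where g: "\<And>i. g i \<in> H" "\<And>i. h (g i) = single i 1" by metis
  have "g ` {-2..2::int} \<subseteq> \<Union>D" using g(1) un lin_subspaceD(2)[OF lie_subalgebraD(1)[OF H]] by auto
  then obtain M where M: "M \<in> D" "g ` {-2..2::int} \<subseteq> M"
    using directed_finite_subset[OF _ _ assms(1) dir, of "g ` {-2..2}"] by auto
  have HM: "lie_subalgebra (H \<inter> M) (L\<lparr>carrier := M\<rparr>)"
    by (rule lie_subalgebra_inter_restrict[OF H sub[OF M(1)]])
  have HML: "lie_subalgebra (H \<inter> M) L" by (rule lie_subalgebra_of_restrict[OF sub[OF M(1)] HM])
  have "h ` (H \<inter> M) = UNIV"
  proof (rule witt_generated)
    show "lie_subalgebra (h ` (H \<inter> M)) witt"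
    proof (rule lie_subalgebraI)
      show "lin_subspace (h ` (H \<inter> M)) witt"
        by (rule witt_image_subspace[OF lie_subalgebraD(1)[OF HML]]) (simp_all add: h)
      fix x y assume "x \<in> h ` (H \<inter> M)" "y \<in> h ` (H \<inter> M)"
      then obtain a b where ab: "a \<in> H \<inter> M" "b \<in> H \<inter> M" "x = h a" "y = h b" by blast
      have "a \<in> H" "b \<in> H" using ab by auto
      then show "x \<otimes>\<^bsub>witt\<^esub> y \<in> h ` (H \<inter> M)"
        using imageI[OF lie_subalgebraD(2)[OF HML ab(1,2)], of h] by (simp add: h ab)
    qed
    fix i :: int assume "\<bar>i\<bar> \<le> 2"
    then have "i \<in> {-2..2}" by (simp add: abs_le_iff)
    then have "g i \<in> H \<inter> M" using g(1) M(2) by blast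
    then show "single i 1 \<in> h ` (H \<inter> M)" using g(2)[of i] by force
  qed
  then have "witt_section (L\<lparr>carrier := M\<rparr>)" by (intro witt_sectionI[OF HM]) (simp_all add: h)
  then show ?thesis using M(1) by blast
qed

text \<open>A finite spanning set of \<open>H\<close> has images supported in a finite set
  \<open>S\<close> of indices, and being supported in \<open>S\<close> is inherited by the span. So
  only finitely many e_i could be hit.\<close>

lemma not_witt_section_finite_dim:
  fixes L :: "('k::field, 'u) module"
  assumes L: "finite_dim L"
  shows "\<not> witt_section L"
proof
  assume "witt_section L"
  then obtain H h where Hh: "witt_epi L H h"  unfolding witt_section_def by blast
  note H = witt_epiD(1)[OF Hh] and h = witt_epiD(2,4,5)[OF Hh]
  note sub = lie_subalgebraD(1)[OF H]
  note Hs = lin_subspaceD[OF sub]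
  interpret V: vectorspace class_ring L by (rule Hs(1))
  interpret W: vectorspace class_ring "L\<lparr>carrier := H\<rparr>" by (rule V.subspace_is_vs[OF sub])
  obtain A where A: "finite A" "A \<subseteq> H" "lin_span (L\<lparr>carrier := H\<rparr>) A = H"
    using finite_dim_subspace[OF L sub] unfolding W.fin_dim_def by auto
  have span: "lin_span L A = H" using lin_span_restrict[OF sub A(2)] A(3) by simp
  define S where "S = (\<Union>a\<in>A. keys (h a))"
  define K where "K = {x \<in> H. keys (h x) \<subseteq> S}"
  have h0: "h \<zero>\<^bsub>L\<^esub> = 0" by (rule witt_hom_zero[OF lie_subalgebraD(1)[OF H] h(1)])
  have "lin_subspace K L"
  proof (rule lin_subspaceI[OF Hs(1)])
    show "K \<subseteq> carrier L" using Hs(2) by (auto simp: K_def)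
    show "\<zero>\<^bsub>L\<^esub> \<in> K" by (simp add: K_def Hs(3) h0)
    show "x \<oplus>\<^bsub>L\<^esub> y \<in> K" if "x \<in> K" "y \<in> K" for x y
      using that Poly_Mapping.keys_add[of "h x" "h y"] by (auto simp: K_def Hs(4) h(1))
    show "c \<odot>\<^bsub>L\<^esub> x \<in> K" if "x \<in> K" for c x
      using that keys_map_mult[of c "h x"] by (auto simp: K_def Hs(5) h(2))
  qed
  moreover have "A \<subseteq> K" using A(2) by (auto simp: K_def S_def)
  ultimately have HK: "H \<subseteq> K" using lin_span_minimal[of K L A] span by simp
  have "i \<in> S" for i
  proof -
    obtain x where x: "x \<in> H" "h x = single i 1" using h(3) by (metis UNIV_I imageE)
    then have "keys (h x) \<subseteq> S" using HK by (auto simp: K_def)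
    then show ?thesis by (simp add: x(2))
  qed
  then have "S = UNIV" by blast
  moreover have "finite S" using A(1) by (simp add: S_def)
  ultimately show False using infinite_UNIV_int by simp
qed

text \<open>The bracket [e_0, e_1] = e_1 would be the image of a vanishing bracket.\<close>

lemma not_witt_section_abelian:
  fixes L :: "('k::field, 'u) module"
  assumes L: "\<forall>x\<in>carrier L. \<forall>y\<in>carrier L. x \<otimes>\<^bsub>L\<^esub> y = \<zero>\<^bsub>L\<^esub>"
  shows "\<not> witt_section L"
proof
  assume "witt_section L"
  then obtain H h where Hh: "witt_epi L H h"  unfolding witt_section_def by blast
  note H = witt_epiD(1)[OF Hh] and h = witt_epiD(2,3,5)[OF Hh]
  note Hs = lin_subspaceD[OF lie_subalgebraD(1)[OF H]]
  interpret V: vectorspace class_ring L by (rule Hs(1))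
  have h0: "h \<zero>\<^bsub>L\<^esub> = 0" by (rule witt_hom_zero[OF lie_subalgebraD(1)[OF H] h(1)])
  obtain x y where xy: "x \<in> H" "h x = single 0 1" "y \<in> H" "h y = single 1 1"
    using h(3) by (metis UNIV_I imageE)
  have "x \<otimes>\<^bsub>L\<^esub> y = \<zero>\<^bsub>L\<^esub>" using L xy Hs(2) by blast
  then have "single 0 1 \<otimes>\<^bsub>witt\<^esub> single 1 1 = (0 :: int \<Rightarrow>\<^sub>0 'k)"
    using h(2)[OF xy(1,3)] h0 xy by simp
  then have "single (0 + 1) (of_int (1 - 0) * 1 * 1) = (0 :: int \<Rightarrow>\<^sub>0 'k)"
    unfolding witt_mult_single .
  from arg_cong[OF this, of "\<lambda>f. lookup f 1"] show False by simp
qed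

text \<open>Being a Lie algebra is part of the induction: the hypotheses supply it for the algebra
  of which a subalgebra or quotient is taken, and for the quotient term of an extension.\<close>

lemma EL_not_witt_section:
  fixes L :: "('k::field_char_0, 'u) module"
  assumes "L \<in> EL"
  shows "lie_algebra L \<and> \<not> witt_section L"
  using assms unfolding EL_def
proof (induction rule: lie_closure.induct)
  case (base L)
  then show ?case using not_witt_section_finite_dim not_witt_section_abelian by blast
next
  case (subalgebra L H)
  have "\<not> witt_section (L\<lparr>carrier := H\<rparr>)"
  proof
    assume "witt_section (L\<lparr>carrier := H\<rparr>)"
    then obtain K h where Hh: "witt_epi (L\<lparr>carrier := H\<rparr>) K h"  unfolding witt_section_def by blast
    note K = witt_epiD(1)[OF Hh] and h = witt_epiD(2-5)[OF Hh]
    have "witt_section L"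
      by (rule witt_sectionI[OF lie_subalgebra_of_restrict[OF subalgebra(2) K], of h]) (use h in simp_all)
    then show False using subalgebra by blast
  qed
  then show ?case using lie_algebra_restrict[of L H] subalgebra by blast
next
  case (quotient L I Q)
  then show ?case using witt_section_quotient[of L I Q] by blast
next
  case (extension L I Q)
  then show ?case using witt_section_extension[of L I Q] by blast
next
  case (directed_union L D)
  then show ?case using witt_section_directed_union[of D L] by blast
qed

lemma witt_section_isomorphic:
  fixes M :: "('k::field_char_0, 'u) module"
  assumes iso: "lie_isomorphic (witt :: ('k, int \<Rightarrow>\<^sub>0 'k) module) M" and M: "lie_algebra M"
  shows "witt_section M"
proof -
  interpret M: lie_algebra M by (rule M)
  obtain \<phi> where \<phi>: "\<phi> \<in> LinearCombinations.module_hom class_ring (witt :: ('k, int \<Rightarrow>\<^sub>0 'k) module) M"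
    and m: "\<And>x y. \<phi> (x \<otimes>\<^bsub>witt\<^esub> y) = \<phi> x \<otimes>\<^bsub>M\<^esub> \<phi> y" and bij: "bij_betw \<phi> UNIV (carrier M)"
    using iso unfolding lie_isomorphic_def by (auto simp: witt_simps(1))
  have add: "\<phi> (x + y) = \<phi> x \<oplus>\<^bsub>M\<^esub> \<phi> y" for x y
    using LinearCombinations.module_hom_add[OF \<phi>, of x y] by (simp add: witt_simps)
  have smult: "\<phi> (scale c x) = c \<odot>\<^bsub>M\<^esub> \<phi> x" for c x
    using LinearCombinations.module_hom_smult[OF \<phi>, of c x] by (simp add: witt_simps)
  define h where "h = the_inv_into UNIV \<phi>"
  have h: "h (\<phi> x) = x" for x
    unfolding h_def by (rule the_inv_into_f_f[OF bij_betw_imp_inj_on[OF bij] UNIV_I])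
  have surj: "\<exists>a. x = \<phi> a" if "x \<in> carrier M" for x
    using that bij_betw_imp_surj_on[OF bij] by blast
  show ?thesis
  proof (rule witt_sectionI[of "carrier M" M h])
    show "lie_subalgebra (carrier M) M"
      by (rule lie_subalgebraI[OF lin_subspace_carrier[OF M.vectorspace_axioms] M.bracket_closed])
    have "h ` \<phi> ` UNIV = UNIV" unfolding image_image h by simp
    then show "h ` carrier M = UNIV" using bij_betw_imp_surj_on[OF bij] by simp
    fix x y c assume "x \<in> carrier M"
    then obtain a where a: "x = \<phi> a" using surj by blast
    show "h (c \<odot>\<^bsub>M\<^esub> x) = scale c (h x)" unfolding a smult[symmetric] h ..
    assume "y \<in> carrier M"
    then obtain b where b: "y = \<phi> b" using surj by blast
    show "h (x \<oplus>\<^bsub>M\<^esub> y) = h x + h y" unfolding a b add[symmetric] h ..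
    show "h (x \<otimes>\<^bsub>M\<^esub> y) = h x \<otimes>\<^bsub>witt\<^esub> h y" unfolding a b m[symmetric] h ..
  qed
qed

lemma not_elementarily_amenable_witt:
  "\<not> elementarily_amenable TYPE('u) (witt :: ('k::field_char_0, int \<Rightarrow>\<^sub>0 'k) module)"
  unfolding elementarily_amenable_def using EL_not_witt_section witt_section_isomorphic by blast

section \<open>Growth\<close>

lemma set_add_memI: "x \<in> X \<Longrightarrow> y \<in> Y \<Longrightarrow> x \<oplus>\<^bsub>V\<^esub> y \<in> X <+>\<^bsub>V\<^esub> Y"
  by (auto simp: set_add_def')

lemma set_add_subset:
  fixes V :: "('k::field, 'v) module"
  assumes "lin_subspace Z V" "X \<subseteq> Z" "Y \<subseteq> Z"
  shows "X <+>\<^bsub>V\<^esub> Y \<subseteq> Z"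
proof
  fix z assume "z \<in> X <+>\<^bsub>V\<^esub> Y"
  then obtain x y where "x \<in> X" "y \<in> Y" "z = x \<oplus>\<^bsub>V\<^esub> y" by (auto simp: set_add_def')
  then show "z \<in> Z" using lin_subspaceD(4)[OF assms(1)] assms(2,3) by blast
qed

lemma lin_subspace_set_add:
  fixes V :: "('k::field, 'v) module"
  assumes X: "lin_subspace X V" and Y: "lin_subspace Y V"
  shows "lin_subspace (X <+>\<^bsub>V\<^esub> Y) V" "X \<subseteq> X <+>\<^bsub>V\<^esub> Y" "Y \<subseteq> X <+>\<^bsub>V\<^esub> Y"
proof -
  note Xs = lin_subspaceD[OF X] and Ys = lin_subspaceD[OF Y]
  interpret V: vectorspace class_ring V by (rule Xs(1))
  have Xc: "x \<in> carrier V" if "x \<in> X" for x using Xs(2) that by (rule subsetD)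
  have Yc: "y \<in> carrier V" if "y \<in> Y" for y using Ys(2) that by (rule subsetD)
  have el: "\<exists>x\<in>X. \<exists>y\<in>Y. z = x \<oplus>\<^bsub>V\<^esub> y" if "z \<in> X <+>\<^bsub>V\<^esub> Y" for z
    using that by (auto simp: set_add_def')
  show "X \<subseteq> X <+>\<^bsub>V\<^esub> Y"
    using set_add_memI[OF _ Ys(3), of _ X V] V.M.r_zero[OF Xc] by (metis subsetI)
  show "Y \<subseteq> X <+>\<^bsub>V\<^esub> Y"
    using set_add_memI[OF Xs(3), of _ Y V] V.M.l_zero[OF Yc] by (metis subsetI)
  show "lin_subspace (X <+>\<^bsub>V\<^esub> Y) V"
  proof (rule lin_subspaceI[OF Xs(1)])
    show "X <+>\<^bsub>V\<^esub> Y \<subseteq> carrier V"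
      by (rule set_add_subset[OF lin_subspace_carrier[OF Xs(1)] Xs(2) Ys(2)])
    show "\<zero>\<^bsub>V\<^esub> \<in> X <+>\<^bsub>V\<^esub> Y"
      using set_add_memI[OF Xs(3) Ys(3), of V] by simp
    fix z w c assume z: "z \<in> X <+>\<^bsub>V\<^esub> Y"
    obtain x y where xy: "x \<in> X" "y \<in> Y" "z = x \<oplus>\<^bsub>V\<^esub> y" using el[OF z] by blast
    show "c \<odot>\<^bsub>V\<^esub> z \<in> X <+>\<^bsub>V\<^esub> Y"
      using set_add_memI[OF Xs(5)[OF xy(1), of c] Ys(5)[OF xy(2), of c], of V]
        V.smult_r_distr[OF _ Xc[OF xy(1)] Yc[OF xy(2)], of c] xy(3) by simp
    assume w: "w \<in> X <+>\<^bsub>V\<^esub> Y"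
    obtain x' y' where xy': "x' \<in> X" "y' \<in> Y" "w = x' \<oplus>\<^bsub>V\<^esub> y'" using el[OF w] by blast
    have "z \<oplus>\<^bsub>V\<^esub> w = (x \<oplus>\<^bsub>V\<^esub> x') \<oplus>\<^bsub>V\<^esub> (y \<oplus>\<^bsub>V\<^esub> y')"
      using Xc[OF xy(1)] Yc[OF xy(2)] Xc[OF xy'(1)] Yc[OF xy'(2)] by (simp add: xy(3) xy'(3) V.M.a_ac)
    then show "z \<oplus>\<^bsub>V\<^esub> w \<in> X <+>\<^bsub>V\<^esub> Y"
      using set_add_memI[OF Xs(4)[OF xy(1) xy'(1)] Ys(4)[OF xy(2) xy'(2)], of V] by simp
  qed
qed

text \<open>For n >= 1 one has 4n + 1 <= 5n, and the n-th roots of 5 and of n tend to 1.\<close>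

lemma root_linear_limsup:
  assumes "\<And>n. n \<ge> 1 \<Longrightarrow> d n \<le> 4 * n + 1"
  shows "limsup (\<lambda>n. ereal (root n (real (d n)))) \<le> 1"
proof -
  have "(\<lambda>n. root n 5 * root n (real n)) \<longlonglongrightarrow> 1 * 1"
    by (intro tendsto_mult LIMSEQ_root_const LIMSEQ_root) simp
  then have lim: "(\<lambda>n. ereal (root n 5 * root n (real n))) \<longlonglongrightarrow> ereal 1" by simp
  have "eventually (\<lambda>n. ereal (root n (real (d n))) \<le> ereal (root n 5 * root n (real n))) sequentially"
    using eventually_ge_at_top[of 1]
  proof eventually_elim
    case (elim n)
    have "real (d n) \<le> 5 * real n" using assms[OF elim] elim by linarith
    then have "root n (real (d n)) \<le> root n (5 * real n)" using elim by (intro real_root_le_mono) auto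
    then show ?case by (simp add: real_root_mult)
  qed
  then have "limsup (\<lambda>n. ereal (root n (real (d n)))) \<le> limsup (\<lambda>n. ereal (root n 5 * root n (real n)))"
    by (rule Limsup_mono)
  also have "\<dots> = ereal 1" by (rule lim_imp_Limsup[OF _ lim]) simp
  finally show ?thesis by (simp add: one_ereal_def)
qed

lemma witt_mult_keys:
  fixes f g :: "int \<Rightarrow>\<^sub>0 'k::field"
  assumes "keys f \<subseteq> {-a..a}" "keys g \<subseteq> {-b..b}"
  shows "keys (f \<otimes>\<^bsub>witt\<^esub> g) \<subseteq> {-(a+b)..a+b}"
  using assms(1)
proof (induction f rule: poly_mapping_induct_on)
  case (single i c)
  show ?case using assms(2)
  proof (induction g rule: poly_mapping_induct_on)
    case (add g h)
    then show ?case using Poly_Mapping.keys_add[of "single i c \<otimes>\<^bsub>witt\<^esub> g" "single i c \<otimes>\<^bsub>witt\<^esub> h"]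
      by (simp add: witt_distrib) blast
  qed (use single in \<open>auto simp: witt_mult_zero witt_mult_single\<close>)
next
  case (add f h)
  then show ?case using Poly_Mapping.keys_add[of "f \<otimes>\<^bsub>witt\<^esub> g" "h \<otimes>\<^bsub>witt\<^esub> g"]
    by (simp add: witt_distrib) blast
qed (simp add: witt_mult_zero)

text \<open>Generate by the images of e_-2, ..., e_2. A bracket with one of them widens the range of
  indices by at most 2 on each side, so the n-th ball lies in the span of the images of e_i with |i|
  <= 2n, which are 4n + 1 vectors. The copy \<open>M\<close> stands in for the Witt algebra because
  \<open>SL\<close> consists of algebras drawn from a prescribed type.\<close>

lemma subexponential_growth_isomorphic_witt:
  fixes M :: "('k::field_char_0, 'u) module"
  assumes iso: "lie_isomorphic (witt :: ('k, int \<Rightarrow>\<^sub>0 'k) module) M" and M: "lie_algebra M"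
  shows "subexponential_growth M"
proof -
  interpret M: lie_algebra M by (rule M)
  obtain \<phi> where \<phi>: "\<phi> \<in> LinearCombinations.module_hom class_ring (witt :: ('k, int \<Rightarrow>\<^sub>0 'k) module) M"
    and m: "\<And>x y. \<phi> (x \<otimes>\<^bsub>witt\<^esub> y) = \<phi> x \<otimes>\<^bsub>M\<^esub> \<phi> y" and bij: "bij_betw \<phi> UNIV (carrier M)"
    using iso unfolding lie_isomorphic_def by (auto simp: witt_simps(1))
  have add: "\<phi> (x + y) = \<phi> x \<oplus>\<^bsub>M\<^esub> \<phi> y" for x y
    using LinearCombinations.module_hom_add[OF \<phi>, of x y] by (simp add: witt_simps)
  have smult: "\<phi> (scale c x) = c \<odot>\<^bsub>M\<^esub> \<phi> x" for c x
    using LinearCombinations.module_hom_smult[OF \<phi>, of c x] by (simp add: witt_simps)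
  have surj: "range \<phi> = carrier M" by (rule bij_betw_imp_surj_on[OF bij])
  have cl: "\<phi> x \<in> carrier M" for x unfolding surj[symmetric] by simp
  have zero: "\<phi> 0 = \<zero>\<^bsub>M\<^esub>"
  proof -
    have "scale 0 (0 :: int \<Rightarrow>\<^sub>0 'k) = 0" by (rule poly_mapping_eqI) simp
    then show ?thesis using smult[of 0 0] M.smult_l_null[OF cl[of 0]] by simp
  qed
  define V :: "int \<Rightarrow> (int \<Rightarrow>\<^sub>0 'k) set" where "V a = {f. keys f \<subseteq> {-a..a}}" for a
  define E where "E a = (\<lambda>i. \<phi> (single i 1)) ` {-a..a}" for a :: int
  have Ec: "E a \<subseteq> carrier M" "finite (E a)" for a by (auto simp: E_def cl)
  \<comment> \<open>Writing the image of \<open>V a\<close> as the span of finitely many vectors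
    reduces the dimension bound to counting the integers between -a and a.\<close>
  have im: "\<phi> ` V a = lin_span M (E a)" for a
  proof
    have sub: "lin_subspace (lin_span M (E a)) M" by (rule lin_span_subspace[OF M.vectorspace_axioms Ec(1)])
    note S = lin_subspaceD[OF sub]
    show "\<phi> ` V a \<subseteq> lin_span M (E a)"
    proof (rule image_subsetI)
      fix f assume "f \<in> V a"
      then have "keys f \<subseteq> {-a..a}" by (simp add: V_def)
      then show "\<phi> f \<in> lin_span M (E a)"
      proof (induction rule: poly_mapping_induct_on)
        case (single i c)
        then have "\<phi> (single i 1) \<in> lin_span M (E a)"
          using lin_span_superset[OF M.vectorspace_axioms Ec(1), of a] by (auto simp: E_def)
        then show ?case unfolding single_eq_smult[of i c] smult by (rule S(5))
      qed (simp_all add: zero S add)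
    qed
    have "lin_subspace (\<phi> ` V a) M"
    proof (rule lin_subspaceI[OF M.vectorspace_axioms])
      show "\<phi> ` V a \<subseteq> carrier M" using cl by blast
      have "0 \<in> V a" by (simp add: V_def)
      then show "\<zero>\<^bsub>M\<^esub> \<in> \<phi> ` V a" unfolding zero[symmetric] by (rule imageI)
      fix x y c assume "x \<in> \<phi> ` V a"
      then obtain f where f: "f \<in> V a" "x = \<phi> f" by blast
      have "scale c f \<in> V a" using f(1) keys_map_mult[of c f] by (auto simp: V_def)
      then show "c \<odot>\<^bsub>M\<^esub> x \<in> \<phi> ` V a" unfolding f(2) smult[symmetric] by (rule imageI)
      assume "y \<in> \<phi> ` V a"
      then obtain g where g: "g \<in> V a" "y = \<phi> g" by blast
      have "f + g \<in> V a" using f(1) g(1) Poly_Mapping.keys_add[of f g] by (auto simp: V_def)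
      then show "x \<oplus>\<^bsub>M\<^esub> y \<in> \<phi> ` V a" unfolding f(2) g(2) add[symmetric] by (rule imageI)
    qed
    moreover have "E a \<subseteq> \<phi> ` V a" by (auto simp: E_def V_def)
    ultimately show "lin_span M (E a) \<subseteq> \<phi> ` V a" by (rule lin_span_minimal)
  qed
  have Vs: "lin_subspace (\<phi> ` V a) M" for a
    unfolding im by (rule lin_span_subspace[OF M.vectorspace_axioms Ec(1)])
  define F where "F = \<phi> ` V 2"
  \<comment> \<open>Monotonicity of dimension compares subspaces, so the induction also records that
    each ball is one.\<close>
  have ball: "lin_subspace (lie_ball M F (Suc n)) M \<and> lie_ball M F (Suc n) \<subseteq> \<phi> ` V (2 * int (Suc n))" for n
  proof (induction n)
    case 0
    then show ?case using Vs[of 2] by (simp add: F_def)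
  next
    case (Suc n)
    let ?B = "lie_ball M F (Suc n)" and ?P = "{b \<otimes>\<^bsub>M\<^esub> f | b f. b \<in> lie_ball M F (Suc n) \<and> f \<in> F}"
    have P: "?P \<subseteq> \<phi> ` V (2 * int (Suc (Suc n)))"
    proof
      fix z assume "z \<in> ?P"
      then obtain b f where bf: "b \<in> ?B" "f \<in> F" "z = b \<otimes>\<^bsub>M\<^esub> f" by blast
      obtain x where x: "x \<in> V (2 * int (Suc n))" "b = \<phi> x" using Suc bf(1) by blast
      obtain y where y: "y \<in> V 2" "f = \<phi> y" using bf(2) by (auto simp: F_def)
      have e: "2 * int (Suc (Suc n)) = 2 * int (Suc n) + 2" by simp
      have "x \<otimes>\<^bsub>witt\<^esub> y \<in> V (2 * int (Suc (Suc n)))"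
        using witt_mult_keys[of x "2 * int (Suc n)" y 2] x(1) y(1) unfolding V_def e by (simp only: mem_Collect_eq)
      then show "z \<in> \<phi> ` V (2 * int (Suc (Suc n)))" unfolding bf(3) x(2) y(2) m[symmetric] by (rule imageI)
    qed
    have mono: "?B \<subseteq> \<phi> ` V (2 * int (Suc (Suc n)))"
    proof -
      have "V (2 * int (Suc n)) \<subseteq> V (2 * int (Suc (Suc n)))" by (fastforce simp: V_def)
      then show ?thesis using Suc by blast
    qed
    have span: "lin_subspace (lin_span M ?P) M" "lin_span M ?P \<subseteq> \<phi> ` V (2 * int (Suc (Suc n)))"
      using lin_span_subspace[OF M.vectorspace_axioms, of ?P] P lin_subspaceD(2)[OF Vs] lin_span_minimal[OF Vs P]
      by blast+
    have "lie_ball M F (Suc (Suc n)) = ?B <+>\<^bsub>M\<^esub> lin_span M ?P" by simp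
    then show ?case
      using lin_subspace_set_add(1)[OF conjunct1[OF Suc] span(1)] set_add_subset[OF Vs mono span(2)]
      by (simp only:)
  qed
  have dim: "dimension (M\<lparr>carrier := lie_ball M F n\<rparr>) \<le> 4 * n + 1" if n: "n \<ge> 1" for n
  proof -
    obtain k where k: "n = Suc k" using n by (cases n) auto
    have fd: "finite_dim (M\<lparr>carrier := \<phi> ` V (2 * int n)\<rparr>)"
      and d: "dimension (M\<lparr>carrier := \<phi> ` V (2 * int n)\<rparr>) \<le> card (E (2 * int n))"
      unfolding im using finite_dim_lin_span[OF M.vectorspace_axioms Ec(2,1)]
        dimension_lin_span[OF M.vectorspace_axioms Ec(2,1)] .
    have "dimension (M\<lparr>carrier := lie_ball M F n\<rparr>) \<le> dimension (M\<lparr>carrier := \<phi> ` V (2 * int n)\<rparr>)"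
      using dimension_mono[OF Vs _ _ fd, of "lie_ball M F n"] ball[of k] unfolding k by blast
    also have "card (E (2 * int n)) \<le> card {- (2 * int n)..2 * int n}"
      unfolding E_def by (rule card_image_le) simp
    then have "dimension (M\<lparr>carrier := \<phi> ` V (2 * int n)\<rparr>) \<le> 4 * n + 1" using d by simp
    finally show ?thesis .
  qed
  have gen: "H = carrier M" if H: "lie_subalgebra H M" "F \<subseteq> H" for H
  proof -
    note Hs = lin_subspaceD[OF lie_subalgebraD(1)[OF H(1)]]
    have "\<phi> -` H = UNIV"
    proof (rule witt_generated)
      show "lie_subalgebra (\<phi> -` H) witt"
        by (intro lie_subalgebraI lin_subspaceI[OF vectorspace_witt])
          (simp_all add: witt_simps zero add smult m Hs lie_subalgebraD(2)[OF H(1)])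
      fix i :: int assume "\<bar>i\<bar> \<le> 2"
      then have "single i 1 \<in> V 2" by (simp add: V_def abs_le_iff)
      then show "single i 1 \<in> \<phi> -` H" using H(2) by (auto simp: F_def)
    qed
    then have "carrier M \<subseteq> H" unfolding surj[symmetric] by blast
    then show ?thesis using Hs(2) by blast
  qed
  have Fs: "lin_subspace F M" unfolding F_def by (rule Vs)
  show ?thesis
    unfolding subexponential_growth_def
  proof (intro conjI exI[of _ F])
    show "lie_algebra M" by (rule M)
    show "lin_subspace F M" by (rule Fs)
    show "finite_dim (M\<lparr>carrier := F\<rparr>)"
      unfolding F_def im by (rule finite_dim_lin_span[OF M.vectorspace_axioms Ec(2,1)])
    have "lie_subalgebra (carrier M) M"
      by (rule lie_subalgebraI[OF lin_subspace_carrier[OF M.vectorspace_axioms] M.bracket_closed])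
    then have "{H. lie_subalgebra H M \<and> F \<subseteq> H} = {carrier M}"
      using gen lin_subspaceD(2)[OF Fs] by blast
    then show "\<Inter> {H. lie_subalgebra H M \<and> F \<subseteq> H} = carrier M" by simp
    show "limsup (\<lambda>n. ereal (root n (real (dimension (M\<lparr>carrier := lie_ball M F n\<rparr>))))) \<le> 1"
      by (rule root_linear_limsup[OF dim])
  qed
qed

text \<open>An injection into \<open>'u\<close> carries the operations over to its range. This
  places the Witt algebra inside the universe in which the classes are formed.\<close>

lemma witt_copy:
  assumes "(UNIV :: (int \<Rightarrow>\<^sub>0 'k::field_char_0) set) \<lesssim> (UNIV :: 'u set)"
  obtains M :: "('k::field_char_0, 'u) module" where "lie_algebra M" "lie_isomorphic (witt :: ('k, int \<Rightarrow>\<^sub>0 'k) module) M"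
proof -
  obtain g :: "(int \<Rightarrow>\<^sub>0 'k) \<Rightarrow> 'u" where g: "inj g" using assms unfolding lepoll_def by blast
  define M :: "('k, 'u) module" where "M = \<lparr>carrier = range g, mult = (\<lambda>x y. g (inv_into UNIV g x \<otimes>\<^bsub>witt\<^esub> inv_into UNIV g y)),
    one = undefined, zero = g 0, add = (\<lambda>x y. g (inv_into UNIV g x + inv_into UNIV g y)),
    smult = (\<lambda>c x. g (scale c (inv_into UNIV g x)))\<rparr>"
  have M: "lie_algebra M"
    by (rule lie_algebra_surj[OF lie_algebra_witt, of g]) (simp_all add: M_def witt_simps inv_into_f_f[OF g])
  moreover have "lie_isomorphic (witt :: ('k, int \<Rightarrow>\<^sub>0 'k) module) M"
    unfolding lie_isomorphic_def
  proof (intro bexI[of _ g] conjI ballI)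
    show "bij_betw g (carrier witt) (carrier M)"
      unfolding M_def witt_simps by (simp add: bij_betw_def g)
    show "g \<in> LinearCombinations.module_hom class_ring witt M"
      by (simp add: LinearCombinations.module_hom_def M_def witt_simps inv_into_f_f[OF g])
  qed (simp add: M_def inv_into_f_f[OF g])
  ultimately show thesis by (rule that)
qed

lemma EL_neq_SL:
  assumes "(UNIV :: (int \<Rightarrow>\<^sub>0 'k::field_char_0) set) \<lesssim> (UNIV :: 'u set)"
  shows "(EL :: ('k, 'u) module set) \<noteq> SL"
proof -
  obtain M :: "('k, 'u) module" where M: "lie_algebra M" "lie_isomorphic (witt :: ('k, int \<Rightarrow>\<^sub>0 'k) module) M"
    by (rule witt_copy[OF assms])
  have "M \<in> SL"
    unfolding SL_def by (rule lie_closure.base) (simp add: subexponential_growth_isomorphic_witt[OF M(2,1)])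
  moreover have "M \<notin> EL" using EL_not_witt_section witt_section_isomorphic[OF M(2,1)] by blast
  ultimately show ?thesis by blast
qed

section \<open>Counting sorted words\<close>

text \<open>The summand 1 makes e_0 cost something, so only finitely many words have bounded weight.
  Moreover |i + j| + 1 <= (|i| + 1) + (|j| + 1), so merging two letters into their bracket never
  raises the weight.\<close>

definition weight :: "int list \<Rightarrow> nat" where
  "weight w = sum_list (map (\<lambda>i. nat \<bar>i\<bar> + 1) w)"

lemma weight_simps [simp]: "weight [] = 0" "weight (i # w) = nat \<bar>i\<bar> + 1 + weight w"
  by (simp_all add: weight_def)

lemma length_le_weight: "length w \<le> weight w"
  by (induction w) auto

lemma abs_le_weight: "i \<in> set w \<Longrightarrow> nat \<bar>i\<bar> < weight w"
  by (induction w) auto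

lemma weight_sort: "weight (sort w) = weight w"
proof -
  have "weight (insort i w) = nat \<bar>i\<bar> + 1 + weight w" for i w
    by (induction w) auto
  then show ?thesis by (induction w) simp_all
qed

lemma finite_weight_le: "finite {w. weight w \<le> n}"
proof (rule finite_subset)
  show "{w. weight w \<le> n} \<subseteq> {w. set w \<subseteq> {- int n..int n} \<and> length w \<le> n}"
  proof (rule subsetI, rule CollectI, rule conjI)
    fix w assume "w \<in> {w. weight w \<le> n}"
    then have w: "weight w \<le> n" by simp
    show "length w \<le> n" using length_le_weight[of w] w by simp
    show "set w \<subseteq> {- int n..int n}"
    proof
      fix i assume "i \<in> set w"
      then have "nat \<bar>i\<bar> < n" using abs_le_weight[of i w] w by simp
      then show "i \<in> {- int n..int n}" by auto
    qed
  qed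
qed (rule finite_lists_length_le, simp)

lemma geometric_sum_le:
  fixes y :: real
  assumes "0 \<le> y" "y < 1"
  shows "(\<Sum>m<n. y ^ m) \<le> 1 / (1 - y)"
proof -
  have "(1 - y) * (\<Sum>m<n. y ^ m) = 1 - y ^ n" by (rule one_diff_power_eq[symmetric])
  also have "\<dots> \<le> 1" using assms by simp
  finally show ?thesis using assms by (simp add: field_simps)
qed

text \<open>Positive and negative indices contribute a geometric series each; the bound does not
  depend on \<open>n\<close>, which is what the counting argument needs.\<close>

lemma sum_power_abs_le:
  fixes x :: real
  assumes "0 \<le> x" "x < 1"
  shows "(\<Sum>i\<in>{- int n..int n}. x ^ (nat \<bar>i\<bar> + 1)) \<le> 2 / (1 - x)"
proof -
  have "(\<Sum>i\<in>{- int n..int n}. x ^ (nat \<bar>i\<bar> + 1)) \<le> 2 * (\<Sum>m<Suc n. x ^ m)"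
  proof (induction n)
    case 0
    then show ?case using assms by simp
  next
    case (Suc n)
    have e: "{- int (Suc n)..int (Suc n)} = insert (- int (Suc n)) (insert (int (Suc n)) {- int n..int n})"
      by auto
    have "(\<Sum>i\<in>{- int (Suc n)..int (Suc n)}. x ^ (nat \<bar>i\<bar> + 1)) =
        2 * x ^ Suc (Suc n) + (\<Sum>i\<in>{- int n..int n}. x ^ (nat \<bar>i\<bar> + 1))"
      unfolding e by (subst sum.insert; simp add: nat_add_distrib)+
    \<comment> \<open>The two new indices n+1 and -(n+1) contribute x^(n+2) each, while the
      right-hand side grows by 2 x^(n+1).\<close>
    moreover have "x ^ Suc (Suc n) \<le> x ^ Suc n" using assms by (intro power_decreasing) auto
    ultimately show ?case using Suc.IH unfolding sum.lessThan_Suc[of _ "Suc n"] distrib_left by linarith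
  qed
  also have "\<dots> \<le> 2 * (1 / (1 - x))" by (intro mult_left_mono geometric_sum_le assms) simp
  finally show ?thesis by simp
qed

text \<open>The number of multisets of weight at most \<open>n\<close> grows subexponentially because its generating
  function \<open>\<Prod>i. 1 / (1 - x ^ (\<bar>i\<bar> + 1))\<close> converges for \<open>0 < x < 1\<close>.\<close>
lemma card_sorted_weight_le:
  fixes x :: real
  assumes x: "0 < x" "x < 1"
  shows "real (card {w. sorted w \<and> weight w \<le> n}) * x ^ n \<le> exp (2 / (1 - x) ^ 2)"
proof -
  define S where "S = {w. sorted w \<and> weight w \<le> n}"
  define X where "X = {- int n..int n}"
  define v where "v i = nat \<bar>i\<bar> + 1" for i :: int
  \<comment> \<open>The multiplicities of the letters determine a sorted word; restricting the
    counting function to the finite set \<open>X\<close> makes it a point of a finite product of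
    sets. In these terms x to the weight becomes the product \<open>P\<close>.\<close>
  define \<kappa> where "\<kappa> w = restrict (count_list w) X" for w :: "int list"
  define P where "P g = (\<Prod>i\<in>X. (x ^ v i) ^ g i)" for g :: "int \<Rightarrow> nat"
  have finX: "finite X" by (simp add: X_def)
  have finS: "finite S" unfolding S_def by (rule finite_subset[OF _ finite_weight_le[of n]]) blast
  have setX: "set w \<subseteq> X" if "w \<in> S" for w
  proof
    fix i assume "i \<in> set w"
    then have "nat \<bar>i\<bar> < n" using abs_le_weight[of i w] that by (simp add: S_def)
    then show "i \<in> X" by (auto simp: X_def)
  qed
  have inj: "inj_on \<kappa> S"
  proof (rule inj_onI)
    fix u w assume uw: "u \<in> S" "w \<in> S" "\<kappa> u = \<kappa> w"
    have "count_list u i = count_list w i" for i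
    proof (cases "i \<in> X")
      case True
      then show ?thesis using fun_cong[OF uw(3), of i] by (simp add: \<kappa>_def)
    next
      case False
      then have "i \<notin> set u" "i \<notin> set w" using setX uw(1,2) by blast+
      then show ?thesis by (simp add: count_list_0_iff)
    qed
    then have "mset u = mset w" by (intro multiset_eqI) (simp add: count_mset)
    then show "u = w" using uw(1,2) unfolding S_def
      by (metis mem_Collect_eq properties_for_sort sorted_sort_id)
  qed
  have wt: "x ^ weight w = P (\<kappa> w)" if "w \<in> S" for w
  proof -
    have "weight w = (\<Sum>i\<in>X. count_list w i * v i)"
      unfolding weight_def v_def by (rule sum_list_map_eq_sum_count2[OF setX[OF that] finX])
    then have "x ^ weight w = (\<Prod>i\<in>X. x ^ (count_list w i * v i))" by (simp only: power_sum)
    also have "\<dots> = P (\<kappa> w)"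
      unfolding P_def \<kappa>_def
      by (rule prod.cong[OF refl]) (simp only: restrict_apply if_True power_mult[symmetric] mult.commute)
    finally show ?thesis .
  qed
  have PiE: "\<kappa> ` S \<subseteq> PiE X (\<lambda>_. {..<Suc n})"
  proof (rule image_subsetI)
    fix w assume w: "w \<in> S"
    have "count_list w i < Suc n" for i
      using count_le_length[of w i] length_le_weight[of w] w by (simp add: S_def)
    then show "\<kappa> w \<in> PiE X (\<lambda>_. {..<Suc n})" by (simp add: \<kappa>_def)
  qed
  have y: "0 \<le> x ^ v i" "x ^ v i < 1" "x ^ v i \<le> x" for i
  proof -
    show "0 \<le> x ^ v i" using x by simp
    show "x ^ v i \<le> x" using x power_decreasing[of 1 "v i" x] by (simp add: v_def)
    then show "x ^ v i < 1" using x by linarith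
  qed
  have "real (card S) * x ^ n = (\<Sum>w\<in>S. x ^ n)" by simp
  \<comment> \<open>As 0 < x < 1 and weights in \<open>S\<close> are at most n, x^n is a lower bound
    for every x^weight. The new sum is a partial sum of the generating function of
    multisets.\<close>
  also have "\<dots> \<le> (\<Sum>w\<in>S. x ^ weight w)"
    by (rule sum_mono) (use x in \<open>auto simp: S_def intro!: power_decreasing\<close>)
  also have "\<dots> = (\<Sum>w\<in>S. P (\<kappa> w))" by (rule sum.cong[OF refl wt])
  also have "\<dots> = (\<Sum>g\<in>\<kappa> ` S. P g)" using sum.reindex[OF inj, of P] by (simp add: comp_def)
  also have "\<dots> \<le> (\<Sum>g\<in>PiE X (\<lambda>_. {..<Suc n}). P g)"
    by (rule sum_mono2[OF _ PiE]) (use x finX in \<open>auto simp: P_def intro!: finite_PiE prod_nonneg\<close>)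
  \<comment> \<open>Choosing a multiplicity for every letter is expanding a product: Euler's product
    for partitions, with multiplicities cut off at n.\<close>
  also have "\<dots> = (\<Prod>i\<in>X. \<Sum>m<Suc n. (x ^ v i) ^ m)"
    unfolding P_def by (rule prod_sum_PiE[symmetric]) (use finX in auto)
  also have "\<dots> \<le> (\<Prod>i\<in>X. exp (x ^ v i / (1 - x)))"
  proof (rule prod_mono, rule conjI)
    fix i
    show "0 \<le> (\<Sum>m<Suc n. (x ^ v i) ^ m)" by (intro sum_nonneg zero_le_power y)
    have "(\<Sum>m<Suc n. (x ^ v i) ^ m) \<le> 1 / (1 - x ^ v i)" by (rule geometric_sum_le[OF y(1,2)])
    also have "\<dots> = 1 + x ^ v i / (1 - x ^ v i)" using y(2)[of i] by (simp add: field_simps)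
    \<comment> \<open>Replacing the denominator by the smaller constant 1 - x leaves something
      linear in x^(v i); with 1 + t <= exp t the product is bounded by the exponential of a
      geometric sum.\<close>
    also have "\<dots> \<le> 1 + x ^ v i / (1 - x)" using y[of i] x by (intro add_left_mono divide_left_mono) auto
    also have "\<dots> \<le> exp (x ^ v i / (1 - x))" by (rule exp_ge_add_one_self)
    finally show "(\<Sum>m<Suc n. (x ^ v i) ^ m) \<le> exp (x ^ v i / (1 - x))" .
  qed
  also have "\<dots> = exp ((\<Sum>i\<in>X. x ^ v i) / (1 - x))"
    by (simp add: exp_sum[OF finX, symmetric] sum_divide_distrib)
  also have "\<dots> \<le> exp ((2 / (1 - x)) / (1 - x))"
    unfolding exp_le_cancel_iff X_def v_def using sum_power_abs_le[of x n] x by (intro divide_right_mono) auto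
  finally show ?thesis by (simp add: S_def power2_eq_square)
qed

text \<open>If each step of length \<open>c\<close> multiplied \<open>d\<close> by at least 1 +
  \<epsilon>, then d(kc) >= (1 + \<epsilon>)^k, starting from d(0) >= 1, and the growth would be
  exponential. One good index is all that is claimed, and amenability asks for no more.\<close>

lemma subexponential_slow_step:
  fixes d :: "nat \<Rightarrow> nat" and \<epsilon> :: real
  assumes pos: "\<And>n. d n \<ge> 1" and sub: "\<And>x::real. 0 < x \<Longrightarrow> x < 1 \<Longrightarrow> \<exists>C. \<forall>n. real (d n) * x ^ n \<le> C"
    and c: "c > 0" and \<epsilon>: "\<epsilon> > 0"
  shows "\<exists>n. real (d (n + c)) < (1 + \<epsilon>) * real (d n)"
proof (rule ccontr)
  assume "\<not> ?thesis"
  then have step: "(1 + \<epsilon>) * real (d n) \<le> real (d (n + c))" for n by (simp add: not_less)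
  have low: "(1 + \<epsilon>) ^ k \<le> real (d (k * c))" for k
  proof (induction k)
    case 0
    then show ?case using pos[of 0] by simp
  next
    case (Suc k)
    have "(1 + \<epsilon>) ^ Suc k \<le> (1 + \<epsilon>) * real (d (k * c))" using Suc \<epsilon> by simp
    also have "\<dots> \<le> real (d (Suc k * c))" using step[of "k * c"] by (simp add: add.commute)
    finally show ?case .
  qed
  \<comment> \<open>Any x with x^c strictly between 1/(1 + \<epsilon>) and 1 would do: x < 1 allows
    the growth hypothesis, while (1 + \<epsilon>) x^c > 1 makes its bound fail. The value
    \<epsilon>/2 picks one such x.\<close>
  define x where "x = root c (1 / (1 + \<epsilon> / 2))"
  have xc: "x ^ c = 1 / (1 + \<epsilon> / 2)" unfolding x_def using c \<epsilon> by (intro real_root_pow_pos2) auto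
  have "0 < x" unfolding x_def using c \<epsilon> by simp
  moreover have "x < 1" unfolding x_def using c \<epsilon> by simp
  ultimately obtain C where C: "\<And>n. real (d n) * x ^ n \<le> C" using sub[of x] by blast
  define r where "r = (1 + \<epsilon>) / (1 + \<epsilon> / 2)"
  have "r > 1" using \<epsilon> by (simp add: r_def)
  then obtain k where k: "C < r ^ k" using real_arch_pow by blast
  have "r ^ k = (1 + \<epsilon>) ^ k * x ^ (k * c)"
    unfolding r_def mult.commute[of k c] power_mult xc by (simp add: power_divide)
  also have "\<dots> \<le> real (d (k * c)) * x ^ (k * c)" using low[of k] \<open>0 < x\<close> by (intro mult_right_mono) auto
  also have "\<dots> \<le> C" by (rule C)
  finally show False using k by simp
qed

section \<open>Amenability of the Witt algebra\<close>

text \<open>The zero map on \<open>L\<close> respects brackets, so the universal property extends it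
  to a unital homomorphism from U(L) to the ground field, the counit. If 1 were 0 in U(L), the same
  would hold in the field.\<close>

lemma one_envelope_nonzero:
  fixes L :: "('k::field, 'v) module"
  assumes L: "lie_algebra L"
  shows "\<one>\<^bsub>envelope L\<^esub> \<noteq> \<zero>\<^bsub>envelope L\<^esub>"
proof
  assume eq: "\<one>\<^bsub>envelope L\<^esub> = \<zero>\<^bsub>envelope L\<^esub>"
  \<comment> \<open>The free monoid on no letters has a single element, so its monoid algebra is a
    copy of the ground field.\<close>
  define T :: "('k, unit list \<Rightarrow>\<^sub>0 'k) module" where "T = monoid_algebra (free_monoid {})"
  have T: "assoc_algebra T" unfolding T_def by (rule assoc_algebra_monoid_algebra[OF monoid_free_monoid])
  interpret T: ring T by (rule assoc_algebraD(1)[OF T])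
  interpret vT: vectorspace class_ring T by (rule assoc_algebraD(2)[OF T])
  interpret U: ring "envelope L" by (rule assoc_algebraD(1)[OF assoc_algebra_envelope[OF L]])
  have "\<exists>\<Delta>. \<Delta> \<in> LinearCombinations.module_hom class_ring (envelope L) T \<and> \<Delta> \<in> Ring.ring_hom (envelope L) T \<and>
    (\<forall>x\<in>carrier L. \<Delta> (envelope_incl L x) = \<zero>\<^bsub>T\<^esub>)"
    using vT.smult_r_null by (intro envelope_universal[OF L T]) simp_all
  then obtain \<Delta> where \<Delta>: "\<Delta> \<in> Ring.ring_hom (envelope L) T" by blast
  interpret h: ring_hom_ring "envelope L" T \<Delta>
    by (rule ring_hom_ringI2[OF U.ring_axioms T.ring_axioms \<Delta>])
  have "\<one>\<^bsub>T\<^esub> = \<zero>\<^bsub>T\<^esub>" using h.hom_one h.hom_zero eq by simp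
  then have "single [] 1 = (0 :: unit list \<Rightarrow>\<^sub>0 'k)"
    by (simp add: T_def monoid_algebra_simps free_monoid_def)
  from arg_cong[OF this, of "\<lambda>f. lookup f []"] show False by simp
qed

lemma dimension_pos:
  fixes V :: "('k::field, 'v) module"
  assumes V: "vectorspace class_ring V" and fd: "finite_dim V" and x: "x \<in> carrier V" "x \<noteq> \<zero>\<^bsub>V\<^esub>"
  shows "dimension V \<ge> 1"
proof -
  interpret vectorspace class_ring V by (rule V)
  obtain b where b: "finite b" "basis b" using finite_basis_exists[OF fd] by blast
  have "b \<noteq> {}"
  proof
    assume "b = {}"
    then have "carrier V = {\<zero>\<^bsub>V\<^esub>}" using b(2) span_empty by (simp add: basis_def)
    then show False using x by simp
  qed
  then have "card b \<ge> 1" using b(1) by (simp add: Suc_le_eq card_gt_0_iff)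
  then show ?thesis using dim_basis[OF b] by simp
qed

text \<open>Induction over a span: the vectors with property \<open>P\<close> form a subspace
  containing the generators.\<close>

lemma lin_span_collect:
  fixes V :: "('k::field, 'v) module"
  assumes V: "vectorspace class_ring V" and S: "S \<subseteq> carrier V" and u: "u \<in> lin_span V S"
    and "P \<zero>\<^bsub>V\<^esub>" "\<And>x y. x \<in> carrier V \<Longrightarrow> y \<in> carrier V \<Longrightarrow> P x \<Longrightarrow> P y \<Longrightarrow> P (x \<oplus>\<^bsub>V\<^esub> y)"
    and "\<And>c x. x \<in> carrier V \<Longrightarrow> P x \<Longrightarrow> P (c \<odot>\<^bsub>V\<^esub> x)" "\<And>x. x \<in> S \<Longrightarrow> P x"
  shows "P u"
proof -
  interpret vectorspace class_ring V by (rule V)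
  have sc: "c \<odot>\<^bsub>V\<^esub> x \<in> carrier V" if "x \<in> carrier V" for c x using smult_closed[OF _ that] by simp
  have "lin_subspace {x \<in> carrier V. P x} V"
    by (rule lin_subspaceI[OF V]) (simp_all add: assms sc)
  then have "lin_span V S \<subseteq> {x \<in> carrier V. P x}"
    by (rule lin_span_minimal) (use S assms(7) in blast)
  then show ?thesis using u by blast
qed

section \<open>The weight filtration on the enveloping algebra of the Witt algebra\<close>

context
  fixes W :: "('k::field_char_0, int \<Rightarrow>\<^sub>0 'k) module" and U :: "('k, ((int \<Rightarrow>\<^sub>0 'k) list \<Rightarrow>\<^sub>0 'k) set) module"
  assumes W_def: "W = witt" and U_def: "U = envelope W"
begin

lemma lie_W: "lie_algebra W" unfolding W_def by (rule lie_algebra_witt)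

lemma W_carrier: "x \<in> carrier W" by (simp add: W_def witt_simps)

lemma assoc_algebra_U: "assoc_algebra U" unfolding U_def by (rule assoc_algebra_envelope[OF lie_W])

interpretation U: ring U by (rule assoc_algebraD(1)[OF assoc_algebra_U])
interpretation vU: vectorspace class_ring U by (rule assoc_algebraD(2)[OF assoc_algebra_U])

lemma vectorspace_U: "vectorspace class_ring U" by (rule assoc_algebraD(2)[OF assoc_algebra_U])

lemmas U_smult = assoc_algebraD(3-5)[OF assoc_algebra_U]

definition env_gen :: "int \<Rightarrow> ((int \<Rightarrow>\<^sub>0 'k) list \<Rightarrow>\<^sub>0 'k) set" where
  "env_gen i = envelope_incl W (single i 1)"

abbreviation env_word :: "int list \<Rightarrow> ((int \<Rightarrow>\<^sub>0 'k) list \<Rightarrow>\<^sub>0 'k) set" where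
  "env_word \<equiv> word_prod U env_gen"

lemma env_gen_closed [simp]: "env_gen i \<in> carrier U"
  unfolding env_gen_def U_def by (rule envelope_incl_closed[OF lie_W W_carrier])

lemma env_word_closed [simp]: "env_word w \<in> carrier U"
  by (rule word_prod_closed[OF U.is_monoid, of UNIV]) simp_all

lemma env_gen_swap:
  "env_gen i \<otimes>\<^bsub>U\<^esub> env_gen j = (env_gen j \<otimes>\<^bsub>U\<^esub> env_gen i) \<oplus>\<^bsub>U\<^esub> (of_int (j - i) \<odot>\<^bsub>U\<^esub> env_gen (i + j))"
proof -
  have "single i 1 \<otimes>\<^bsub>W\<^esub> single j 1 = of_int (j - i) \<odot>\<^bsub>W\<^esub> single (i + j) 1"
    by (simp add: W_def witt_mult_single witt_simps map_mult_single)
  then show ?thesis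
    using envelope_incl_bracket[OF lie_W W_carrier W_carrier, of "single i 1" "single j 1"]
      envelope_incl_smult[OF lie_W W_carrier, of "of_int (j - i)" "single (i + j) 1"]
    by (simp add: env_gen_def U_def)
qed

text \<open>Home of the error terms of sorting. The length bound is strict so that an error term of
  a word of length l consists of words to which induction on length applies.\<close>

definition short_word_span :: "nat \<Rightarrow> nat \<Rightarrow> ((int \<Rightarrow>\<^sub>0 'k) list \<Rightarrow>\<^sub>0 'k) set set" where
  "short_word_span l m = lin_span U {env_word w | w. length w < l \<and> weight w \<le> m}"

definition sorted_word_span :: "nat \<Rightarrow> ((int \<Rightarrow>\<^sub>0 'k) list \<Rightarrow>\<^sub>0 'k) set set" where
  "sorted_word_span m = lin_span U (env_word ` {w. sorted w \<and> weight w \<le> m})"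

definition word_span :: "nat \<Rightarrow> ((int \<Rightarrow>\<^sub>0 'k) list \<Rightarrow>\<^sub>0 'k) set set" where
  "word_span m = lin_span U {env_word w | w. weight w \<le> m}"

lemma short_word_span_subspace: "lin_subspace (short_word_span l m) U"
  unfolding short_word_span_def by (rule lin_span_subspace[OF vectorspace_U]) auto

lemma word_span_subspace: "lin_subspace (word_span m) U"
  unfolding word_span_def by (rule lin_span_subspace[OF vectorspace_U]) auto

lemma sorted_word_span_subspace: "lin_subspace (sorted_word_span m) U"
  unfolding sorted_word_span_def by (rule lin_span_subspace[OF vectorspace_U]) auto

lemma word_in_short_word_span: "length w < l \<Longrightarrow> weight w \<le> m \<Longrightarrow> env_word w \<in> short_word_span l m"
  unfolding short_word_span_def by (rule subsetD[OF lin_span_superset[OF vectorspace_U]]) auto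

lemma word_in_word_span: "weight w \<le> m \<Longrightarrow> env_word w \<in> word_span m"
  unfolding word_span_def by (rule subsetD[OF lin_span_superset[OF vectorspace_U]]) auto

lemma sorted_word_in_sorted_word_span: "sorted w \<Longrightarrow> weight w \<le> m \<Longrightarrow> env_word w \<in> sorted_word_span m"
  unfolding sorted_word_span_def by (rule subsetD[OF lin_span_superset[OF vectorspace_U]]) auto

lemma gen_mult_short_word_span:
  assumes "u \<in> short_word_span l m" "Suc l \<le> l'" "m + nat \<bar>i\<bar> + 1 \<le> m'"
  shows "env_gen i \<otimes>\<^bsub>U\<^esub> u \<in> short_word_span l' m'"
proof -
  note S = lin_subspaceD[OF short_word_span_subspace]
  show ?thesis
  proof (rule lin_span_collect[OF vectorspace_U _ assms(1)[unfolded short_word_span_def], where P = "\<lambda>u. env_gen i \<otimes>\<^bsub>U\<^esub> u \<in> short_word_span l' m'"])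
    fix x assume "x \<in> {env_word w | w. length w < l \<and> weight w \<le> m}"
    then obtain w where "x = env_word w" "length w < l" "weight w \<le> m" by blast
    then show "env_gen i \<otimes>\<^bsub>U\<^esub> x \<in> short_word_span l' m'"
      using word_in_short_word_span[of "i # w" l' m'] assms(2,3) by simp
  qed (auto simp: S U_smult U.r_distr)
qed

lemma minus_self: "x \<in> carrier U \<Longrightarrow> x \<ominus>\<^bsub>U\<^esub> x = \<zero>\<^bsub>U\<^esub>"
  by (simp add: a_minus_def U.r_neg)

text \<open>Push e_i to the right past each smaller letter e_j by e_i e_j = e_j e_i + (j - i)
  e_(i+j). Every exchange leaves a remainder with one letter less and no more weight, so the total
  error is a combination of words strictly shorter than the full one.\<close>

lemma gen_mult_insort:
  "env_gen i \<otimes>\<^bsub>U\<^esub> env_word w \<ominus>\<^bsub>U\<^esub> env_word (insort i w) \<in> short_word_span (Suc (length w)) (nat \<bar>i\<bar> + 1 + weight w)"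
proof (induction w)
  case Nil
  show ?case using lin_subspaceD(3)[OF short_word_span_subspace] by (simp add: minus_self)
next
  case (Cons j w)
  let ?M = "short_word_span (Suc (length (j # w))) (nat \<bar>i\<bar> + 1 + weight (j # w))"
  note S = lin_subspaceD[OF short_word_span_subspace]
  show ?case
  proof (cases "i \<le> j")
    case True
    have "env_gen i \<otimes>\<^bsub>U\<^esub> env_word (j # w) = env_word (insort i (j # w))" using True by simp
    then show ?thesis using S(3) minus_self[OF env_word_closed] by (simp only:)
  next
    case False
    let ?P = "env_word w" and ?I = "env_word (insort i w)" and ?c = "of_int (j - i) :: 'k"
    \<comment> \<open>The error from inserting into the tail, multiplied by e_j: one more letter in
      the words and in the length bound, and the weight of e_j is available in the budget of
      \<open>?M\<close>.\<close>
    have 1: "env_gen j \<otimes>\<^bsub>U\<^esub> (env_gen i \<otimes>\<^bsub>U\<^esub> ?P \<ominus>\<^bsub>U\<^esub> ?I) \<in> ?M"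
      by (rule gen_mult_short_word_span[OF Cons.IH]) auto
    \<comment> \<open>The commutator merges two letters into one, so the word is shorter; by the
      triangle inequality it is no heavier.\<close>
    have "env_word ((i + j) # w) \<in> ?M"
      by (rule word_in_short_word_span) auto
    then have 2: "?c \<odot>\<^bsub>U\<^esub> env_word ((i + j) # w) \<in> ?M" by (rule S(5))
    have "env_gen i \<otimes>\<^bsub>U\<^esub> env_word (j # w) = (env_gen i \<otimes>\<^bsub>U\<^esub> env_gen j) \<otimes>\<^bsub>U\<^esub> ?P"
      by (simp add: U.m_assoc)
    also have "\<dots> = env_gen j \<otimes>\<^bsub>U\<^esub> (env_gen i \<otimes>\<^bsub>U\<^esub> ?P) \<oplus>\<^bsub>U\<^esub> ?c \<odot>\<^bsub>U\<^esub> env_word ((i + j) # w)"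
      unfolding env_gen_swap[of i j] by (simp only: U.l_distr U.m_closed env_gen_closed env_word_closed U_smult U.m_assoc word_prod_simps)
    finally have "env_gen i \<otimes>\<^bsub>U\<^esub> env_word (j # w) \<ominus>\<^bsub>U\<^esub> env_word (insort i (j # w)) =
        (env_gen j \<otimes>\<^bsub>U\<^esub> (env_gen i \<otimes>\<^bsub>U\<^esub> ?P) \<oplus>\<^bsub>U\<^esub> ?c \<odot>\<^bsub>U\<^esub> env_word ((i + j) # w)) \<ominus>\<^bsub>U\<^esub> env_gen j \<otimes>\<^bsub>U\<^esub> ?I"
      using False by simp
    also have "\<dots> = env_gen j \<otimes>\<^bsub>U\<^esub> (env_gen i \<otimes>\<^bsub>U\<^esub> ?P \<ominus>\<^bsub>U\<^esub> ?I) \<oplus>\<^bsub>U\<^esub> ?c \<odot>\<^bsub>U\<^esub> env_word ((i + j) # w)"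
    proof -
      have "a \<in> carrier U \<Longrightarrow> p \<in> carrier U \<Longrightarrow> q \<in> carrier U \<Longrightarrow> z \<in> carrier U \<Longrightarrow>
        (a \<otimes>\<^bsub>U\<^esub> p \<oplus>\<^bsub>U\<^esub> z) \<ominus>\<^bsub>U\<^esub> a \<otimes>\<^bsub>U\<^esub> q = a \<otimes>\<^bsub>U\<^esub> (p \<ominus>\<^bsub>U\<^esub> q) \<oplus>\<^bsub>U\<^esub> z" for a p q z
        by algebra
      then show ?thesis by (simp only: U.m_closed env_gen_closed env_word_closed U_smult)
    qed
    finally show ?thesis using S(4)[OF 1 2] by (simp only:)
  qed
qed

text \<open>Insertion sort: the error of sorting the tail, multiplied by the first letter, plus the
  error of inserting that letter into the sorted tail.\<close>

lemma word_sort: "env_word w \<ominus>\<^bsub>U\<^esub> env_word (sort w) \<in> short_word_span (length w) (weight w)"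
proof (induction w)
  case Nil
  show ?case using lin_subspaceD(3)[OF short_word_span_subspace] by (simp add: minus_self)
next
  case (Cons i w)
  let ?M = "short_word_span (length (i # w)) (weight (i # w))"
  have 1: "env_gen i \<otimes>\<^bsub>U\<^esub> (env_word w \<ominus>\<^bsub>U\<^esub> env_word (sort w)) \<in> ?M"
    by (rule gen_mult_short_word_span[OF Cons.IH]) auto
  have 2: "env_gen i \<otimes>\<^bsub>U\<^esub> env_word (sort w) \<ominus>\<^bsub>U\<^esub> env_word (insort i (sort w)) \<in> ?M"
    using gen_mult_insort[of i "sort w"] by (simp add: weight_sort)
  have "a \<in> carrier U \<Longrightarrow> p \<in> carrier U \<Longrightarrow> q \<in> carrier U \<Longrightarrow> z \<in> carrier U \<Longrightarrow>
      a \<otimes>\<^bsub>U\<^esub> p \<ominus>\<^bsub>U\<^esub> z = a \<otimes>\<^bsub>U\<^esub> (p \<ominus>\<^bsub>U\<^esub> q) \<oplus>\<^bsub>U\<^esub> (a \<otimes>\<^bsub>U\<^esub> q \<ominus>\<^bsub>U\<^esub> z)" for a p q z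
    by algebra
  from this[OF env_gen_closed env_word_closed env_word_closed env_word_closed, of i w "insort i (sort w)" "sort w"]
  show ?case using lin_subspaceD(4)[OF short_word_span_subspace 1 2] by simp
qed

text \<open>Modulo strictly shorter words of no larger weight a word equals its sorted version, so
  strong induction on length absorbs all error terms. This is the spanning half of the
  Poincare-Birkhoff-Witt theorem, with control of the weight.\<close>

lemma word_in_sorted_word_span: "weight w \<le> m \<Longrightarrow> env_word w \<in> sorted_word_span m"
proof (induction "length w" arbitrary: w rule: less_induct)
  case less
  note S = lin_subspaceD[OF sorted_word_span_subspace]
  have "short_word_span (length w) (weight w) \<subseteq> sorted_word_span m"
    unfolding short_word_span_def
    by (rule lin_span_minimal[OF sorted_word_span_subspace]) (use less in auto)
  then have 1: "env_word w \<ominus>\<^bsub>U\<^esub> env_word (sort w) \<in> sorted_word_span m" using word_sort[of w] by blast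
  have 2: "env_word (sort w) \<in> sorted_word_span m"
    using less.prems by (intro sorted_word_in_sorted_word_span) (simp_all add: weight_sort)
  have "(env_word w \<ominus>\<^bsub>U\<^esub> env_word (sort w)) \<oplus>\<^bsub>U\<^esub> env_word (sort w) = env_word w"
    by (simp add: a_minus_def U.a_assoc U.l_neg)
  then show ?case using S(4)[OF 1 2] by simp
qed

lemma word_span_eq_sorted: "word_span m = sorted_word_span m"
proof
  show "word_span m \<subseteq> sorted_word_span m"
    unfolding word_span_def by (rule lin_span_minimal[OF sorted_word_span_subspace]) (use word_in_sorted_word_span in auto)
  show "sorted_word_span m \<subseteq> word_span m"
    unfolding sorted_word_span_def by (rule lin_span_minimal[OF word_span_subspace]) (use word_in_word_span in auto)
qed

lemma
  shows finite_dim_word_span: "finite_dim (U\<lparr>carrier := word_span m\<rparr>)"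
    and dimension_word_span_le: "dimension (U\<lparr>carrier := word_span m\<rparr>) \<le> card {w. sorted w \<and> weight w \<le> m}"
proof -
  have fin: "finite {w. sorted w \<and> weight w \<le> m}"
    by (rule finite_subset[OF _ finite_weight_le[of m]]) blast
  have sub: "env_word ` {w. sorted w \<and> weight w \<le> m} \<subseteq> carrier U" by auto
  show "finite_dim (U\<lparr>carrier := word_span m\<rparr>)"
    unfolding word_span_eq_sorted sorted_word_span_def
    by (rule finite_dim_lin_span[OF vectorspace_U finite_imageI[OF fin] sub])
  have "dimension (U\<lparr>carrier := word_span m\<rparr>) \<le> card (env_word ` {w. sorted w \<and> weight w \<le> m})"
    unfolding word_span_eq_sorted sorted_word_span_def
    by (rule dimension_lin_span[OF vectorspace_U finite_imageI[OF fin] sub])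
  also have "\<dots> \<le> card {w. sorted w \<and> weight w \<le> m}" by (rule card_image_le[OF fin])
  finally show "dimension (U\<lparr>carrier := word_span m\<rparr>) \<le> card {w. sorted w \<and> weight w \<le> m}" .
qed

text \<open>The empty word has weight 0, so the unit lies in every level of the filtration, and it
  is nonzero.\<close>

lemma dimension_word_span_pos: "dimension (U\<lparr>carrier := word_span m\<rparr>) \<ge> 1"
proof (rule dimension_pos[OF vU.subspace_is_vs[OF word_span_subspace] finite_dim_word_span])
  show "\<one>\<^bsub>U\<^esub> \<in> carrier (U\<lparr>carrier := word_span m\<rparr>)" using word_in_word_span[of "[]" m] by simp
  show "\<one>\<^bsub>U\<^esub> \<noteq> \<zero>\<^bsub>U\<lparr>carrier := word_span m\<rparr>\<^esub>" using one_envelope_nonzero[OF lie_W] by (simp add: U_def)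
qed

lemma dimension_word_span_slow:
  assumes "c > 0" "\<epsilon> > 0"
  shows "\<exists>n. real (dimension (U\<lparr>carrier := word_span (n + c)\<rparr>)) < (1 + \<epsilon>) * real (dimension (U\<lparr>carrier := word_span n\<rparr>))"
proof (rule subexponential_slow_step[OF dimension_word_span_pos _ assms])
  fix x :: real assume x: "0 < x" "x < 1"
  have "real (dimension (U\<lparr>carrier := word_span n\<rparr>)) * x ^ n \<le> exp (2 / (1 - x) ^ 2)" for n
  proof -
    have "real (dimension (U\<lparr>carrier := word_span n\<rparr>)) * x ^ n \<le> real (card {w. sorted w \<and> weight w \<le> n}) * x ^ n"
      using dimension_word_span_le[of n] x by (intro mult_right_mono) auto
    also have "\<dots> \<le> exp (2 / (1 - x) ^ 2)" by (rule card_sorted_weight_le[OF x])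
    finally show ?thesis .
  qed
  then show "\<exists>C. \<forall>n. real (dimension (U\<lparr>carrier := word_span n\<rparr>)) * x ^ n \<le> C" by blast
qed

lemma word_span_mono: "m \<le> m' \<Longrightarrow> word_span m \<subseteq> word_span m'"
  unfolding word_span_def by (rule lin_span_mono[OF vectorspace_U]) fastforce

text \<open>Prefixing e_i with |i| <= N adds |i| + 1 <= N + 1 to the weight; linearity in
  \<open>f\<close> and in \<open>u\<close> gives the general case. This fixes the step length for
  the growth argument.\<close>

lemma incl_mult_word_span:
  assumes f: "keys f \<subseteq> {-int N..int N}" and u: "u \<in> word_span m"
  shows "envelope_incl W f \<otimes>\<^bsub>U\<^esub> u \<in> word_span (m + Suc N)"
proof -
  note S = lin_subspaceD[OF word_span_subspace]
  have uc: "u \<in> carrier U" using S(2) u by blast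
  have ic: "envelope_incl W g \<in> carrier U" for g
    unfolding U_def by (rule envelope_incl_closed[OF lie_W W_carrier])
  have smult: "envelope_incl W (scale c g) = c \<odot>\<^bsub>U\<^esub> envelope_incl W g" for c g
    using envelope_incl_smult[OF lie_W W_carrier, of c g] by (simp add: W_def U_def witt_simps)
  have incl_add: "envelope_incl W (g + h) = envelope_incl W g \<oplus>\<^bsub>U\<^esub> envelope_incl W h" for g h
    using envelope_incl_add[OF lie_W W_carrier W_carrier, of g h] by (simp add: W_def U_def witt_simps)
  show ?thesis using f
  proof (induction rule: poly_mapping_induct_on)
    case zero
    have "scale 0 (0 :: int \<Rightarrow>\<^sub>0 'k) = 0" by (rule poly_mapping_eqI) simp
    then have "envelope_incl W 0 = \<zero>\<^bsub>U\<^esub>" using smult[of 0 0] vU.smult_l_null[OF ic[of 0]] by simp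
    then show ?case using S(3) uc by simp
  next
    case (add g h)
    then show ?case unfolding incl_add
      using U.l_distr[OF ic ic uc, of g h] S(4) by simp
  next
    case (single i c)
    have "env_gen i \<otimes>\<^bsub>U\<^esub> u \<in> word_span (m + Suc N)"
    proof (rule lin_span_collect[OF vectorspace_U _ u[unfolded word_span_def], where P = "\<lambda>u. env_gen i \<otimes>\<^bsub>U\<^esub> u \<in> word_span (m + Suc N)"])
      fix x assume "x \<in> {env_word w | w. weight w \<le> m}"
      then obtain w where "x = env_word w" "weight w \<le> m" by blast
      then show "env_gen i \<otimes>\<^bsub>U\<^esub> x \<in> word_span (m + Suc N)"
        using word_in_word_span[of "i # w" "m + Suc N"] single by auto
    qed (auto simp: S U_smult U.r_distr)
    then show ?case
      unfolding single_eq_smult[of i c] smult env_gen_def[symmetric] by (simp add: U_smult uc S)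
  qed
qed

text \<open>Letters are primitive, so the coproduct of a word distributes its letters over two
  tensor factors in all possible ways. Total weight is preserved, and hence neither factor exceeds
  the bound.\<close>

lemma comult_word_span:
  assumes "u \<in> word_span m"
  shows "comult W u \<in> lin_span (tensor U U) {pure_tensor U U a b | a b. a \<in> word_span m \<and> b \<in> word_span m}"
proof -
  have T: "assoc_algebra (tensor U U)" by (rule assoc_algebra_tensor[OF assoc_algebra_U assoc_algebra_U])
  interpret T: ring "tensor U U" by (rule assoc_algebraD(1)[OF T])
  interpret vT: vectorspace class_ring "tensor U U" by (rule assoc_algebraD(2)[OF T])
  have vsT: "vectorspace class_ring (tensor U U)" by (rule assoc_algebraD(2)[OF T])
  note Tsm = assoc_algebraD(3-5)[OF T]
  note pc = pure_tensor_closed[OF assoc_algebra_U assoc_algebra_U]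
    and pm = pure_tensor_mult[OF assoc_algebra_U assoc_algebra_U]
  note co = comult[OF lie_W, folded U_def]
  \<comment> \<open>Bounding the sum of the two weights, rather than each separately, is what makes
    the induction work: a new letter enters one factor or the other and raises the sum by exactly
    its own weight.\<close>
  define Y where "Y k = lin_span (tensor U U) {pure_tensor U U (env_word v) (env_word w) | v w. weight v + weight w \<le> k}" for k
  have gc: "{pure_tensor U U (env_word v) (env_word w) | v w. weight v + weight w \<le> k} \<subseteq> carrier (tensor U U)" for k
    using pc[OF env_word_closed env_word_closed] by blast
  have Ysub: "lin_subspace (Y k) (tensor U U)" for k
    unfolding Y_def by (rule lin_span_subspace[OF vsT gc])
  note S = lin_subspaceD[OF Ysub]
  have inY: "pure_tensor U U (env_word v) (env_word w) \<in> Y k" if "weight v + weight w \<le> k" for v w k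
    unfolding Y_def using that by (intro subsetD[OF lin_span_superset[OF vsT gc]]) blast
  have g: "comult W (env_gen i) = pure_tensor U U (env_gen i) \<one>\<^bsub>U\<^esub> \<oplus>\<^bsub>tensor U U\<^esub> pure_tensor U U \<one>\<^bsub>U\<^esub> (env_gen i)" for i
    unfolding env_gen_def using co(3)[OF W_carrier] by (simp add: U_def)
  have step: "comult W (env_gen i) \<otimes>\<^bsub>tensor U U\<^esub> z \<in> Y (nat \<bar>i\<bar> + 1 + k)" if z: "z \<in> Y k" for i k z
  proof (rule lin_span_collect[OF vsT gc z[unfolded Y_def], where P = "\<lambda>z. comult W (env_gen i) \<otimes>\<^bsub>tensor U U\<^esub> z \<in> Y (nat \<bar>i\<bar> + 1 + k)"])
    have c: "comult W (env_gen i) \<in> carrier (tensor U U)" unfolding g by (intro T.a_closed pc env_gen_closed U.one_closed)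
    show "comult W (env_gen i) \<otimes>\<^bsub>tensor U U\<^esub> \<zero>\<^bsub>tensor U U\<^esub> \<in> Y (nat \<bar>i\<bar> + 1 + k)" using c S(3) by simp
    show "comult W (env_gen i) \<otimes>\<^bsub>tensor U U\<^esub> (x \<oplus>\<^bsub>tensor U U\<^esub> y) \<in> Y (nat \<bar>i\<bar> + 1 + k)"
      if "x \<in> carrier (tensor U U)" "y \<in> carrier (tensor U U)" "comult W (env_gen i) \<otimes>\<^bsub>tensor U U\<^esub> x \<in> Y (nat \<bar>i\<bar> + 1 + k)"
        "comult W (env_gen i) \<otimes>\<^bsub>tensor U U\<^esub> y \<in> Y (nat \<bar>i\<bar> + 1 + k)" for x y
      using that c S(4) by (simp add: T.r_distr)
    show "comult W (env_gen i) \<otimes>\<^bsub>tensor U U\<^esub> (d \<odot>\<^bsub>tensor U U\<^esub> x) \<in> Y (nat \<bar>i\<bar> + 1 + k)"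
      if "x \<in> carrier (tensor U U)" "comult W (env_gen i) \<otimes>\<^bsub>tensor U U\<^esub> x \<in> Y (nat \<bar>i\<bar> + 1 + k)" for d x
      using that c S(5) by (simp add: Tsm)
    fix x assume "x \<in> {pure_tensor U U (env_word v) (env_word w) | v w. weight v + weight w \<le> k}"
    then obtain v w where vw: "x = pure_tensor U U (env_word v) (env_word w)" "weight v + weight w \<le> k" by blast
    have "comult W (env_gen i) \<otimes>\<^bsub>tensor U U\<^esub> x = pure_tensor U U (env_word (i # v)) (env_word w) \<oplus>\<^bsub>tensor U U\<^esub> pure_tensor U U (env_word v) (env_word (i # w))"
      unfolding g vw(1) by (simp add: T.l_distr pc pm)
    then show "comult W (env_gen i) \<otimes>\<^bsub>tensor U U\<^esub> x \<in> Y (nat \<bar>i\<bar> + 1 + k)"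
      using vw(2) by (simp del: word_prod_simps) (intro S(4) inY; simp)
  qed
  have word: "comult W (env_word w) \<in> Y (weight w)" for w
  proof (induction w)
    case Nil
    have "comult W \<one>\<^bsub>U\<^esub> = pure_tensor U U \<one>\<^bsub>U\<^esub> \<one>\<^bsub>U\<^esub>"
      using co(2) pure_tensor_one[OF assoc_algebra_U assoc_algebra_U] by (simp add: Ring.ring_hom_def)
    then show ?case using inY[of "[]" "[]" 0] by simp
  next
    case (Cons i w)
    have "comult W (env_word (i # w)) = comult W (env_gen i) \<otimes>\<^bsub>tensor U U\<^esub> comult W (env_word w)"
      using co(2) by (simp add: Ring.ring_hom_def)
    then show ?case using step[OF Cons.IH, of i] by simp
  qed
  let ?Z = "lin_span (tensor U U) {pure_tensor U U a b | a b. a \<in> word_span m \<and> b \<in> word_span m}"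
  have Ec: "a \<in> carrier U" if "a \<in> word_span m" for a using that lin_subspaceD(2)[OF word_span_subspace] by blast
  have Zc: "{pure_tensor U U a b | a b. a \<in> word_span m \<and> b \<in> word_span m} \<subseteq> carrier (tensor U U)" using pc Ec by blast
  have Zsub: "lin_subspace ?Z (tensor U U)" by (rule lin_span_subspace[OF vsT Zc])
  note Z = lin_subspaceD[OF Zsub]
  \<comment> \<open>If the sum of two weights is at most k <= m, then so is each of them.\<close>
  have YZ: "Y k \<subseteq> ?Z" if "k \<le> m" for k
    unfolding Y_def
  proof (rule lin_span_minimal[OF Zsub], rule subsetI)
    fix x assume "x \<in> {pure_tensor U U (env_word v) (env_word w) | v w. weight v + weight w \<le> k}"
    then obtain v w where vw: "x = pure_tensor U U (env_word v) (env_word w)" "weight v + weight w \<le> k" by blast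
    then have "env_word v \<in> word_span m" "env_word w \<in> word_span m" using that by (auto intro: word_in_word_span)
    then show "x \<in> ?Z" using lin_span_superset[OF vsT Zc] vw(1) by blast
  qed
  show ?thesis
  proof (rule lin_span_collect[OF vectorspace_U _ assms[unfolded word_span_def], where P = "\<lambda>u. comult W u \<in> ?Z"])
    have "comult W \<zero>\<^bsub>U\<^esub> = comult W ((0::'k) \<odot>\<^bsub>U\<^esub> \<zero>\<^bsub>U\<^esub>)"
      using vU.smult_r_null[of 0] by simp
    also have "\<dots> = 0 \<odot>\<^bsub>tensor U U\<^esub> comult W \<zero>\<^bsub>U\<^esub>"
      by (rule LinearCombinations.module_hom_smult[OF co(1)]) simp_all
    also have "\<dots> = \<zero>\<^bsub>tensor U U\<^esub>"
      using vT.smult_l_null[OF funcset_mem[OF LinearCombinations.module_hom_closed[OF co(1)] U.zero_closed]] by simp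
    finally show "comult W \<zero>\<^bsub>U\<^esub> \<in> ?Z" using Z(3) by simp
    show "comult W (x \<oplus>\<^bsub>U\<^esub> y) \<in> ?Z" if "x \<in> carrier U" "y \<in> carrier U" "comult W x \<in> ?Z" "comult W y \<in> ?Z" for x y
      unfolding LinearCombinations.module_hom_add[OF co(1) that(1,2)] by (rule Z(4)[OF that(3,4)])
    show "comult W (c \<odot>\<^bsub>U\<^esub> x) \<in> ?Z" if "x \<in> carrier U" "comult W x \<in> ?Z" for c x
      using LinearCombinations.module_hom_smult[OF co(1) _ that(1), of c] Z(5)[OF that(2)] by simp
    show "comult W x \<in> ?Z" if "x \<in> {env_word w | w. weight w \<le> m}" for x
      using that word YZ by blast
  qed auto
qed

lemma subcoalgebra_word_span: "subcoalgebra (word_span m) W"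
  unfolding subcoalgebra_def U_def[symmetric] using word_span_subspace comult_word_span by blast

text \<open>A finite spanning set involves finitely many indices, and linear combinations introduce
  no new ones.\<close>

lemma finite_dim_keys_bounded:
  assumes F: "lin_subspace F W" "finite_dim (W\<lparr>carrier := F\<rparr>)"
  obtains N where "\<And>f. f \<in> F \<Longrightarrow> keys f \<subseteq> {-int N..int N}"
proof -
  note Fs = lin_subspaceD[OF F(1)]
  interpret V: vectorspace class_ring W by (rule Fs(1))
  interpret F: vectorspace class_ring "W\<lparr>carrier := F\<rparr>" by (rule V.subspace_is_vs[OF F(1)])
  obtain A where A: "finite A" "A \<subseteq> F" "lin_span (W\<lparr>carrier := F\<rparr>) A = F"
    using F(2) unfolding F.fin_dim_def by auto
  have span: "lin_span W A = F" using lin_span_restrict[OF F(1) A(2)] A(3) by simp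
  \<comment> \<open>The sum of all the absolute values is a crude but convenient bound for the
    largest of them.\<close>
  define N where "N = (\<Sum>f\<in>A. \<Sum>i\<in>keys f. nat \<bar>i\<bar>)"
  have bd: "keys f \<subseteq> {-int N..int N}" if "f \<in> A" for f
  proof
    fix i assume i: "i \<in> keys f"
    have "nat \<bar>i\<bar> \<le> (\<Sum>i\<in>keys f. nat \<bar>i\<bar>)" by (rule member_le_sum[OF i]) auto
    also have "\<dots> \<le> N" unfolding N_def by (rule member_le_sum[OF that]) (use A(1) in auto)
    finally show "i \<in> {-int N..int N}" by auto
  qed
  have "keys f \<subseteq> {-int N..int N}" if "f \<in> F" for f
  proof (rule lin_span_collect[OF Fs(1), where P = "\<lambda>f. keys f \<subseteq> {-int N..int N}"])
    show "A \<subseteq> carrier W" using A(2) Fs(2) by blast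
    show "f \<in> lin_span W A" using that span by simp
    show "keys \<zero>\<^bsub>W\<^esub> \<subseteq> {-int N..int N}" by (simp add: W_def witt_simps)
    show "keys (x \<oplus>\<^bsub>W\<^esub> y) \<subseteq> {-int N..int N}"
      if "keys x \<subseteq> {-int N..int N}" "keys y \<subseteq> {-int N..int N}" for x y
      unfolding W_def witt_simps using that by (intro order_trans[OF Poly_Mapping.keys_add] Un_least)
    show "keys (c \<odot>\<^bsub>W\<^esub> x) \<subseteq> {-int N..int N}"
      if "keys x \<subseteq> {-int N..int N}" for c x
      unfolding W_def witt_simps using that by (rule order_trans[OF keys_map_mult])
  qed (rule bd)
  then show thesis by (rule that)
qed

text \<open>If \<open>F\<close> involves only indices up to N in absolute value, then E = E_n gives
  E + FE inside E_(n+N+1). Choosing n with dim E_(n+N+1) < (1 + \<epsilon>) dim E_n makes the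
  quotient smaller than \<epsilon> dim E_n.\<close>

lemma lie_amenable_W: "lie_amenable W"
  unfolding lie_amenable_def
proof (intro conjI allI impI, rule lie_W)
  fix F and \<epsilon> :: real
  assume as: "lin_subspace F W \<and> finite_dim (W\<lparr>carrier := F\<rparr>) \<and> 0 < \<epsilon>"
  obtain N where N: "\<And>f. f \<in> F \<Longrightarrow> keys f \<subseteq> {-int N..int N}"
    by (rule finite_dim_keys_bounded[of F]) (use as in auto)
  obtain n where n: "real (dimension (U\<lparr>carrier := word_span (n + Suc N)\<rparr>)) < (1 + \<epsilon>) * real (dimension (U\<lparr>carrier := word_span n\<rparr>))"
    using dimension_word_span_slow[of "Suc N" \<epsilon>] as by auto
  let ?FE = "lie_translate W F (word_span n)" and ?P = "{envelope_incl W f \<otimes>\<^bsub>U\<^esub> e | f e. f \<in> F \<and> e \<in> word_span n}"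
  let ?V = "word_span n <+>\<^bsub>U\<^esub> ?FE"
  have FE: "?FE = lin_span U ?P" unfolding lie_translate_def U_def ..
  have P: "?P \<subseteq> word_span (n + Suc N)" using incl_mult_word_span N by blast
  have Pc: "?P \<subseteq> carrier U" using P lin_subspaceD(2)[OF word_span_subspace] by blast
  have FEs: "lin_subspace ?FE U" unfolding FE by (rule lin_span_subspace[OF vectorspace_U Pc])
  have FEE: "?FE \<subseteq> word_span (n + Suc N)" unfolding FE by (rule lin_span_minimal[OF word_span_subspace P])
  note V = lin_subspace_set_add[OF word_span_subspace FEs, of n]
  have VE: "?V \<subseteq> word_span (n + Suc N)" by (rule set_add_subset[OF word_span_subspace word_span_mono FEE]) simp
  have fdV: "finite_dim (U\<lparr>carrier := ?V\<rparr>)"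
    by (rule finite_dim_mono[OF word_span_subspace V(1) VE finite_dim_word_span])
  have dV: "dimension (U\<lparr>carrier := ?V\<rparr>) \<le> dimension (U\<lparr>carrier := word_span (n + Suc N)\<rparr>)"
    by (rule dimension_mono[OF word_span_subspace V(1) VE finite_dim_word_span])
  \<comment> \<open>Rank-nullity inside the ambient space E + FE, so that the estimate for n only
    has to be subtracted.\<close>
  have "dimension (quotient_alg (U\<lparr>carrier := ?V\<rparr>) (word_span n)) + dimension (U\<lparr>carrier := word_span n\<rparr>) =
      dimension (U\<lparr>carrier := ?V\<rparr>)"
    using dimension_quotient_alg[OF lin_subspace_restrict[OF V(1) word_span_subspace V(2)] fdV] by simp
  then have "real (dimension (quotient_alg (U\<lparr>carrier := ?V\<rparr>) (word_span n))) < \<epsilon> * real (dimension (U\<lparr>carrier := word_span n\<rparr>))"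
    using n dV by (simp add: algebra_simps)
  then show "\<exists>word_span. subcoalgebra word_span W \<and> finite_dim ((envelope W)\<lparr>carrier := word_span\<rparr>) \<and>
      real (dimension (quotient_alg ((envelope W)\<lparr>carrier := word_span <+>\<^bsub>envelope W\<^esub> lie_translate W F word_span\<rparr>) word_span))
        < \<epsilon> * real (dimension ((envelope W)\<lparr>carrier := word_span\<rparr>))"
    unfolding U_def[symmetric] using subcoalgebra_word_span finite_dim_word_span by (intro exI[of _ "word_span n"] conjI)
qed

end

text \<open>The hypothesis makes the universe \<open>'u\<close> large enough to hold a copy of the
  Witt algebra, which then witnesses the difference between the two classes formed in it.\<close>

theorem corollary5p3:
  assumes "(UNIV :: (int \<Rightarrow>\<^sub>0 'k::field_char_0) set) \<lesssim> (UNIV :: 'u set)"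
  shows "lie_amenable (witt :: ('k, int \<Rightarrow>\<^sub>0 'k) module) \<and>
    \<not> elementarily_amenable TYPE('u) (witt :: ('k, int \<Rightarrow>\<^sub>0 'k) module) \<and>
    (EL :: ('k, 'u) module set) \<noteq> SL"
  using lie_amenable_W[OF refl refl] not_elementarily_amenable_witt EL_neq_SL[OF assms] by blast

end
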